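(* Let $\mathcal C_1,\mathcal C_2$ be (suspended, triangulated) symmetric monoidal closed categories, $f^*:\mathcal C_1\to\mathcal C_2$ a (suspended, exact) symmetric monoidal functor with structure isomorphism of (suspended) bifunctors $\alpha:f^*(-)\otimes f^*( * )\to f^*(-\otimes * )$, and let $K,M$ be objects of $\mathcal C_1$. Then $\alpha$ is an isomorphism of duality preserving functors from $$I_{\alpha_{K,M}}\{-\otimes *,\tau_{f^*K,f^*M}\}\{f^*\times f^*,\beta_K\times\beta_M\}\quad\text{to}\quad\{f^*,\beta_{K\otimes M}\}\{-\otimes *,\tau_{K,M}\},$$ both being duality preserving functors from $(\mathcal C_1\times\mathcal C_1,D_K\times D_M,\varpi_K\times\varpi_M)$ to $(\mathcal C_2,D_{f^*(K\otimes M)},\varpi_{f^*(K\otimes M)})$.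
   Context: Closed categories. A symmetric monoidal closed category $(\mathcal C,\otimes)$ (with symmetry $s$) has an internal Hom $[-,-]$ with adjunctions $(-\otimes X)\dashv[X,-]$ natural in $X$, with counit $\mathrm{ev}^l_{X,A}:[X,A]\otimes X\to A$ and unit $\mathrm{coev}^l_{X,A}:A\to[X,A\otimes X]$. Put $\mathrm{ev}^r_{A,K}=\mathrm{ev}^l_{A,K}\circ s$. Dualities. For an object $K$, $D_K=[-,K]:\mathcal C\to\mathcal C^o$, with opposite functor $D_K^o$, and $\varpi_K:\mathrm{Id}\to D_K^oD_K$ has component $\varpi_{K,A}:A\to[[A,K],K]$ corresponding to $\mathrm{ev}^r_{A,K}:A\otimes[A,K]\to K$ under $(-\otimes[A,K])\dashv[[A,K],-]$. A duality preserving functor $\{F,\phi\}:(\mathcal C_1,D_1,\varpi_1)\to(\mathcal C_2,D_2,\varpi_2)$ is a functor $F$ and a natural transformation $\phi:FD_1^o\to D_2^oF^o$ (components $\phi_A:FD_1A\to D_2FA$) with $\phi_{D_1A}\circ F(\varpi_{1,A})=D_2(\phi_A)\circ\varpi_{2,FA}$ for all $A$. Composition: $\{F',\phi'\}\{F,\phi\}=\{F'F,\phi'F^o\circ F'\phi\}$. A morphism (resp. isomorphism) $\{F,\phi\}\to\{F',\phi'\}$ is a natural transformation (resp. isomorphism) $\rho:F\to F'$ with $\phi_A=D_2(\rho_A)\circ\phi'_A\circ\rho_{D_1A}$ for all $A$. A morphism $\iota:K\to M$ induces the duality preserving functor $I_\iota=\{\mathrm{Id},\tilde\iota\}:(\mathcal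 C,D_K,\varpi_K)\to(\mathcal C,D_M,\varpi_M)$, where $\tilde\iota:[-,K]\to[-,M]$ is composition with $\iota$. Product. Let $\varrho:(A\otimes B)\otimes(C\otimes D)\to(A\otimes C)\otimes(B\otimes D)$ be the isomorphism exchanging the two middle factors, built from associativity and symmetry. $\tau_{K,M}:D_K(A)\otimes D_M(B)\to D_{K\otimes M}(A\otimes B)$ is the composition $[A,K]\otimes[B,M]\xrightarrow{\mathrm{coev}^l}[A\otimes B,([A,K]\otimes[B,M])\otimes(A\otimes B)]\xrightarrow{\varrho}[A\otimes B,([A,K]\otimes A)\otimes([B,M]\otimes B)]\xrightarrow{\mathrm{ev}^l\otimes\mathrm{ev}^l}[A\otimes B,K\otimes M]$. $\{-\otimes*,\tau_{K,M}\}$ is a duality preserving functor from $(\mathcal C\times\mathcal C,D_K\times D_M,\varpi_K\times\varpi_M)$ to $(\mathcal C,D_{K\otimes M},\varpi_{K\otimes M})$. Pull-back. A symmetric monoidal functor $f^*$ comes with a natural isomorphism $\alpha_{A,B}:f^*A\otimes f^*B\to f^*(A\otimes B)$ compatible with associativity and symmetry (and units, when considered); in the suspended setting $\alpha$ is by assumption an isomorphism of suspended bifunctors, i.e. compatible with the isomorphisms moving the suspension $T$ out of either variable. $\beta_{A,K}$ is the composition $f^*[A,K]\xrightarrow{\mathrm{coev}^l}[f^*A,f^*[A,K]\otimes f^*A]\xrightarrow{\alpha}[f^*A,f^*([A,K]\otimes A)]\xrightarrow{\mathrm{ev}^l}[f^*A,f^*K]$; $\{f^*,\beta_K\}$ is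 a duality preserving functor from $D_K$ to $D_{f^*K}$. *)

theory Defs
  imports "HOL-Algebra.Group"
begin

section \<open>Categories, functors, natural transformations\<close>

text \<open>Objects and arrows of a category are elements of carrier sets; \<open>Comp C g f\<close> is
  \<open>g\<close> after \<open>f\<close>. Values of the operations outside the carriers are irrelevant: all
  predicates below are relativised.\<close>

record ('o, 'a) category_data =
  Ob :: "'o set"
  Ar :: "'a set"
  Dom :: "'a \<Rightarrow> 'o"
  Cod :: "'a \<Rightarrow> 'o"
  Ide :: "'o \<Rightarrow> 'a"
  Comp :: "'a \<Rightarrow> 'a \<Rightarrow> 'a"  (infixr \<open>\<cdot>\<index>\<close> 70)

definition Hom :: "('o, 'a, 'm) category_data_scheme \<Rightarrow> 'o \<Rightarrow> 'o \<Rightarrow> 'a set" where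
  "Hom C A B = {f \<in> Ar C. Dom C f = A \<and> Cod C f = B}"

locale category =
  fixes C :: "('o, 'a, 'm) category_data_scheme" (structure)
  assumes dom_closed: "f \<in> Ar C \<Longrightarrow> Dom C f \<in> Ob C"
    and cod_closed: "f \<in> Ar C \<Longrightarrow> Cod C f \<in> Ob C"
    and ide_closed: "A \<in> Ob C \<Longrightarrow> Ide C A \<in> Hom C A A"
    and comp_closed: "\<lbrakk>f \<in> Hom C A B; g \<in> Hom C B E\<rbrakk> \<Longrightarrow> g \<cdot> f \<in> Hom C A E"
    and comp_ide_left: "f \<in> Hom C A B \<Longrightarrow> Ide C B \<cdot> f = f"
    and comp_ide_right: "f \<in> Hom C A B \<Longrightarrow> f \<cdot> Ide C A = f"
    and comp_assoc:
      "\<lbrakk>f \<in> Hom C A B; g \<in> Hom C B E; h \<in> Hom C E G\<rbrakk> \<Longrightarrow> (h \<cdot> g) \<cdot> f = h \<cdot> (g \<cdot> f)"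

definition inverse_arrows :: "('o, 'a, 'm) category_data_scheme \<Rightarrow> 'a \<Rightarrow> 'a \<Rightarrow> bool" where
  "inverse_arrows C f g \<longleftrightarrow>
     f \<in> Ar C \<and> g \<in> Hom C (Cod C f) (Dom C f) \<and>
     g \<cdot>\<^bsub>C\<^esub> f = Ide C (Dom C f) \<and> f \<cdot>\<^bsub>C\<^esub> g = Ide C (Cod C f)"

definition is_isomorphism :: "('o, 'a, 'm) category_data_scheme \<Rightarrow> 'a \<Rightarrow> bool" where
  "is_isomorphism C f \<longleftrightarrow> (\<exists>g. inverse_arrows C f g)"

definition inverse_arrow :: "('o, 'a, 'm) category_data_scheme \<Rightarrow> 'a \<Rightarrow> 'a" where
  "inverse_arrow C f = (THE g. inverse_arrows C f g)"

definition op_cat :: "('o, 'a, 'm) category_data_scheme \<Rightarrow> ('o, 'a) category_data" where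
  "op_cat C = \<lparr>Ob = Ob C, Ar = Ar C, Dom = Cod C, Cod = Dom C, Ide = Ide C,
     Comp = (\<lambda>g f. f \<cdot>\<^bsub>C\<^esub> g)\<rparr>"

definition prod_cat :: "('o, 'a, 'm) category_data_scheme \<Rightarrow> ('p, 'b, 'n) category_data_scheme
    \<Rightarrow> ('o \<times> 'p, 'a \<times> 'b) category_data" where
  "prod_cat C D = \<lparr>Ob = Ob C \<times> Ob D, Ar = Ar C \<times> Ar D,
     Dom = map_prod (Dom C) (Dom D), Cod = map_prod (Cod C) (Cod D),
     Ide = map_prod (Ide C) (Ide D),
     Comp = (\<lambda>g f. (fst g \<cdot>\<^bsub>C\<^esub> fst f, snd g \<cdot>\<^bsub>D\<^esub> snd f))\<rparr>"

text \<open>A functor is recorded without its source and target, so the opposite functor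
  \<open>F\<^sup>o : C\<^sup>o \<rightarrow> D\<^sup>o\<close> of \<open>F : C \<rightarrow> D\<close> has the same data as \<open>F\<close>.\<close>

record ('o, 'a, 'p, 'b) functor_data =
  fo :: "'o \<Rightarrow> 'p"
  fa :: "'a \<Rightarrow> 'b"

definition is_functor :: "('o, 'a, 'm) category_data_scheme \<Rightarrow> ('p, 'b, 'n) category_data_scheme
    \<Rightarrow> ('o, 'a, 'p, 'b) functor_data \<Rightarrow> bool" where
  "is_functor C D F \<longleftrightarrow>
     (\<forall>A\<in>Ob C. fo F A \<in> Ob D) \<and>
     (\<forall>A B. \<forall>f\<in>Hom C A B. fa F f \<in> Hom D (fo F A) (fo F B)) \<and>
     (\<forall>A\<in>Ob C. fa F (Ide C A) = Ide D (fo F A)) \<and>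
     (\<forall>A B E. \<forall>f\<in>Hom C A B. \<forall>g\<in>Hom C B E. fa F (g \<cdot>\<^bsub>C\<^esub> f) = fa F g \<cdot>\<^bsub>D\<^esub> fa F f)"

definition id_functor :: "('o, 'a, 'o, 'a) functor_data" where
  "id_functor = \<lparr>fo = (\<lambda>A. A), fa = (\<lambda>f. f)\<rparr>"

definition comp_functor :: "('p, 'b, 'q, 'c) functor_data \<Rightarrow> ('o, 'a, 'p, 'b) functor_data
    \<Rightarrow> ('o, 'a, 'q, 'c) functor_data"  (infixr \<open>\<circ>\<^sub>F\<close> 55) where
  "G \<circ>\<^sub>F F = \<lparr>fo = fo G \<circ> fo F, fa = fa G \<circ> fa F\<rparr>"

definition prod_functor :: "('o, 'a, 'p, 'b) functor_data \<Rightarrow> ('o', 'a', 'p', 'b') functor_data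
    \<Rightarrow> ('o \<times> 'o', 'a \<times> 'a', 'p \<times> 'p', 'b \<times> 'b') functor_data"  (infixr \<open>\<times>\<^sub>F\<close> 80) where
  "F \<times>\<^sub>F G = \<lparr>fo = map_prod (fo F) (fo G), fa = map_prod (fa F) (fa G)\<rparr>"

definition nat_trans :: "('o, 'a, 'm) category_data_scheme \<Rightarrow> ('p, 'b, 'n) category_data_scheme
    \<Rightarrow> ('o, 'a, 'p, 'b) functor_data \<Rightarrow> ('o, 'a, 'p, 'b) functor_data \<Rightarrow> ('o \<Rightarrow> 'b) \<Rightarrow> bool" where
  "nat_trans C D F G \<eta> \<longleftrightarrow>
     is_functor C D F \<and> is_functor C D G \<and>
     (\<forall>A\<in>Ob C. \<eta> A \<in> Hom D (fo F A) (fo G A)) \<and>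
     (\<forall>A B. \<forall>f\<in>Hom C A B. \<eta> B \<cdot>\<^bsub>D\<^esub> fa F f = fa G f \<cdot>\<^bsub>D\<^esub> \<eta> A)"

definition nat_iso :: "('o, 'a, 'm) category_data_scheme \<Rightarrow> ('p, 'b, 'n) category_data_scheme
    \<Rightarrow> ('o, 'a, 'p, 'b) functor_data \<Rightarrow> ('o, 'a, 'p, 'b) functor_data \<Rightarrow> ('o \<Rightarrow> 'b) \<Rightarrow> bool" where
  "nat_iso C D F G \<eta> \<longleftrightarrow> nat_trans C D F G \<eta> \<and> (\<forall>A\<in>Ob C. is_isomorphism D (\<eta> A))"

definition equivalence_functor :: "('o, 'a, 'm) category_data_scheme
    \<Rightarrow> ('p, 'b, 'n) category_data_scheme \<Rightarrow> ('o, 'a, 'p, 'b) functor_data \<Rightarrow> bool" where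
  "equivalence_functor C D F \<longleftrightarrow> is_functor C D F \<and>
     (\<exists>G \<eta> \<epsilon>. is_functor D C G \<and> nat_iso C C id_functor (G \<circ>\<^sub>F F) \<eta> \<and>
       nat_iso D D (F \<circ>\<^sub>F G) id_functor \<epsilon>)"


section \<open>Symmetric monoidal closed categories\<close>

record ('o, 'a) smcc_data = "('o, 'a) category_data" +
  Tensor :: "('o \<times> 'o, 'a \<times> 'a, 'o, 'a) functor_data"
  Unit :: "'o"
  Assoc :: "'o \<Rightarrow> 'o \<Rightarrow> 'o \<Rightarrow> 'a"
  Lunit :: "'o \<Rightarrow> 'a"
  Runit :: "'o \<Rightarrow> 'a"
  Swap :: "'o \<Rightarrow> 'o \<Rightarrow> 'a"
  IHom :: "('o \<times> 'o, 'a \<times> 'a, 'o, 'a) functor_data"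
  Ev :: "'o \<Rightarrow> 'o \<Rightarrow> 'a"
  Coev :: "'o \<Rightarrow> 'o \<Rightarrow> 'a"

text \<open>\<open>A \<odot> B\<close> and \<open>f \<star> g\<close> are the tensor product of objects and of arrows,
  \<open>A \<rightarrowtail> B\<close> and \<open>f \<Zinj> g\<close> are the internal Hom \<open>[A, B]\<close> of objects and of arrows (the latter
  contravariant in \<open>f\<close>).\<close>

abbreviation tensor_ob :: "('o, 'a, 'm) smcc_data_scheme \<Rightarrow> 'o \<Rightarrow> 'o \<Rightarrow> 'o"
    (\<open>(_ \<odot>\<index> _)\<close> [76, 76] 75) where
  "A \<odot>\<^bsub>C\<^esub> B \<equiv> fo (Tensor C) (A, B)"

abbreviation tensor_ar :: "('o, 'a, 'm) smcc_data_scheme \<Rightarrow> 'a \<Rightarrow> 'a \<Rightarrow> 'a"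
    (\<open>(_ \<star>\<index> _)\<close> [76, 76] 75) where
  "f \<star>\<^bsub>C\<^esub> g \<equiv> fa (Tensor C) (f, g)"

abbreviation ihom_ob :: "('o, 'a, 'm) smcc_data_scheme \<Rightarrow> 'o \<Rightarrow> 'o \<Rightarrow> 'o"
    (\<open>(_ \<rightarrowtail>\<index> _)\<close> [78, 78] 77) where
  "A \<rightarrowtail>\<^bsub>C\<^esub> B \<equiv> fo (IHom C) (A, B)"

abbreviation ihom_ar :: "('o, 'a, 'm) smcc_data_scheme \<Rightarrow> 'a \<Rightarrow> 'a \<Rightarrow> 'a"
    (\<open>(_ \<Zinj>\<index> _)\<close> [78, 78] 77) where
  "f \<Zinj>\<^bsub>C\<^esub> g \<equiv> fa (IHom C) (f, g)"

text \<open>The arrow \<open>A \<rightarrow> [X, B]\<close> corresponding to \<open>g : A \<otimes> X \<rightarrow> B\<close>.\<close>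

definition curry_arrow :: "('o, 'a, 'm) smcc_data_scheme \<Rightarrow> 'o \<Rightarrow> 'o \<Rightarrow> 'a \<Rightarrow> 'a" where
  "curry_arrow C A X g = (Ide C X \<Zinj>\<^bsub>C\<^esub> g) \<cdot>\<^bsub>C\<^esub> Coev C X A"

locale symmetric_monoidal_category = category C
  for C :: "('o, 'a, 'm) smcc_data_scheme" (structure) +
  assumes tensor_functor: "is_functor (prod_cat C C) C (Tensor C)"
    and unit_closed: "Unit C \<in> Ob C"
    and assoc_closed: "\<lbrakk>A \<in> Ob C; B \<in> Ob C; E \<in> Ob C\<rbrakk>
      \<Longrightarrow> Assoc C A B E \<in> Hom C ((A \<odot> B) \<odot> E) (A \<odot> (B \<odot> E))"
    and assoc_iso: "\<lbrakk>A \<in> Ob C; B \<in> Ob C; E \<in> Ob C\<rbrakk> \<Longrightarrow> is_isomorphism C (Assoc C A B E)"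
    and assoc_natural: "\<lbrakk>f \<in> Hom C A A'; g \<in> Hom C B B'; h \<in> Hom C E E'\<rbrakk>
      \<Longrightarrow> Assoc C A' B' E' \<cdot> ((f \<star> g) \<star> h) = (f \<star> (g \<star> h)) \<cdot> Assoc C A B E"
    and lunit_nat_iso: "nat_iso C C \<lparr>fo = (\<lambda>A. Unit C \<odot> A), fa = (\<lambda>f. Ide C (Unit C) \<star> f)\<rparr>
      id_functor (Lunit C)"
    and runit_nat_iso: "nat_iso C C \<lparr>fo = (\<lambda>A. A \<odot> Unit C), fa = (\<lambda>f. f \<star> Ide C (Unit C))\<rparr>
      id_functor (Runit C)"
    and swap_closed: "\<lbrakk>A \<in> Ob C; B \<in> Ob C\<rbrakk> \<Longrightarrow> Swap C A B \<in> Hom C (A \<odot> B) (B \<odot> A)"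
    and swap_natural: "\<lbrakk>f \<in> Hom C A A'; g \<in> Hom C B B'\<rbrakk>
      \<Longrightarrow> Swap C A' B' \<cdot> (f \<star> g) = (g \<star> f) \<cdot> Swap C A B"
    and swap_swap: "\<lbrakk>A \<in> Ob C; B \<in> Ob C\<rbrakk> \<Longrightarrow> Swap C B A \<cdot> Swap C A B = Ide C (A \<odot> B)"
    and pentagon: "\<lbrakk>A \<in> Ob C; B \<in> Ob C; E \<in> Ob C; G \<in> Ob C\<rbrakk>
      \<Longrightarrow> Assoc C A B (E \<odot> G) \<cdot> Assoc C (A \<odot> B) E G =
          (Ide C A \<star> Assoc C B E G) \<cdot> Assoc C A (B \<odot> E) G \<cdot> (Assoc C A B E \<star> Ide C G)"
    and triangle: "\<lbrakk>A \<in> Ob C; B \<in> Ob C\<rbrakk>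
      \<Longrightarrow> (Ide C A \<star> Lunit C B) \<cdot> Assoc C A (Unit C) B = Runit C A \<star> Ide C B"
    and hexagon: "\<lbrakk>A \<in> Ob C; B \<in> Ob C; E \<in> Ob C\<rbrakk>
      \<Longrightarrow> Assoc C B E A \<cdot> Swap C A (B \<odot> E) \<cdot> Assoc C A B E =
          (Ide C B \<star> Swap C A E) \<cdot> Assoc C B A E \<cdot> (Swap C A B \<star> Ide C E)"

text \<open>The adjunctions \<open>(- \<otimes> X) \<stileturn> [X, -]\<close> are given by counit and unit; the last axiom says
  that the bijections \<open>Hom (A \<otimes> X) B \<cong> Hom A [X, B]\<close> are natural in \<open>X\<close>.\<close>

locale symmetric_monoidal_closed_category = symmetric_monoidal_category C
  for C :: "('o, 'a, 'm) smcc_data_scheme" (structure) +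
  assumes ihom_functor: "is_functor (prod_cat (op_cat C) C) C (IHom C)"
    and ev_closed: "\<lbrakk>X \<in> Ob C; A \<in> Ob C\<rbrakk> \<Longrightarrow> Ev C X A \<in> Hom C ((X \<rightarrowtail> A) \<odot> X) A"
    and ev_natural: "\<lbrakk>X \<in> Ob C; f \<in> Hom C A B\<rbrakk>
      \<Longrightarrow> Ev C X B \<cdot> ((Ide C X \<Zinj> f) \<star> Ide C X) = f \<cdot> Ev C X A"
    and coev_closed: "\<lbrakk>X \<in> Ob C; A \<in> Ob C\<rbrakk> \<Longrightarrow> Coev C X A \<in> Hom C A (X \<rightarrowtail> (A \<odot> X))"
    and coev_natural: "\<lbrakk>X \<in> Ob C; f \<in> Hom C A B\<rbrakk>
      \<Longrightarrow> Coev C X B \<cdot> f = (Ide C X \<Zinj> (f \<star> Ide C X)) \<cdot> Coev C X A"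
    and ev_coev: "\<lbrakk>X \<in> Ob C; A \<in> Ob C\<rbrakk>
      \<Longrightarrow> Ev C X (A \<odot> X) \<cdot> (Coev C X A \<star> Ide C X) = Ide C (A \<odot> X)"
    and coev_ev: "\<lbrakk>X \<in> Ob C; A \<in> Ob C\<rbrakk>
      \<Longrightarrow> (Ide C X \<Zinj> Ev C X A) \<cdot> Coev C X (X \<rightarrowtail> A) = Ide C (X \<rightarrowtail> A)"
    and curry_natural: "\<lbrakk>A \<in> Ob C; x \<in> Hom C X X'; g \<in> Hom C (A \<odot> X') B\<rbrakk>
      \<Longrightarrow> (x \<Zinj> Ide C B) \<cdot> curry_arrow C A X' g = curry_arrow C A X (g \<cdot> (Ide C A \<star> x))"

text \<open>A symmetric monoidal functor \<open>{f, \<alpha>}\<close>. Compatibility with units is not required.\<close>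

definition symmetric_monoidal_functor :: "('o, 'a, 'm) smcc_data_scheme
    \<Rightarrow> ('p, 'b, 'n) smcc_data_scheme \<Rightarrow> ('o, 'a, 'p, 'b) functor_data \<Rightarrow> ('o \<times> 'o \<Rightarrow> 'b) \<Rightarrow> bool"
  where
  "symmetric_monoidal_functor C D f \<alpha> \<longleftrightarrow>
     is_functor C D f \<and>
     nat_iso (prod_cat C C) D (Tensor D \<circ>\<^sub>F f \<times>\<^sub>F f) (f \<circ>\<^sub>F Tensor C) \<alpha> \<and>
     (\<forall>A\<in>Ob C. \<forall>B\<in>Ob C. \<forall>E\<in>Ob C.
        fa f (Assoc C A B E) \<cdot>\<^bsub>D\<^esub> \<alpha> (A \<odot>\<^bsub>C\<^esub> B, E) \<cdot>\<^bsub>D\<^esub> (\<alpha> (A, B) \<star>\<^bsub>D\<^esub> Ide D (fo f E)) =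
        \<alpha> (A, B \<odot>\<^bsub>C\<^esub> E) \<cdot>\<^bsub>D\<^esub> (Ide D (fo f A) \<star>\<^bsub>D\<^esub> \<alpha> (B, E)) \<cdot>\<^bsub>D\<^esub>
          Assoc D (fo f A) (fo f B) (fo f E)) \<and>
     (\<forall>A\<in>Ob C. \<forall>B\<in>Ob C.
        fa f (Swap C A B) \<cdot>\<^bsub>D\<^esub> \<alpha> (A, B) = \<alpha> (B, A) \<cdot>\<^bsub>D\<^esub> Swap D (fo f A) (fo f B))"


section \<open>Dualities and duality preserving functors\<close>

text \<open>A category with duality \<open>(C, D, \<varpi>)\<close>, where \<open>D : C \<rightarrow> C\<^sup>o\<close> and \<open>\<varpi>\<^sub>A : A \<rightarrow> D D A\<close>,
  is represented as a triple; a duality preserving functor \<open>{F, \<phi>}\<close> as a pair.\<close>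

definition prod_duality ::
  "('o, 'a, 'm) category_data_scheme \<times> ('o, 'a, 'o, 'a) functor_data \<times> ('o \<Rightarrow> 'a)
    \<Rightarrow> ('p, 'b, 'n) category_data_scheme \<times> ('p, 'b, 'p, 'b) functor_data \<times> ('p \<Rightarrow> 'b)
    \<Rightarrow> ('o \<times> 'p, 'a \<times> 'b) category_data \<times> ('o \<times> 'p, 'a \<times> 'b, 'o \<times> 'p, 'a \<times> 'b) functor_data
        \<times> ('o \<times> 'p \<Rightarrow> 'a \<times> 'b)" where
  "prod_duality X Y = (case (X, Y) of ((C, D, \<omega>), (C', D', \<omega>')) \<Rightarrow>
     (prod_cat C C', D \<times>\<^sub>F D', map_prod \<omega> \<omega>'))"

definition duality_preserving_functor ::
  "('o, 'a, 'm) category_data_scheme \<times> ('o, 'a, 'o, 'a) functor_data \<times> ('o \<Rightarrow> 'a)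
    \<Rightarrow> ('p, 'b, 'n) category_data_scheme \<times> ('p, 'b, 'p, 'b) functor_data \<times> ('p \<Rightarrow> 'b)
    \<Rightarrow> ('o, 'a, 'p, 'b) functor_data \<times> ('o \<Rightarrow> 'b) \<Rightarrow> bool" where
  "duality_preserving_functor X Y \<Phi> =
     (case (X, Y, \<Phi>) of ((C1, D1, \<omega>1), (C2, D2, \<omega>2), (F, \<phi>)) \<Rightarrow>
       is_functor C1 C2 F \<and>
       nat_trans (op_cat C1) C2 (F \<circ>\<^sub>F D1) (D2 \<circ>\<^sub>F F) \<phi> \<and>
       (\<forall>A\<in>Ob C1. \<phi> (fo D1 A) \<cdot>\<^bsub>C2\<^esub> fa F (\<omega>1 A) = fa D2 (\<phi> A) \<cdot>\<^bsub>C2\<^esub> \<omega>2 (fo F A)))"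

text \<open>\<open>dp_comp D {F', \<phi>'} {F, \<phi>} = {F' F, \<phi>' F\<^sup>o \<circ> F' \<phi>}\<close>, where \<open>D\<close> is the target category.\<close>

definition dp_comp :: "('q, 'c, 'm) category_data_scheme
    \<Rightarrow> ('p, 'b, 'q, 'c) functor_data \<times> ('p \<Rightarrow> 'c) \<Rightarrow> ('o, 'a, 'p, 'b) functor_data \<times> ('o \<Rightarrow> 'b)
    \<Rightarrow> ('o, 'a, 'q, 'c) functor_data \<times> ('o \<Rightarrow> 'c)" where
  "dp_comp D \<Phi>' \<Phi> = (case (\<Phi>', \<Phi>) of ((F', \<phi>'), (F, \<phi>)) \<Rightarrow>
     (F' \<circ>\<^sub>F F, \<lambda>A. \<phi>' (fo F A) \<cdot>\<^bsub>D\<^esub> fa F' (\<phi> A)))"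

definition dp_prod :: "('o, 'a, 'p, 'b) functor_data \<times> ('o \<Rightarrow> 'b)
    \<Rightarrow> ('o', 'a', 'p', 'b') functor_data \<times> ('o' \<Rightarrow> 'b')
    \<Rightarrow> ('o \<times> 'o', 'a \<times> 'a', 'p \<times> 'p', 'b \<times> 'b') functor_data \<times> ('o \<times> 'o' \<Rightarrow> 'b \<times> 'b')" where
  "dp_prod \<Phi> \<Psi> = (fst \<Phi> \<times>\<^sub>F fst \<Psi>, map_prod (snd \<Phi>) (snd \<Psi>))"

definition duality_preserving_iso ::
  "('o, 'a, 'm) category_data_scheme \<times> ('o, 'a, 'o, 'a) functor_data \<times> ('o \<Rightarrow> 'a)
    \<Rightarrow> ('p, 'b, 'n) category_data_scheme \<times> ('p, 'b, 'p, 'b) functor_data \<times> ('p \<Rightarrow> 'b)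
    \<Rightarrow> ('o, 'a, 'p, 'b) functor_data \<times> ('o \<Rightarrow> 'b) \<Rightarrow> ('o, 'a, 'p, 'b) functor_data \<times> ('o \<Rightarrow> 'b)
    \<Rightarrow> ('o \<Rightarrow> 'b) \<Rightarrow> bool" where
  "duality_preserving_iso X Y \<Phi> \<Phi>' \<rho> \<longleftrightarrow>
     duality_preserving_functor X Y \<Phi> \<and> duality_preserving_functor X Y \<Phi>' \<and>
     (case (X, Y, \<Phi>, \<Phi>') of ((C1, D1, \<omega>1), (C2, D2, \<omega>2), (F, \<phi>), (F', \<phi>')) \<Rightarrow>
       nat_iso C1 C2 F F' \<rho> \<and>
       (\<forall>A\<in>Ob C1. \<phi> A = fa D2 (\<rho> A) \<cdot>\<^bsub>C2\<^esub> \<phi>' A \<cdot>\<^bsub>C2\<^esub> \<rho> (fo D1 A)))"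

definition dual_functor :: "('o, 'a, 'm) smcc_data_scheme \<Rightarrow> 'o \<Rightarrow> ('o, 'a, 'o, 'a) functor_data"
  where "dual_functor C K = \<lparr>fo = (\<lambda>A. A \<rightarrowtail>\<^bsub>C\<^esub> K), fa = (\<lambda>f. f \<Zinj>\<^bsub>C\<^esub> Ide C K)\<rparr>"

definition ev_right :: "('o, 'a, 'm) smcc_data_scheme \<Rightarrow> 'o \<Rightarrow> 'o \<Rightarrow> 'a" where
  "ev_right C A K = Ev C A K \<cdot>\<^bsub>C\<^esub> Swap C A (A \<rightarrowtail>\<^bsub>C\<^esub> K)"

definition bidual :: "('o, 'a, 'm) smcc_data_scheme \<Rightarrow> 'o \<Rightarrow> 'o \<Rightarrow> 'a" where
  "bidual C K A = curry_arrow C A (A \<rightarrowtail>\<^bsub>C\<^esub> K) (ev_right C A K)"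

definition with_duality :: "('o, 'a, 'm) smcc_data_scheme \<Rightarrow> 'o
    \<Rightarrow> ('o, 'a, 'm) smcc_data_scheme \<times> ('o, 'a, 'o, 'a) functor_data \<times> ('o \<Rightarrow> 'a)" where
  "with_duality C K = (C, dual_functor C K, bidual C K)"

text \<open>The functor \<open>I\<^sub>\<iota>\<close>, for \<open>\<iota> : K \<rightarrow> M\<close>.\<close>

definition change_dualizing :: "('o, 'a, 'm) smcc_data_scheme \<Rightarrow> 'a
    \<Rightarrow> ('o, 'a, 'o, 'a) functor_data \<times> ('o \<Rightarrow> 'a)" where
  "change_dualizing C \<iota> = (id_functor, \<lambda>A. Ide C A \<Zinj>\<^bsub>C\<^esub> \<iota>)"

text \<open>\<open>(A \<otimes> B) \<otimes> (E \<otimes> G) \<rightarrow> (A \<otimes> E) \<otimes> (B \<otimes> G)\<close>\<close>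

definition middle_swap :: "('o, 'a, 'm) smcc_data_scheme \<Rightarrow> 'o \<Rightarrow> 'o \<Rightarrow> 'o \<Rightarrow> 'o \<Rightarrow> 'a" where
  "middle_swap C A B E G =
     inverse_arrow C (Assoc C A E (B \<odot>\<^bsub>C\<^esub> G)) \<cdot>\<^bsub>C\<^esub>
     (Ide C A \<star>\<^bsub>C\<^esub> Assoc C E B G) \<cdot>\<^bsub>C\<^esub>
     (Ide C A \<star>\<^bsub>C\<^esub> (Swap C B E \<star>\<^bsub>C\<^esub> Ide C G)) \<cdot>\<^bsub>C\<^esub>
     (Ide C A \<star>\<^bsub>C\<^esub> inverse_arrow C (Assoc C B E G)) \<cdot>\<^bsub>C\<^esub>
     Assoc C A B (E \<odot>\<^bsub>C\<^esub> G)"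

definition tau :: "('o, 'a, 'm) smcc_data_scheme \<Rightarrow> 'o \<Rightarrow> 'o \<Rightarrow> 'o \<times> 'o \<Rightarrow> 'a" where
  "tau C K M = (\<lambda>(A, B).
     (Ide C (A \<odot>\<^bsub>C\<^esub> B) \<Zinj>\<^bsub>C\<^esub> (Ev C A K \<star>\<^bsub>C\<^esub> Ev C B M)) \<cdot>\<^bsub>C\<^esub>
     (Ide C (A \<odot>\<^bsub>C\<^esub> B) \<Zinj>\<^bsub>C\<^esub> middle_swap C (A \<rightarrowtail>\<^bsub>C\<^esub> K) (B \<rightarrowtail>\<^bsub>C\<^esub> M) A B) \<cdot>\<^bsub>C\<^esub>
     Coev C (A \<odot>\<^bsub>C\<^esub> B) ((A \<rightarrowtail>\<^bsub>C\<^esub> K) \<odot>\<^bsub>C\<^esub> (B \<rightarrowtail>\<^bsub>C\<^esub> M)))"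

definition beta :: "('o, 'a, 'm) smcc_data_scheme \<Rightarrow> ('p, 'b, 'n) smcc_data_scheme
    \<Rightarrow> ('o, 'a, 'p, 'b) functor_data \<Rightarrow> ('o \<times> 'o \<Rightarrow> 'b) \<Rightarrow> 'o \<Rightarrow> 'o \<Rightarrow> 'b" where
  "beta C D f \<alpha> K A =
     (Ide D (fo f A) \<Zinj>\<^bsub>D\<^esub> fa f (Ev C A K)) \<cdot>\<^bsub>D\<^esub>
     (Ide D (fo f A) \<Zinj>\<^bsub>D\<^esub> \<alpha> (A \<rightarrowtail>\<^bsub>C\<^esub> K, A)) \<cdot>\<^bsub>D\<^esub>
     Coev D (fo f A) (fo f (A \<rightarrowtail>\<^bsub>C\<^esub> K))"

definition product_dp :: "('o, 'a, 'm) smcc_data_scheme \<Rightarrow> 'o \<Rightarrow> 'o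
    \<Rightarrow> ('o \<times> 'o, 'a \<times> 'a, 'o, 'a) functor_data \<times> ('o \<times> 'o \<Rightarrow> 'a)" where
  "product_dp C K M = (Tensor C, tau C K M)"

definition pullback_dp :: "('o, 'a, 'm) smcc_data_scheme \<Rightarrow> ('p, 'b, 'n) smcc_data_scheme
    \<Rightarrow> ('o, 'a, 'p, 'b) functor_data \<Rightarrow> ('o \<times> 'o \<Rightarrow> 'b) \<Rightarrow> 'o
    \<Rightarrow> ('o, 'a, 'p, 'b) functor_data \<times> ('o \<Rightarrow> 'b)" where
  "pullback_dp C D f \<alpha> K = (f, beta C D f \<alpha> K)"


section \<open>Suspended categories\<close>

record ('o, 'a) suspension_data =
  hadd :: "'a \<Rightarrow> 'a \<Rightarrow> 'a"
  hzero :: "'o \<Rightarrow> 'o \<Rightarrow> 'a"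
  Susp :: "('o, 'a, 'o, 'a) functor_data"

definition Hom_group :: "('o, 'a, 'm) category_data_scheme \<Rightarrow> ('o, 'a, 'k) suspension_data_scheme
    \<Rightarrow> 'o \<Rightarrow> 'o \<Rightarrow> 'a monoid" where
  "Hom_group C S A B = \<lparr>carrier = Hom C A B, mult = hadd S, one = hzero S A B\<rparr>"

definition hneg :: "('o, 'a, 'm) category_data_scheme \<Rightarrow> ('o, 'a, 'k) suspension_data_scheme
    \<Rightarrow> 'a \<Rightarrow> 'a" where
  "hneg C S f = m_inv (Hom_group C S (Dom C f) (Cod C f)) f"

definition zero_object :: "('o, 'a, 'm) category_data_scheme \<Rightarrow> 'o \<Rightarrow> bool" where
  "zero_object C Z \<longleftrightarrow> Z \<in> Ob C \<and>
     (\<forall>A\<in>Ob C. (\<exists>!f. f \<in> Hom C Z A) \<and> (\<exists>!f. f \<in> Hom C A Z))"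

definition additive_category :: "('o, 'a, 'm) category_data_scheme
    \<Rightarrow> ('o, 'a, 'k) suspension_data_scheme \<Rightarrow> bool" where
  "additive_category C S \<longleftrightarrow>
     category C \<and>
     (\<forall>A\<in>Ob C. \<forall>B\<in>Ob C. comm_group (Hom_group C S A B)) \<and>
     (\<forall>A B E. \<forall>f\<in>Hom C A B. \<forall>f'\<in>Hom C A B. \<forall>g\<in>Hom C B E.
        g \<cdot>\<^bsub>C\<^esub> hadd S f f' = hadd S (g \<cdot>\<^bsub>C\<^esub> f) (g \<cdot>\<^bsub>C\<^esub> f')) \<and>
     (\<forall>A B E. \<forall>f\<in>Hom C A B. \<forall>g\<in>Hom C B E. \<forall>g'\<in>Hom C B E.
        hadd S g g' \<cdot>\<^bsub>C\<^esub> f = hadd S (g \<cdot>\<^bsub>C\<^esub> f) (g' \<cdot>\<^bsub>C\<^esub> f)) \<and>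
     (\<exists>Z. zero_object C Z) \<and>
     (\<forall>A\<in>Ob C. \<forall>B\<in>Ob C. \<exists>P\<in>Ob C.
        \<exists>i\<in>Hom C A P. \<exists>j\<in>Hom C B P. \<exists>p\<in>Hom C P A. \<exists>q\<in>Hom C P B.
          p \<cdot>\<^bsub>C\<^esub> i = Ide C A \<and> q \<cdot>\<^bsub>C\<^esub> j = Ide C B \<and>
          p \<cdot>\<^bsub>C\<^esub> j = hzero S B A \<and> q \<cdot>\<^bsub>C\<^esub> i = hzero S A B \<and>
          hadd S (i \<cdot>\<^bsub>C\<^esub> p) (j \<cdot>\<^bsub>C\<^esub> q) = Ide C P)"

definition additive_functor :: "('o, 'a, 'm) category_data_scheme
    \<Rightarrow> ('o, 'a, 'k) suspension_data_scheme \<Rightarrow> ('p, 'b, 'n) category_data_scheme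
    \<Rightarrow> ('p, 'b, 'l) suspension_data_scheme \<Rightarrow> ('o, 'a, 'p, 'b) functor_data \<Rightarrow> bool" where
  "additive_functor C S D S' F \<longleftrightarrow> is_functor C D F \<and>
     (\<forall>A B. \<forall>f\<in>Hom C A B. \<forall>g\<in>Hom C A B. fa F (hadd S f g) = hadd S' (fa F f) (fa F g))"

definition suspended_category :: "('o, 'a, 'm) category_data_scheme
    \<Rightarrow> ('o, 'a, 'k) suspension_data_scheme \<Rightarrow> bool" where
  "suspended_category C S \<longleftrightarrow> additive_category C S \<and>
     additive_functor C S C S (Susp S) \<and> equivalence_functor C C (Susp S)"

text \<open>A suspended functor \<open>{F, t}\<close> carries a natural isomorphism \<open>t : F T \<rightarrow> T F\<close>.\<close>

definition suspended_functor :: "('o, 'a, 'm) category_data_scheme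
    \<Rightarrow> ('o, 'a, 'k) suspension_data_scheme \<Rightarrow> ('p, 'b, 'n) category_data_scheme
    \<Rightarrow> ('p, 'b, 'l) suspension_data_scheme
    \<Rightarrow> ('o, 'a, 'p, 'b) functor_data \<times> ('o \<Rightarrow> 'b) \<Rightarrow> bool" where
  "suspended_functor C S D S' F = (case F of (F, t) \<Rightarrow>
     additive_functor C S D S' F \<and> nat_iso C D (F \<circ>\<^sub>F Susp S) (Susp S' \<circ>\<^sub>F F) t)"

text \<open>The functors obtained from a bifunctor by fixing an object in the second,
  respectively first, variable.\<close>

definition fix_snd :: "('p, 'b, 'm) category_data_scheme \<Rightarrow> 'p
    \<Rightarrow> ('o \<times> 'p, 'a \<times> 'b, 'q, 'c) functor_data \<Rightarrow> ('o, 'a, 'q, 'c) functor_data" where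
  "fix_snd C B F = \<lparr>fo = (\<lambda>A. fo F (A, B)), fa = (\<lambda>f. fa F (f, Ide C B))\<rparr>"

definition fix_fst :: "('o, 'a, 'm) category_data_scheme \<Rightarrow> 'o
    \<Rightarrow> ('o \<times> 'p, 'a \<times> 'b, 'q, 'c) functor_data \<Rightarrow> ('p, 'b, 'q, 'c) functor_data" where
  "fix_fst C A F = \<lparr>fo = (\<lambda>B. fo F (A, B)), fa = (\<lambda>g. fa F (Ide C A, g))\<rparr>"

text \<open>A suspended bifunctor \<open>{F, b, c}\<close> carries natural isomorphisms
  \<open>b : F (T A, B) \<rightarrow> T (F (A, B))\<close> and \<open>c : F (A, T B) \<rightarrow> T (F (A, B))\<close> such that the two ways
  \<open>F (T A, T B) \<rightarrow> T T (F (A, B))\<close> of moving both suspensions out are negatives of each other.\<close>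

definition suspended_bifunctor :: "('o, 'a, 'm) category_data_scheme
    \<Rightarrow> ('o, 'a, 'k) suspension_data_scheme \<Rightarrow> ('p, 'b, 'n) category_data_scheme
    \<Rightarrow> ('p, 'b, 'l) suspension_data_scheme \<Rightarrow> ('q, 'c, 'r) category_data_scheme
    \<Rightarrow> ('q, 'c, 's) suspension_data_scheme
    \<Rightarrow> ('o \<times> 'p, 'a \<times> 'b, 'q, 'c) functor_data \<times> ('o \<times> 'p \<Rightarrow> 'c) \<times> ('o \<times> 'p \<Rightarrow> 'c) \<Rightarrow> bool"
  where
  "suspended_bifunctor C1 S1 C2 S2 D S F = (case F of (F, b, c) \<Rightarrow>
     is_functor (prod_cat C1 C2) D F \<and>
     (\<forall>B\<in>Ob C2. additive_functor C1 S1 D S (fix_snd C2 B F)) \<and>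
     (\<forall>A\<in>Ob C1. additive_functor C2 S2 D S (fix_fst C1 A F)) \<and>
     nat_iso (prod_cat C1 C2) D (F \<circ>\<^sub>F Susp S1 \<times>\<^sub>F id_functor) (Susp S \<circ>\<^sub>F F) b \<and>
     nat_iso (prod_cat C1 C2) D (F \<circ>\<^sub>F id_functor \<times>\<^sub>F Susp S2) (Susp S \<circ>\<^sub>F F) c \<and>
     (\<forall>A\<in>Ob C1. \<forall>B\<in>Ob C2.
        hadd S (fa (Susp S) (c (A, B)) \<cdot>\<^bsub>D\<^esub> b (A, fo (Susp S2) B))
               (fa (Susp S) (b (A, B)) \<cdot>\<^bsub>D\<^esub> c (fo (Susp S1) A, B)) =
        hzero S (fo F (fo (Susp S1) A, fo (Susp S2) B))
                (fo (Susp S) (fo (Susp S) (fo F (A, B))))))"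

definition suspended_bifunctor_iso :: "('o, 'a, 'm) category_data_scheme
    \<Rightarrow> ('o, 'a, 'k) suspension_data_scheme \<Rightarrow> ('p, 'b, 'n) category_data_scheme
    \<Rightarrow> ('p, 'b, 'l) suspension_data_scheme \<Rightarrow> ('q, 'c, 'r) category_data_scheme
    \<Rightarrow> ('q, 'c, 's) suspension_data_scheme
    \<Rightarrow> ('o \<times> 'p, 'a \<times> 'b, 'q, 'c) functor_data \<times> ('o \<times> 'p \<Rightarrow> 'c) \<times> ('o \<times> 'p \<Rightarrow> 'c)
    \<Rightarrow> ('o \<times> 'p, 'a \<times> 'b, 'q, 'c) functor_data \<times> ('o \<times> 'p \<Rightarrow> 'c) \<times> ('o \<times> 'p \<Rightarrow> 'c)
    \<Rightarrow> ('o \<times> 'p \<Rightarrow> 'c) \<Rightarrow> bool" where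
  "suspended_bifunctor_iso C1 S1 C2 S2 D S F F' \<rho> \<longleftrightarrow>
     suspended_bifunctor C1 S1 C2 S2 D S F \<and> suspended_bifunctor C1 S1 C2 S2 D S F' \<and>
     (case (F, F') of ((F, b, c), (F', b', c')) \<Rightarrow>
       nat_iso (prod_cat C1 C2) D F F' \<rho> \<and>
       (\<forall>A\<in>Ob C1. \<forall>B\<in>Ob C2.
          fa (Susp S) (\<rho> (A, B)) \<cdot>\<^bsub>D\<^esub> b (A, B) = b' (A, B) \<cdot>\<^bsub>D\<^esub> \<rho> (fo (Susp S1) A, B) \<and>
          fa (Susp S) (\<rho> (A, B)) \<cdot>\<^bsub>D\<^esub> c (A, B) = c' (A, B) \<cdot>\<^bsub>D\<^esub> \<rho> (A, fo (Susp S2) B)))"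

text \<open>Composition of a suspended bifunctor with suspended functors in both variables
  (\<open>C1\<close>, \<open>C2\<close> being the sources and \<open>D\<close> the target of the bifunctor), and of a suspended functor
  with a suspended bifunctor (\<open>D\<close> being the target of the functor).\<close>

definition suspended_precomp :: "('p, 'b, 'm) category_data_scheme
    \<Rightarrow> ('p', 'b', 'n) category_data_scheme \<Rightarrow> ('q, 'c, 'r) category_data_scheme
    \<Rightarrow> ('p \<times> 'p', 'b \<times> 'b', 'q, 'c) functor_data \<times> ('p \<times> 'p' \<Rightarrow> 'c) \<times> ('p \<times> 'p' \<Rightarrow> 'c)
    \<Rightarrow> ('o, 'a, 'p, 'b) functor_data \<times> ('o \<Rightarrow> 'b)
    \<Rightarrow> ('o', 'a', 'p', 'b') functor_data \<times> ('o' \<Rightarrow> 'b')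
    \<Rightarrow> ('o \<times> 'o', 'a \<times> 'a', 'q, 'c) functor_data \<times> ('o \<times> 'o' \<Rightarrow> 'c) \<times> ('o \<times> 'o' \<Rightarrow> 'c)" where
  "suspended_precomp C1 C2 D B F G = (case (B, F, G) of ((B, b, c), (F, s), (G, t)) \<Rightarrow>
     (B \<circ>\<^sub>F F \<times>\<^sub>F G,
      (\<lambda>(X, Y). b (fo F X, fo G Y) \<cdot>\<^bsub>D\<^esub> fa B (s X, Ide C2 (fo G Y))),
      (\<lambda>(X, Y). c (fo F X, fo G Y) \<cdot>\<^bsub>D\<^esub> fa B (Ide C1 (fo F X), t Y))))"

definition suspended_postcomp :: "('q, 'c, 'm) category_data_scheme
    \<Rightarrow> ('p, 'b, 'q, 'c) functor_data \<times> ('p \<Rightarrow> 'c)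
    \<Rightarrow> ('o \<times> 'o', 'a \<times> 'a', 'p, 'b) functor_data \<times> ('o \<times> 'o' \<Rightarrow> 'b) \<times> ('o \<times> 'o' \<Rightarrow> 'b)
    \<Rightarrow> ('o \<times> 'o', 'a \<times> 'a', 'q, 'c) functor_data \<times> ('o \<times> 'o' \<Rightarrow> 'c) \<times> ('o \<times> 'o' \<Rightarrow> 'c)" where
  "suspended_postcomp D H B = (case (H, B) of ((H, h), (B, b, c)) \<Rightarrow>
     (H \<circ>\<^sub>F B,
      (\<lambda>P. h (fo B P) \<cdot>\<^bsub>D\<^esub> fa H (b P)),
      (\<lambda>P. h (fo B P) \<cdot>\<^bsub>D\<^esub> fa H (c P))))"

definition suspended_id :: "('o, 'a, 'm) category_data_scheme
    \<Rightarrow> ('o, 'a, 'k) suspension_data_scheme \<Rightarrow> ('o, 'a, 'o, 'a) functor_data \<times> ('o \<Rightarrow> 'a)" where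
  "suspended_id C S = (id_functor, \<lambda>A. Ide C (fo (Susp S) A))"


section \<open>Suspended symmetric monoidal closed categories\<close>

record ('o, 'a) tensor_suspension_data = "('o, 'a) suspension_data" +
  tp1 :: "'o \<times> 'o \<Rightarrow> 'a"
  tp2 :: "'o \<times> 'o \<Rightarrow> 'a"

abbreviation suspended_tensor :: "('o, 'a, 'm) smcc_data_scheme
    \<Rightarrow> ('o, 'a, 'k) tensor_suspension_data_scheme
    \<Rightarrow> ('o \<times> 'o, 'a \<times> 'a, 'o, 'a) functor_data \<times> ('o \<times> 'o \<Rightarrow> 'a) \<times> ('o \<times> 'o \<Rightarrow> 'a)" where
  "suspended_tensor C S \<equiv> (Tensor C, tp1 S, tp2 S)"

text \<open>The tensor product is a suspended bifunctor, and associativity and symmetry are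
  compatible with moving \<open>T\<close> out of each variable. No separate data is needed for the internal
  Hom, whose suspension isomorphisms are induced by adjunction, see \<open>dual_suspension\<close>.\<close>

definition suspended_smcc :: "('o, 'a, 'm) smcc_data_scheme
    \<Rightarrow> ('o, 'a, 'k) tensor_suspension_data_scheme \<Rightarrow> bool" where
  "suspended_smcc C S \<longleftrightarrow>
     symmetric_monoidal_closed_category C \<and> suspended_category C S \<and>
     suspended_bifunctor C S C S C S (suspended_tensor C S) \<and>
     (\<forall>A\<in>Ob C. \<forall>B\<in>Ob C. \<forall>E\<in>Ob C.
        fa (Susp S) (Assoc C A B E) \<cdot>\<^bsub>C\<^esub> tp1 S (A \<odot>\<^bsub>C\<^esub> B, E) \<cdot>\<^bsub>C\<^esub> (tp1 S (A, B) \<star>\<^bsub>C\<^esub> Ide C E) =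
        tp1 S (A, B \<odot>\<^bsub>C\<^esub> E) \<cdot>\<^bsub>C\<^esub> Assoc C (fo (Susp S) A) B E \<and>
        fa (Susp S) (Assoc C A B E) \<cdot>\<^bsub>C\<^esub> tp1 S (A \<odot>\<^bsub>C\<^esub> B, E) \<cdot>\<^bsub>C\<^esub> (tp2 S (A, B) \<star>\<^bsub>C\<^esub> Ide C E) =
        tp2 S (A, B \<odot>\<^bsub>C\<^esub> E) \<cdot>\<^bsub>C\<^esub> (Ide C A \<star>\<^bsub>C\<^esub> tp1 S (B, E)) \<cdot>\<^bsub>C\<^esub> Assoc C A (fo (Susp S) B) E \<and>
        fa (Susp S) (Assoc C A B E) \<cdot>\<^bsub>C\<^esub> tp2 S (A \<odot>\<^bsub>C\<^esub> B, E) =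
        tp2 S (A, B \<odot>\<^bsub>C\<^esub> E) \<cdot>\<^bsub>C\<^esub> (Ide C A \<star>\<^bsub>C\<^esub> tp2 S (B, E)) \<cdot>\<^bsub>C\<^esub> Assoc C A B (fo (Susp S) E)) \<and>
     (\<forall>A\<in>Ob C. \<forall>B\<in>Ob C.
        fa (Susp S) (Swap C A B) \<cdot>\<^bsub>C\<^esub> tp1 S (A, B) = tp2 S (B, A) \<cdot>\<^bsub>C\<^esub> Swap C (fo (Susp S) A) B)"

text \<open>A suspended symmetric monoidal functor \<open>{f, t, \<alpha>}\<close>, with \<open>t : f T \<rightarrow> T f\<close>.\<close>

definition suspended_symmetric_monoidal_functor :: "('o, 'a, 'm) smcc_data_scheme
    \<Rightarrow> ('o, 'a, 'k) tensor_suspension_data_scheme \<Rightarrow> ('p, 'b, 'n) smcc_data_scheme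
    \<Rightarrow> ('p, 'b, 'l) tensor_suspension_data_scheme
    \<Rightarrow> ('o, 'a, 'p, 'b) functor_data \<Rightarrow> ('o \<Rightarrow> 'b) \<Rightarrow> ('o \<times> 'o \<Rightarrow> 'b) \<Rightarrow> bool" where
  "suspended_symmetric_monoidal_functor C S D S' f t \<alpha> \<longleftrightarrow>
     symmetric_monoidal_functor C D f \<alpha> \<and> suspended_functor C S D S' (f, t) \<and>
     suspended_bifunctor_iso C S C S D S'
       (suspended_precomp D D D (suspended_tensor D S') (f, t) (f, t))
       (suspended_postcomp D (f, t) (suspended_tensor C S)) \<alpha>"

text \<open>A suspension isomorphism \<open>D T \<cong> T\<^sup>-\<^sup>1 D\<close> of a duality \<open>D : C \<rightarrow> C\<^sup>o\<close> is recorded in the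
  equivalent form \<open>T (D (T A)) \<rightarrow> D A\<close>, which avoids choosing \<open>T\<^sup>-\<^sup>1\<close>. For \<open>D\<^sub>K\<close> it corresponds by
  adjunction to
  \<open>T [T A, K] \<otimes> A \<cong> T ([T A, K] \<otimes> A) \<cong> [T A, K] \<otimes> T A \<rightarrow> K\<close>.\<close>

definition dual_suspension :: "('o, 'a, 'm) smcc_data_scheme
    \<Rightarrow> ('o, 'a, 'k) tensor_suspension_data_scheme \<Rightarrow> 'o \<Rightarrow> 'o \<Rightarrow> 'a" where
  "dual_suspension C S K A = (let TA = fo (Susp S) A; H = TA \<rightarrowtail>\<^bsub>C\<^esub> K in
     curry_arrow C (fo (Susp S) H) A
       (Ev C TA K \<cdot>\<^bsub>C\<^esub> inverse_arrow C (tp2 S (H, A)) \<cdot>\<^bsub>C\<^esub> tp1 S (H, A)))"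

text \<open>For \<open>{F, b, c}\<close> a suspended bifunctor and \<open>d1, d1', d2\<close> suspension isomorphisms (in the
  above form) of the dualities \<open>D1, D1', D2\<close>: compatibility of
  \<open>\<phi> : F (D1 A, D1' B) \<rightarrow> D2 (F (A, B))\<close> with the suspension in each variable. In the first
  variable, both sides are arrows \<open>F (T D1 T A, D1' B) \<rightarrow> D2 (F (A, B))\<close>.\<close>

definition suspended_duality_compatible :: "('o, 'a, 'm) category_data_scheme
    \<Rightarrow> ('o, 'a, 'k) suspension_data_scheme \<Rightarrow> ('o, 'a, 'o, 'a) functor_data \<Rightarrow> ('o \<Rightarrow> 'a)
    \<Rightarrow> ('p, 'b, 'n) category_data_scheme
    \<Rightarrow> ('p, 'b, 'l) suspension_data_scheme \<Rightarrow> ('p, 'b, 'p, 'b) functor_data \<Rightarrow> ('p \<Rightarrow> 'b)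
    \<Rightarrow> ('q, 'c, 'r) category_data_scheme
    \<Rightarrow> ('q, 'c, 's) suspension_data_scheme \<Rightarrow> ('q, 'c, 'q, 'c) functor_data \<Rightarrow> ('q \<Rightarrow> 'c)
    \<Rightarrow> ('o \<times> 'p, 'a \<times> 'b, 'q, 'c) functor_data \<times> ('o \<times> 'p \<Rightarrow> 'c) \<times> ('o \<times> 'p \<Rightarrow> 'c)
    \<Rightarrow> ('o \<times> 'p \<Rightarrow> 'c) \<Rightarrow> bool" where
  "suspended_duality_compatible C1 S1 D1 d1 C1' S1' D1' d1' C2 S2 D2 d2 F \<phi> =
     (case F of (F, b, c) \<Rightarrow>
       (\<forall>A\<in>Ob C1. \<forall>B\<in>Ob C1'. let TA = fo (Susp S1) A; TB = fo (Susp S1') B in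
          \<phi> (A, B) \<cdot>\<^bsub>C2\<^esub> fa F (d1 A, Ide C1' (fo D1' B)) =
          d2 (fo F (A, B)) \<cdot>\<^bsub>C2\<^esub> fa (Susp S2) (fa D2 (inverse_arrow C2 (b (A, B)))) \<cdot>\<^bsub>C2\<^esub>
            fa (Susp S2) (\<phi> (TA, B)) \<cdot>\<^bsub>C2\<^esub> b (fo D1 TA, fo D1' B) \<and>
          \<phi> (A, B) \<cdot>\<^bsub>C2\<^esub> fa F (Ide C1 (fo D1 A), d1' B) =
          d2 (fo F (A, B)) \<cdot>\<^bsub>C2\<^esub> fa (Susp S2) (fa D2 (inverse_arrow C2 (c (A, B)))) \<cdot>\<^bsub>C2\<^esub>
            fa (Susp S2) (\<phi> (A, TB)) \<cdot>\<^bsub>C2\<^esub> c (fo D1 A, fo D1' TB)))"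


section \<open>Triangulated categories\<close>

text \<open>A triangle \<open>A \<rightarrow> B \<rightarrow> E \<rightarrow> T A\<close> is the triple of its arrows.\<close>

definition candidate_triangle :: "('o, 'a, 'm) category_data_scheme
    \<Rightarrow> ('o, 'a, 'k) suspension_data_scheme \<Rightarrow> 'a \<times> 'a \<times> 'a \<Rightarrow> bool" where
  "candidate_triangle C S t = (case t of (u, v, w) \<Rightarrow>
     u \<in> Ar C \<and> v \<in> Hom C (Cod C u) (Cod C v) \<and>
     w \<in> Hom C (Cod C v) (fo (Susp S) (Dom C u)))"

definition triangle_map :: "('o, 'a, 'm) category_data_scheme
    \<Rightarrow> ('o, 'a, 'k) suspension_data_scheme \<Rightarrow> 'a \<times> 'a \<times> 'a \<Rightarrow> 'a \<times> 'a \<times> 'a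
    \<Rightarrow> 'a \<Rightarrow> 'a \<Rightarrow> 'a \<Rightarrow> bool" where
  "triangle_map C S t t' a b e = (case (t, t') of ((u, v, w), (u', v', w')) \<Rightarrow>
     a \<in> Hom C (Dom C u) (Dom C u') \<and> b \<in> Hom C (Cod C u) (Cod C u') \<and>
     e \<in> Hom C (Cod C v) (Cod C v') \<and>
     b \<cdot>\<^bsub>C\<^esub> u = u' \<cdot>\<^bsub>C\<^esub> a \<and> e \<cdot>\<^bsub>C\<^esub> v = v' \<cdot>\<^bsub>C\<^esub> b \<and> fa (Susp S) a \<cdot>\<^bsub>C\<^esub> w = w' \<cdot>\<^bsub>C\<^esub> e)"

definition triangulated_category :: "('o, 'a, 'm) category_data_scheme
    \<Rightarrow> ('o, 'a, 'k) suspension_data_scheme \<Rightarrow> ('a \<times> 'a \<times> 'a) set \<Rightarrow> bool" where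
  "triangulated_category C S \<Delta> \<longleftrightarrow>
     suspended_category C S \<and>
     (\<forall>t\<in>\<Delta>. candidate_triangle C S t) \<and>
     (\<forall>t\<in>\<Delta>. \<forall>t' a b e. candidate_triangle C S t' \<and> triangle_map C S t t' a b e \<and>
        is_isomorphism C a \<and> is_isomorphism C b \<and> is_isomorphism C e \<longrightarrow> t' \<in> \<Delta>) \<and>
     (\<forall>A\<in>Ob C. \<forall>Z. zero_object C Z \<longrightarrow>
        (Ide C A, hzero S A Z, hzero S Z (fo (Susp S) A)) \<in> \<Delta>) \<and>
     (\<forall>u\<in>Ar C. \<exists>v w. (u, v, w) \<in> \<Delta>) \<and>
     (\<forall>u v w. candidate_triangle C S (u, v, w) \<longrightarrow>
        ((u, v, w) \<in> \<Delta> \<longleftrightarrow> (v, w, hneg C S (fa (Susp S) u)) \<in> \<Delta>)) \<and>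
     (\<forall>u v w u' v' w' a b.
        (u, v, w) \<in> \<Delta> \<and> (u', v', w') \<in> \<Delta> \<and>
        a \<in> Hom C (Dom C u) (Dom C u') \<and> b \<in> Hom C (Cod C u) (Cod C u') \<and>
        b \<cdot>\<^bsub>C\<^esub> u = u' \<cdot>\<^bsub>C\<^esub> a \<longrightarrow>
        (\<exists>e. triangle_map C S (u, v, w) (u', v', w') a b e)) \<and>
     (\<forall>u v j k l i m n.
        Dom C v = Cod C u \<and>
        (u, j, k) \<in> \<Delta> \<and> (v, l, i) \<in> \<Delta> \<and> (v \<cdot>\<^bsub>C\<^esub> u, m, n) \<in> \<Delta> \<longrightarrow>
        (\<exists>f\<in>Hom C (Cod C j) (Cod C m). \<exists>g\<in>Hom C (Cod C m) (Cod C l).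
           (f, g, fa (Susp S) j \<cdot>\<^bsub>C\<^esub> i) \<in> \<Delta> \<and>
           f \<cdot>\<^bsub>C\<^esub> j = m \<cdot>\<^bsub>C\<^esub> v \<and> n \<cdot>\<^bsub>C\<^esub> f = k \<and>
           g \<cdot>\<^bsub>C\<^esub> m = l \<and> i \<cdot>\<^bsub>C\<^esub> g = fa (Susp S) u \<cdot>\<^bsub>C\<^esub> n))"

definition exact_functor :: "('o, 'a, 'm) category_data_scheme
    \<Rightarrow> ('o, 'a, 'k) suspension_data_scheme \<Rightarrow> ('a \<times> 'a \<times> 'a) set
    \<Rightarrow> ('p, 'b, 'n) category_data_scheme
    \<Rightarrow> ('p, 'b, 'l) suspension_data_scheme \<Rightarrow> ('b \<times> 'b \<times> 'b) set
    \<Rightarrow> ('o, 'a, 'p, 'b) functor_data \<times> ('o \<Rightarrow> 'b) \<Rightarrow> bool" where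
  "exact_functor C S \<Delta> D S' \<Delta>' F \<longleftrightarrow> suspended_functor C S D S' F \<and>
     (case F of (F, t) \<Rightarrow>
       \<forall>(u, v, w)\<in>\<Delta>. (fa F u, fa F v, t (Dom C u) \<cdot>\<^bsub>D\<^esub> fa F w) \<in> \<Delta>')"

definition exact_bifunctor :: "('o, 'a, 'm) category_data_scheme
    \<Rightarrow> ('o, 'a, 'k) suspension_data_scheme \<Rightarrow> ('a \<times> 'a \<times> 'a) set
    \<Rightarrow> ('p, 'b, 'n) category_data_scheme
    \<Rightarrow> ('p, 'b, 'l) suspension_data_scheme \<Rightarrow> ('b \<times> 'b \<times> 'b) set
    \<Rightarrow> ('q, 'c, 'r) category_data_scheme
    \<Rightarrow> ('q, 'c, 's) suspension_data_scheme \<Rightarrow> ('c \<times> 'c \<times> 'c) set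
    \<Rightarrow> ('o \<times> 'p, 'a \<times> 'b, 'q, 'c) functor_data \<times> ('o \<times> 'p \<Rightarrow> 'c) \<times> ('o \<times> 'p \<Rightarrow> 'c) \<Rightarrow> bool"
  where
  "exact_bifunctor C1 S1 \<Delta>1 C2 S2 \<Delta>2 D S \<Delta> F \<longleftrightarrow>
     suspended_bifunctor C1 S1 C2 S2 D S F \<and>
     (case F of (F, b, c) \<Rightarrow>
       (\<forall>B\<in>Ob C2. exact_functor C1 S1 \<Delta>1 D S \<Delta> (fix_snd C2 B F, \<lambda>A. b (A, B))) \<and>
       (\<forall>A\<in>Ob C1. exact_functor C2 S2 \<Delta>2 D S \<Delta> (fix_fst C1 A F, \<lambda>B. c (A, B))))"

definition triangulated_smcc :: "('o, 'a, 'm) smcc_data_scheme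
    \<Rightarrow> ('o, 'a, 'k) tensor_suspension_data_scheme \<Rightarrow> ('a \<times> 'a \<times> 'a) set \<Rightarrow> bool" where
  "triangulated_smcc C S \<Delta> \<longleftrightarrow> suspended_smcc C S \<and> triangulated_category C S \<Delta> \<and>
     exact_bifunctor C S \<Delta> C S \<Delta> C S \<Delta> (suspended_tensor C S)"

end

theory Submission
  imports Defs
begin

text \<open>
  An arrow \<open>h : A \<rightarrow> [X, B]\<close> is determined by its transpose \<open>ev \<circ> (h \<otimes> X) : A \<otimes> X \<rightarrow> B\<close>, and all the
  data are defined by their transposes: that of \<open>\<tau>\<close> is \<open>(ev \<otimes> ev) \<circ> \<varrho>\<close>, that of \<open>\<beta>\<close> is
  \<open>f\<^sup>* ev \<circ> \<alpha>\<close>, and that of \<open>\<varpi>\<close> is \<open>ev \<circ> s\<close>. After transposition every claim reduces to the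
  naturality of \<open>\<alpha>\<close> and \<open>\<varrho>\<close> and to a coherence property of \<open>\<varrho>\<close>: with the symmetry for \<open>\<tau>\<close>
  preserving dualities, with \<open>\<alpha>\<close> for \<open>\<alpha>\<close> being a morphism of duality preserving functors, and with
  the maps moving the suspension out of one variable for the suspended case. These are obtained by
  writing \<open>\<varrho> = a\<^sup>-\<^sup>1 \<circ> (A \<otimes> l) \<circ> a\<close> with \<open>l : B \<otimes> (C \<otimes> D) \<rightarrow> C \<otimes> (B \<otimes> D)\<close>, for which they
  follow from the pentagon and the hexagon. In the suspended case only one of the two composites is
  treated directly; compatibility of the other is transported along \<open>\<alpha>\<close>.
\<close>

section \<open>Categories in terms of domains and codomains\<close>

text \<open>The definition of \<open>dual_suspension\<close> shapes the suspended case: transposed,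
  it is evaluation after the map \<open>T H \<otimes> A \<rightarrow> H \<otimes> T A\<close> that
  carries \<open>T\<close> from one factor to the other. So \<tau> and \<beta> are compatible with
  suspension because \<varrho> and \<alpha> commute with carrying \<open>T\<close> across, and each
  such fact is a square pasted to the inverse of another. The composite ending in \<open>f\<close>
  is the one treated directly because its transformation is just
  \<open>\<beta> \<circ> f \<tau>\<close>, while the other contains a tensor product of two \<beta>.
  The identity \<open>\<alpha>_beta_tau\<close> writes the second transformation as the first with
  \<alpha> on both sides, and \<alpha> intertwines the suspension maps by hypothesis. Composites are
  kept nested to the right and types are read off \<open>Dom\<close> and \<open>Cod\<close>, so that
  side conditions are settled by rewriting. The price is that an equation between composites rarely
  matches in place: the calculations rebracket until the wanted instance is a subterm, or use a
  variant with a trailing arrow.\<close>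

context category
begin

lemma Dom_in_Ob [simp]: "f \<in> Ar C \<Longrightarrow> Dom C f \<in> Ob C"
  and Cod_in_Ob [simp]: "f \<in> Ar C \<Longrightarrow> Cod C f \<in> Ob C"
  by (simp_all add: dom_closed cod_closed)

lemma Ide_arrow [simp]:
  assumes "A \<in> Ob C"
  shows "Ide C A \<in> Ar C" "Dom C (Ide C A) = A" "Cod C (Ide C A) = A"
  using ide_closed [OF assms] by (simp_all add: Hom_def)

text \<open>The axioms speak of \<open>Hom\<close> sets with free objects, which conditional
  rewriting cannot guess; here the objects are \<open>Dom\<close> and \<open>Cod\<close> of the
  arrows themselves.\<close>

lemma Comp_arrow [simp]:
  assumes "f \<in> Ar C" "g \<in> Ar C" "Dom C g = Cod C f"
  shows "g \<cdot> f \<in> Ar C" "Dom C (g \<cdot> f) = Dom C f" "Cod C (g \<cdot> f) = Cod C g"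
  using comp_closed [of f "Dom C f" "Cod C f" g "Cod C g"] assms by (simp_all add: Hom_def)

lemma Comp_assoc [simp]:
  assumes "f \<in> Ar C" "g \<in> Ar C" "h \<in> Ar C" "Dom C g = Cod C f" "Dom C h = Cod C g"
  shows "(h \<cdot> g) \<cdot> f = h \<cdot> (g \<cdot> f)"
  using comp_assoc [of f "Dom C f" "Cod C f" g "Cod C g" h "Cod C h"] assms
  by (simp add: Hom_def)

lemma Ide_Comp [simp]: "f \<in> Ar C \<Longrightarrow> Cod C f = B \<Longrightarrow> Ide C B \<cdot> f = f"
  using comp_ide_left [of f "Dom C f" B] by (simp add: Hom_def)

lemma Comp_Ide [simp]: "f \<in> Ar C \<Longrightarrow> Dom C f = A \<Longrightarrow> f \<cdot> Ide C A = f"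
  using comp_ide_right [of f A "Cod C f"] by (simp add: Hom_def)

text \<open>Once composites are nested to the right, \<open>g \<cdot> f\<close> is no longer a
  subterm of \<open>g \<cdot> (f \<cdot> x)\<close>; this lifts an equation for
  \<open>g \<cdot> f\<close> to that position.\<close>

lemma Comp_extend:
  assumes "g \<cdot> f = e" "f \<in> Ar C" "g \<in> Ar C" "Dom C g = Cod C f" "x \<in> Ar C" "Cod C x = Dom C f"
  shows "g \<cdot> (f \<cdot> x) = e \<cdot> x"
  using assms Comp_assoc by metis

lemma inverse_arrows_unique:
  assumes "inverse_arrows C f g" "inverse_arrows C f h"
  shows "g = h"
proof -
  have "g = g \<cdot> (f \<cdot> h)"
    using assms by (simp add: inverse_arrows_def Hom_def)
  also have "\<dots> = (g \<cdot> f) \<cdot> h"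
    using assms by (subst Comp_assoc) (simp_all add: inverse_arrows_def Hom_def)
  also have "\<dots> = h"
    using assms by (simp add: inverse_arrows_def Hom_def)
  finally show ?thesis .
qed

lemma inverse_arrows_inverse_arrow:
  assumes "is_isomorphism C f"
  shows "inverse_arrows C f (inverse_arrow C f)"
proof -
  obtain g where "inverse_arrows C f g"
    using assms by (auto simp: is_isomorphism_def)
  moreover from this have "inverse_arrow C f = g"
    unfolding inverse_arrow_def using inverse_arrows_unique by blast
  ultimately show ?thesis
    by simp
qed

lemma inverse_arrow_eqI: "inverse_arrows C f g \<Longrightarrow> inverse_arrow C f = g"
  using inverse_arrows_inverse_arrow inverse_arrows_unique is_isomorphism_def by metis

lemma iso_arrow: "is_isomorphism C f \<Longrightarrow> f \<in> Ar C"
  by (auto simp: is_isomorphism_def inverse_arrows_def)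

lemma inverse_arrow [simp]:
  assumes "is_isomorphism C f"
  shows "inverse_arrow C f \<in> Ar C"
    "Dom C (inverse_arrow C f) = Cod C f" "Cod C (inverse_arrow C f) = Dom C f"
    "inverse_arrow C f \<cdot> f = Ide C (Dom C f)" "f \<cdot> inverse_arrow C f = Ide C (Cod C f)"
  using inverse_arrows_inverse_arrow [OF assms]
  by (simp_all add: inverse_arrows_def Hom_def)

lemma inverse_arrow_cancel [simp]:
  assumes "is_isomorphism C f" "x \<in> Ar C"
  shows "Cod C x = Dom C f \<Longrightarrow> inverse_arrow C f \<cdot> (f \<cdot> x) = x"
    "Cod C x = Cod C f \<Longrightarrow> f \<cdot> (inverse_arrow C f \<cdot> x) = x"
  using assms iso_arrow [OF assms(1)]
  by (simp_all add: Comp_extend [OF inverse_arrow(4)] Comp_extend [OF inverse_arrow(5)])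

lemma isoI:
  assumes "f \<in> Ar C" "g \<in> Ar C" "Dom C g = Cod C f" "Cod C g = Dom C f"
    "g \<cdot> f = Ide C (Dom C f)" "f \<cdot> g = Ide C (Cod C f)"
  shows "is_isomorphism C f" "inverse_arrow C f = g"
proof -
  have i: "inverse_arrows C f g"
    using assms by (simp add: inverse_arrows_def Hom_def)
  then show "is_isomorphism C f"
    by (auto simp: is_isomorphism_def)
  show "inverse_arrow C f = g"
    using i by (rule inverse_arrow_eqI)
qed

lemma iso_Ide [simp]: "A \<in> Ob C \<Longrightarrow> is_isomorphism C (Ide C A)"
  by (rule isoI [of _ "Ide C A"]) simp_all

lemma iso_Comp [simp]:
  assumes "is_isomorphism C f" "is_isomorphism C g" "Dom C g = Cod C f"
  shows "is_isomorphism C (g \<cdot> f)"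
  using assms iso_arrow [of f] iso_arrow [of g]
  by (intro isoI(1) [of _ "inverse_arrow C f \<cdot> inverse_arrow C g"]) simp_all

lemma inverse_Comp:
  assumes "is_isomorphism C f" "is_isomorphism C g" "Dom C g = Cod C f"
  shows "inverse_arrow C (g \<cdot> f) = inverse_arrow C f \<cdot> inverse_arrow C g"
  using assms iso_arrow [of f] iso_arrow [of g] by (intro isoI(2)) simp_all

lemma inverse_Ide [simp]: "A \<in> Ob C \<Longrightarrow> inverse_arrow C (Ide C A) = Ide C A"
  by (rule isoI(2)) simp_all

lemma iso_cancel_right:
  assumes "is_isomorphism C f" "g \<in> Ar C" "h \<in> Ar C" "Dom C g = Cod C f" "Dom C h = Cod C f"
    "g \<cdot> f = h \<cdot> f"
  shows "g = h"
proof -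
  have "(g \<cdot> f) \<cdot> inverse_arrow C f = (h \<cdot> f) \<cdot> inverse_arrow C f"
    using assms by simp
  then show ?thesis
    using assms(1-5) iso_arrow [of f] by simp
qed

lemma iso_cancel_left:
  assumes "is_isomorphism C f" "g \<in> Ar C" "h \<in> Ar C" "Cod C g = Dom C f" "Cod C h = Dom C f"
    "f \<cdot> g = f \<cdot> h"
  shows "g = h"
proof -
  have "inverse_arrow C f \<cdot> (f \<cdot> g) = inverse_arrow C f \<cdot> (f \<cdot> h)"
    using assms by simp
  then show ?thesis
    using assms(1-5) by simp
qed

text \<open>Conjugates a commuting square by its two invertible sides. Naturality of inverse
  associators and inverse suspension maps, and every passage from moving \<open>T\<close> out of a
  variable to moving it back in, come from it.\<close>

lemma inverse_square:
  assumes "is_isomorphism C x" "is_isomorphism C y" "p \<in> Ar C" "q \<in> Ar C"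
    "Dom C q = Cod C x" "Dom C p = Dom C x" "Cod C p = Dom C y" "q \<cdot> x = y \<cdot> p"
  shows "inverse_arrow C y \<cdot> q = p \<cdot> inverse_arrow C x"
proof -
  note [simp] = iso_arrow [OF assms(1)] iso_arrow [OF assms(2)] assms(1-8)
  \<comment> \<open>The codomain of \<open>q\<close> is read off the equation of the square
    itself.\<close>
  have cq [simp]: "Cod C q = Cod C y"
    using Comp_arrow(3) [of x q] Comp_arrow(3) [of p y] by simp
  have "inverse_arrow C y \<cdot> q = inverse_arrow C y \<cdot> ((q \<cdot> x) \<cdot> inverse_arrow C x)"
    by (subst Comp_assoc) (simp_all del: assms(8))
  also have "\<dots> = p \<cdot> inverse_arrow C x"
    by simp
  finally show ?thesis .
qed

end

lemma op_cat_simps [simp]: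
  "Ob (op_cat C) = Ob C" "Ar (op_cat C) = Ar C" "Dom (op_cat C) = Cod C" "Cod (op_cat C) = Dom C"
  "Ide (op_cat C) = Ide C" "g \<cdot>\<^bsub>op_cat C\<^esub> f = f \<cdot>\<^bsub>C\<^esub> g"
  by (simp_all add: op_cat_def)

lemma prod_cat_simps [simp]:
  "Ob (prod_cat C D) = Ob C \<times> Ob D" "Ar (prod_cat C D) = Ar C \<times> Ar D"
  "Dom (prod_cat C D) = map_prod (Dom C) (Dom D)" "Cod (prod_cat C D) = map_prod (Cod C) (Cod D)"
  "Ide (prod_cat C D) = map_prod (Ide C) (Ide D)"
  "g \<cdot>\<^bsub>prod_cat C D\<^esub> f = (fst g \<cdot>\<^bsub>C\<^esub> fst f, snd g \<cdot>\<^bsub>D\<^esub> snd f)"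
  by (simp_all add: prod_cat_def)

lemma functor_data_simps [simp]:
  "fo id_functor A = A" "fa id_functor a = a"
  "fo (G \<circ>\<^sub>F F) A = fo G (fo F A)" "fa (G \<circ>\<^sub>F F) a = fa G (fa F a)"
  "fo (F \<times>\<^sub>F F') P = map_prod (fo F) (fo F') P" "fa (F \<times>\<^sub>F F') p = map_prod (fa F) (fa F') p"
  by (simp_all add: id_functor_def comp_functor_def prod_functor_def)

lemma is_functorI:
  assumes "\<And>A. A \<in> Ob C \<Longrightarrow> fo F A \<in> Ob D"
    and "\<And>f. f \<in> Ar C \<Longrightarrow> fa F f \<in> Ar D"
    and "\<And>f. f \<in> Ar C \<Longrightarrow> Dom D (fa F f) = fo F (Dom C f)"
    and "\<And>f. f \<in> Ar C \<Longrightarrow> Cod D (fa F f) = fo F (Cod C f)"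
    and "\<And>A. A \<in> Ob C \<Longrightarrow> fa F (Ide C A) = Ide D (fo F A)"
    and "\<And>f g. f \<in> Ar C \<Longrightarrow> g \<in> Ar C \<Longrightarrow> Dom C g = Cod C f \<Longrightarrow>
      fa F (g \<cdot>\<^bsub>C\<^esub> f) = fa F g \<cdot>\<^bsub>D\<^esub> fa F f"
  shows "is_functor C D F"
  using assms by (simp add: is_functor_def Hom_def)

lemma is_functorD:
  assumes "is_functor C D F"
  shows "A \<in> Ob C \<Longrightarrow> fo F A \<in> Ob D"
    and "f \<in> Ar C \<Longrightarrow> fa F f \<in> Ar D"
    and "f \<in> Ar C \<Longrightarrow> Dom D (fa F f) = fo F (Dom C f)"
    and "f \<in> Ar C \<Longrightarrow> Cod D (fa F f) = fo F (Cod C f)"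
    and "A \<in> Ob C \<Longrightarrow> fa F (Ide C A) = Ide D (fo F A)"
    and "f \<in> Ar C \<Longrightarrow> g \<in> Ar C \<Longrightarrow> Dom C g = Cod C f \<Longrightarrow>
      fa F (g \<cdot>\<^bsub>C\<^esub> f) = fa F g \<cdot>\<^bsub>D\<^esub> fa F f"
  using assms by (simp_all add: is_functor_def Hom_def)

lemma is_functor_comp:
  assumes "is_functor C D F" "is_functor D E G"
  shows "is_functor C E (G \<circ>\<^sub>F F)"
  by (rule is_functorI) (simp_all add: is_functorD [OF assms(1)] is_functorD [OF assms(2)])

lemma is_functor_prod:
  assumes "is_functor C D F" "is_functor C' D' F'"
  shows "is_functor (prod_cat C C') (prod_cat D D') (F \<times>\<^sub>F F')"
  by (rule is_functorI)
    (auto simp: is_functorD [OF assms(1)] is_functorD [OF assms(2)])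

lemma is_functor_id: "is_functor C C id_functor"
  by (rule is_functorI) simp_all

lemma functor_iso:
  assumes "category C" "category D" "is_functor C D F" "is_isomorphism C f"
  shows "is_isomorphism D (fa F f)" "inverse_arrow D (fa F f) = fa F (inverse_arrow C f)"
proof -
  interpret C: category C by fact
  interpret D: category D by fact
  note [simp] = is_functorD [OF assms(3)] C.iso_arrow [OF assms(4)] assms(4)
  have "fa F (inverse_arrow C f) \<cdot>\<^bsub>D\<^esub> fa F f = Ide D (fo F (Dom C f))"
    using is_functorD(6) [OF assms(3), of f "inverse_arrow C f"] by simp
  moreover have "fa F f \<cdot>\<^bsub>D\<^esub> fa F (inverse_arrow C f) = Ide D (fo F (Cod C f))"
    using is_functorD(6) [OF assms(3), of "inverse_arrow C f" f] by simp
  ultimately show "is_isomorphism D (fa F f)" "inverse_arrow D (fa F f) = fa F (inverse_arrow C f)"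
    by (auto intro!: D.isoI [of _ "fa F (inverse_arrow C f)"])
qed

lemma nat_transI:
  assumes "is_functor C D F" "is_functor C D G"
    and "\<And>A. A \<in> Ob C \<Longrightarrow> \<eta> A \<in> Ar D"
    and "\<And>A. A \<in> Ob C \<Longrightarrow> Dom D (\<eta> A) = fo F A"
    and "\<And>A. A \<in> Ob C \<Longrightarrow> Cod D (\<eta> A) = fo G A"
    and "\<And>f. f \<in> Ar C \<Longrightarrow> \<eta> (Cod C f) \<cdot>\<^bsub>D\<^esub> fa F f = fa G f \<cdot>\<^bsub>D\<^esub> \<eta> (Dom C f)"
  shows "nat_trans C D F G \<eta>"
  using assms by (auto simp add: nat_trans_def Hom_def)

lemma nat_transD:
  assumes "nat_trans C D F G \<eta>"
  shows "is_functor C D F" "is_functor C D G"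
    and "A \<in> Ob C \<Longrightarrow> \<eta> A \<in> Ar D"
    and "A \<in> Ob C \<Longrightarrow> Dom D (\<eta> A) = fo F A"
    and "A \<in> Ob C \<Longrightarrow> Cod D (\<eta> A) = fo G A"
    and "f \<in> Ar C \<Longrightarrow> \<eta> (Cod C f) \<cdot>\<^bsub>D\<^esub> fa F f = fa G f \<cdot>\<^bsub>D\<^esub> \<eta> (Dom C f)"
  using assms by (auto simp add: nat_trans_def Hom_def)

text \<open>Components are total functions whose values off the objects are arbitrary, so two
  families that agree on objects need not be equal terms.\<close>

lemma nat_trans_cong:
  assumes "category C" "\<And>A. A \<in> Ob C \<Longrightarrow> \<eta> A = \<theta> A"
  shows "nat_trans C D F G \<eta> \<longleftrightarrow> nat_trans C D F G \<theta>"
proof -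
  interpret category C by fact
  show ?thesis
    using assms(2) by (auto simp: nat_trans_def Hom_def)
qed

section \<open>Symmetric monoidal closed categories\<close>

context symmetric_monoidal_category
begin

lemma tensor_ob [simp]: "A \<in> Ob C \<Longrightarrow> B \<in> Ob C \<Longrightarrow> A \<odot> B \<in> Ob C"
  using is_functorD(1) [OF tensor_functor, of "(A, B)"] by simp

lemma tensor_ar [simp]:
  assumes "f \<in> Ar C" "g \<in> Ar C"
  shows "f \<star> g \<in> Ar C" "Dom C (f \<star> g) = Dom C f \<odot> Dom C g" "Cod C (f \<star> g) = Cod C f \<odot> Cod C g"
  using assms is_functorD(2-4) [OF tensor_functor, of "(f, g)"] by simp_all

lemma tensor_Ide [simp]: "A \<in> Ob C \<Longrightarrow> B \<in> Ob C \<Longrightarrow> Ide C A \<star> Ide C B = Ide C (A \<odot> B)"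
  using is_functorD(5) [OF tensor_functor, of "(A, B)"] by simp

lemma tensor_Comp [simp]:
  assumes "f \<in> Ar C" "g \<in> Ar C" "h \<in> Ar C" "k \<in> Ar C" "Dom C h = Cod C f" "Dom C k = Cod C g"
  shows "(h \<star> k) \<cdot> (f \<star> g) = (h \<cdot> f) \<star> (k \<cdot> g)"
  using is_functorD(6) [OF tensor_functor, of "(f, g)" "(h, k)"] assms by simp

lemma tensor_Comp_extend [simp]:
  assumes "f \<in> Ar C" "g \<in> Ar C" "h \<in> Ar C" "k \<in> Ar C" "Dom C h = Cod C f" "Dom C k = Cod C g"
    "x \<in> Ar C" "Cod C x = Dom C f \<odot> Dom C g"
  shows "(h \<star> k) \<cdot> ((f \<star> g) \<cdot> x) = ((h \<cdot> f) \<star> (k \<cdot> g)) \<cdot> x"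
  using assms by (subst Comp_extend [OF tensor_Comp]) simp_all

lemma tensor_iso:
  assumes "is_isomorphism C f" "is_isomorphism C g"
  shows "is_isomorphism C (f \<star> g)"
    "inverse_arrow C (f \<star> g) = inverse_arrow C f \<star> inverse_arrow C g"
  using assms iso_arrow [of f] iso_arrow [of g]
  by (auto intro!: isoI [of _ "inverse_arrow C f \<star> inverse_arrow C g"])

lemma assoc_ar [simp]:
  assumes "A \<in> Ob C" "B \<in> Ob C" "E \<in> Ob C"
  shows "Assoc C A B E \<in> Ar C" "Dom C (Assoc C A B E) = (A \<odot> B) \<odot> E"
    "Cod C (Assoc C A B E) = A \<odot> (B \<odot> E)"
  using assoc_closed [OF assms] by (simp_all add: Hom_def)

lemma swap_ar [simp]:
  assumes "A \<in> Ob C" "B \<in> Ob C"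
  shows "Swap C A B \<in> Ar C" "Dom C (Swap C A B) = A \<odot> B" "Cod C (Swap C A B) = B \<odot> A"
  using swap_closed [OF assms] by (simp_all add: Hom_def)

declare assoc_iso [simp] swap_swap [simp]

lemma swap_swap_extend [simp]:
  assumes "A \<in> Ob C" "B \<in> Ob C" "x \<in> Ar C" "Cod C x = A \<odot> B"
  shows "Swap C B A \<cdot> (Swap C A B \<cdot> x) = x"
  using assms by (subst Comp_extend [OF swap_swap]) simp_all

lemma assoc_nat:
  assumes "f \<in> Ar C" "g \<in> Ar C" "h \<in> Ar C"
  shows "Assoc C (Cod C f) (Cod C g) (Cod C h) \<cdot> ((f \<star> g) \<star> h) =
    (f \<star> (g \<star> h)) \<cdot> Assoc C (Dom C f) (Dom C g) (Dom C h)"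
  using assms by (intro assoc_natural) (simp_all add: Hom_def)

lemma swap_nat:
  assumes "f \<in> Ar C" "g \<in> Ar C"
  shows "Swap C (Cod C f) (Cod C g) \<cdot> (f \<star> g) = (g \<star> f) \<cdot> Swap C (Dom C f) (Dom C g)"
  using assms by (intro swap_natural) (simp_all add: Hom_def)

lemma assoc_inv_nat:
  assumes "f \<in> Ar C" "g \<in> Ar C" "h \<in> Ar C"
  shows "inverse_arrow C (Assoc C (Cod C f) (Cod C g) (Cod C h)) \<cdot> (f \<star> (g \<star> h)) =
    ((f \<star> g) \<star> h) \<cdot> inverse_arrow C (Assoc C (Dom C f) (Dom C g) (Dom C h))"
  using assms assoc_nat [OF assms] by (intro inverse_square) simp_all

subsection \<open>The middle four interchange\<close>

text \<open>The \<open>l\<close> of the overview. It is the only place where the symmetry enters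
  \<open>middle_swap\<close>, so each coherence property of the interchange has its core in one
  about three factors.\<close>

definition left_swap :: "'o \<Rightarrow> 'o \<Rightarrow> 'o \<Rightarrow> 'a" where
  "left_swap A B E =
    Assoc C B A E \<cdot> (Swap C A B \<star> Ide C E) \<cdot> inverse_arrow C (Assoc C A B E)"

lemma left_swap_ar [simp]:
  assumes "A \<in> Ob C" "B \<in> Ob C" "E \<in> Ob C"
  shows "left_swap A B E \<in> Ar C" "Dom C (left_swap A B E) = A \<odot> (B \<odot> E)"
    "Cod C (left_swap A B E) = B \<odot> (A \<odot> E)"
  using assms by (simp_all add: left_swap_def)

lemma left_swap_assoc:
  assumes "A \<in> Ob C" "B \<in> Ob C" "E \<in> Ob C"
  shows "left_swap A B E \<cdot> Assoc C A B E = Assoc C B A E \<cdot> (Swap C A B \<star> Ide C E)"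
  using assms by (simp add: left_swap_def)

text \<open>The three middle arrows of the definition all fix the first factor, so functoriality of
  the tensor product merges them into one arrow.\<close>

lemma middle_swap_left_swap:
  assumes "A \<in> Ob C" "B \<in> Ob C" "E \<in> Ob C" "G \<in> Ob C"
  shows "middle_swap C A B E G = inverse_arrow C (Assoc C A E (B \<odot> G)) \<cdot>
    (Ide C A \<star> left_swap B E G) \<cdot> Assoc C A B (E \<odot> G)"
  using assms by (simp add: middle_swap_def left_swap_def)

lemma middle_swap_ar [simp]:
  assumes "A \<in> Ob C" "B \<in> Ob C" "E \<in> Ob C" "G \<in> Ob C"
  shows "middle_swap C A B E G \<in> Ar C"
    "Dom C (middle_swap C A B E G) = (A \<odot> B) \<odot> (E \<odot> G)"
    "Cod C (middle_swap C A B E G) = (A \<odot> E) \<odot> (B \<odot> G)"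
  using assms by (simp_all add: middle_swap_left_swap)

text \<open>The form without an inverse: coherence proofs about \<open>middle_swap\<close> cancel
  the associator on the left at the end.\<close>

lemma assoc_middle_swap:
  assumes "A \<in> Ob C" "B \<in> Ob C" "E \<in> Ob C" "G \<in> Ob C"
  shows "Assoc C A E (B \<odot> G) \<cdot> middle_swap C A B E G =
    (Ide C A \<star> left_swap B E G) \<cdot> Assoc C A B (E \<odot> G)"
  using assms by (simp add: middle_swap_left_swap)

lemma left_swap_nat:
  assumes "f \<in> Ar C" "g \<in> Ar C" "h \<in> Ar C"
  shows "left_swap (Cod C f) (Cod C g) (Cod C h) \<cdot> (f \<star> (g \<star> h)) =
    (g \<star> (f \<star> h)) \<cdot> left_swap (Dom C f) (Dom C g) (Dom C h)"
proof -
  note [simp] = assms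
  have "left_swap (Cod C f) (Cod C g) (Cod C h) \<cdot> (f \<star> (g \<star> h)) =
    Assoc C (Cod C g) (Cod C f) (Cod C h) \<cdot> (((g \<star> f) \<star> h) \<cdot>
      ((Swap C (Dom C f) (Dom C g) \<star> Ide C (Dom C h)) \<cdot>
        inverse_arrow C (Assoc C (Dom C f) (Dom C g) (Dom C h))))"
    by (simp add: left_swap_def assoc_inv_nat swap_nat)
  also have "\<dots> = (g \<star> (f \<star> h)) \<cdot> left_swap (Dom C f) (Dom C g) (Dom C h)"
    by (subst Comp_extend [OF assoc_nat]) (simp_all add: left_swap_def)
  finally show ?thesis .
qed

lemma middle_swap_nat:
  assumes "f \<in> Ar C" "g \<in> Ar C" "h \<in> Ar C" "k \<in> Ar C"
  shows "middle_swap C (Cod C f) (Cod C g) (Cod C h) (Cod C k) \<cdot> ((f \<star> g) \<star> (h \<star> k)) =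
    ((f \<star> h) \<star> (g \<star> k)) \<cdot> middle_swap C (Dom C f) (Dom C g) (Dom C h) (Dom C k)"
proof -
  note [simp] = assms
  have "middle_swap C (Cod C f) (Cod C g) (Cod C h) (Cod C k) \<cdot> ((f \<star> g) \<star> (h \<star> k)) =
    inverse_arrow C (Assoc C (Cod C f) (Cod C h) (Cod C g \<odot> Cod C k)) \<cdot>
      ((f \<star> (h \<star> (g \<star> k))) \<cdot> ((Ide C (Dom C f) \<star> left_swap (Dom C g) (Dom C h) (Dom C k)) \<cdot>
        Assoc C (Dom C f) (Dom C g) (Dom C h \<odot> Dom C k)))"
    using assoc_nat [of f g "h \<star> k"]
    by (simp add: middle_swap_left_swap left_swap_nat)
  also have "\<dots> = ((f \<star> h) \<star> (g \<star> k)) \<cdot> middle_swap C (Dom C f) (Dom C g) (Dom C h) (Dom C k)"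
    using assoc_inv_nat [of f h "g \<star> k"]
    by (subst Comp_extend [where e = "((f \<star> h) \<star> (g \<star> k)) \<cdot>
      inverse_arrow C (Assoc C (Dom C f) (Dom C h) (Dom C g \<odot> Dom C k))"])
      (simp_all add: middle_swap_left_swap)
  finally show ?thesis .
qed

text \<open>Precomposed with an associator this is the hexagon; \<open>left_swap\<close> has
  absorbed the associator.\<close>

lemma assoc_swap:
  assumes "A \<in> Ob C" "B \<in> Ob C" "E \<in> Ob C"
  shows "Assoc C B E A \<cdot> Swap C A (B \<odot> E) = (Ide C B \<star> Swap C A E) \<cdot> left_swap A B E"
proof (rule iso_cancel_right [of "Assoc C A B E"])
qed (use hexagon [OF assms] assms in \<open>simp_all add: left_swap_assoc\<close>)

text \<open>The hexagon in the other direction. It follows from \<open>assoc_swap\<close> because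
  the symmetry is an involution: a swap of \<open>B\<close> and \<open>G\<close> is inserted
  together with its inverse.\<close>

lemma left_swap_swap:
  assumes "A \<in> Ob C" "B \<in> Ob C" "G \<in> Ob C"
  shows "left_swap G A B \<cdot> Swap C (A \<odot> B) G = (Ide C A \<star> Swap C B G) \<cdot> Assoc C A B G"
proof -
  note [simp] = assms
  have "left_swap G A B \<cdot> Swap C (A \<odot> B) G =
    (Ide C A \<star> Swap C B G) \<cdot> (((Ide C A \<star> Swap C G B) \<cdot> left_swap G A B) \<cdot> Swap C (A \<odot> B) G)"
    by simp
  also have "\<dots> = (Ide C A \<star> Swap C B G) \<cdot> Assoc C A B G"
    unfolding assoc_swap [OF assms(3,1,2), symmetric] by simp
  finally show ?thesis .
qed

text \<open>Both sides move \<open>E\<close> to the left of \<open>A \<otimes> B\<close>, at once or past \<open>B\<close> and \<open>A\<close> in turn.\<close>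

lemma left_swap_tensor:
  assumes "A \<in> Ob C" "B \<in> Ob C" "E \<in> Ob C" "X \<in> Ob C"
  shows "(Ide C E \<star> Assoc C A B X) \<cdot> left_swap (A \<odot> B) E X =
    left_swap A E (B \<odot> X) \<cdot> (Ide C A \<star> left_swap B E X) \<cdot> Assoc C A B (E \<odot> X)"
proof -
  note [simp] = assms
  let ?s = "(Swap C A E \<star> Ide C B) \<cdot> inverse_arrow C (Assoc C A E B) \<cdot>
    (Ide C A \<star> Swap C B E) \<cdot> Assoc C A B E"
  \<comment> \<open>\<open>left_swap A E B\<close> is inverse to \<open>left_swap E A B\<close>, so
    \<open>left_swap_swap\<close> can be solved for the symmetry of \<open>A \<odot> B\<close> with
    \<open>E\<close>: \<open>E\<close> passes \<open>B\<close> and then \<open>A\<close>.\<close>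
  have hex: "Swap C (A \<odot> B) E = Assoc C E A B \<cdot> ?s"
  proof -
    have "left_swap A E B \<cdot> (Ide C A \<star> Swap C B E) \<cdot> Assoc C A B E =
      left_swap A E B \<cdot> left_swap E A B \<cdot> Swap C (A \<odot> B) E"
      by (simp only: left_swap_swap assms)
    also have "\<dots> = Swap C (A \<odot> B) E"
      by (simp add: left_swap_def)
    finally show ?thesis
      by (simp add: left_swap_def)
  qed
  \<comment> \<open>The next three facts are the pentagons for the three positions of
    \<open>E\<close> relative to \<open>A\<close> and \<open>B\<close>; in \<open>p3\<close> two
    associators have been moved across as inverses.\<close>
  have p1: "(Ide C E \<star> Assoc C A B X) \<cdot> Assoc C E (A \<odot> B) X \<cdot> (Assoc C E A B \<star> Ide C X) =
    Assoc C E A (B \<odot> X) \<cdot> Assoc C (E \<odot> A) B X"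
    using pentagon [of E A B X] by simp
  have p2: "(Ide C A \<star> Assoc C B E X) \<cdot> Assoc C A (B \<odot> E) X \<cdot> (Assoc C A B E \<star> Ide C X) =
    Assoc C A B (E \<odot> X) \<cdot> Assoc C (A \<odot> B) E X"
    using pentagon [of A B E X] by simp
  have p3: "inverse_arrow C (Assoc C A E (B \<odot> X)) \<cdot> (Ide C A \<star> Assoc C E B X) \<cdot>
      Assoc C A (E \<odot> B) X =
    Assoc C (A \<odot> E) B X \<cdot> (inverse_arrow C (Assoc C A E B) \<star> Ide C X)"
  proof -
    have "inverse_arrow C (Assoc C A E (B \<odot> X)) \<cdot> (Ide C A \<star> Assoc C E B X) \<cdot>
        Assoc C A (E \<odot> B) X =
      inverse_arrow C (Assoc C A E (B \<odot> X)) \<cdot> ((Ide C A \<star> Assoc C E B X) \<cdot>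
        Assoc C A (E \<odot> B) X \<cdot> (Assoc C A E B \<star> Ide C X)) \<cdot>
        (inverse_arrow C (Assoc C A E B) \<star> Ide C X)"
      by simp
    also have "\<dots> = Assoc C (A \<odot> E) B X \<cdot> (inverse_arrow C (Assoc C A E B) \<star> Ide C X)"
      unfolding pentagon [OF assms(1,3,2,4), symmetric] by simp
    finally show ?thesis .
  qed
  \<comment> \<open>The associator precomposed here turns \<open>left_swap\<close> into a plain
    symmetry tensored with \<open>X\<close>; it is cancelled at the end.\<close>
  have "((Ide C E \<star> Assoc C A B X) \<cdot> left_swap (A \<odot> B) E X) \<cdot> Assoc C (A \<odot> B) E X =
    ((Ide C E \<star> Assoc C A B X) \<cdot> Assoc C E (A \<odot> B) X \<cdot> (Assoc C E A B \<star> Ide C X)) \<cdot>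
      (?s \<star> Ide C X)"
    by (simp add: left_swap_assoc hex)
  also have "\<dots> = Assoc C E A (B \<odot> X) \<cdot> Assoc C (E \<odot> A) B X \<cdot> (?s \<star> Ide C X)"
    unfolding p1 by simp
  also have "\<dots> = Assoc C E A (B \<odot> X) \<cdot> (Assoc C (E \<odot> A) B X \<cdot>
      ((Swap C A E \<star> Ide C B) \<star> Ide C X)) \<cdot>
      (inverse_arrow C (Assoc C A E B) \<star> Ide C X) \<cdot>
      (((Ide C A \<star> Swap C B E) \<cdot> Assoc C A B E) \<star> Ide C X)"
    by simp
  also have "\<dots> = Assoc C E A (B \<odot> X) \<cdot> (Swap C A E \<star> Ide C (B \<odot> X)) \<cdot>
      (Assoc C (A \<odot> E) B X \<cdot> (inverse_arrow C (Assoc C A E B) \<star> Ide C X)) \<cdot>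
      (((Ide C A \<star> Swap C B E) \<cdot> Assoc C A B E) \<star> Ide C X)"
    using assoc_nat [of "Swap C A E" "Ide C B" "Ide C X"] by simp
  also have "\<dots> = left_swap A E (B \<odot> X) \<cdot> (Ide C A \<star> Assoc C E B X) \<cdot>
      (Assoc C A (E \<odot> B) X \<cdot> ((Ide C A \<star> Swap C B E) \<star> Ide C X)) \<cdot>
      (Assoc C A B E \<star> Ide C X)"
    unfolding p3 [symmetric] by (simp add: left_swap_def)
  also have "\<dots> = left_swap A E (B \<odot> X) \<cdot> ((Ide C A \<star> (Assoc C E B X \<cdot> (Swap C B E \<star> Ide C X))) \<cdot>
      Assoc C A (B \<odot> E) X) \<cdot> (Assoc C A B E \<star> Ide C X)"
    using assoc_nat [of "Ide C A" "Swap C B E" "Ide C X"] by simp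
  also have "\<dots> = left_swap A E (B \<odot> X) \<cdot> (Ide C A \<star> left_swap B E X) \<cdot>
    ((Ide C A \<star> Assoc C B E X) \<cdot> Assoc C A (B \<odot> E) X \<cdot> (Assoc C A B E \<star> Ide C X))"
    by (simp add: left_swap_assoc)
  also have "\<dots> = (left_swap A E (B \<odot> X) \<cdot> (Ide C A \<star> left_swap B E X) \<cdot>
    Assoc C A B (E \<odot> X)) \<cdot> Assoc C (A \<odot> B) E X"
    unfolding p2 by simp
  finally show ?thesis
    by (rule iso_cancel_right [rotated -1]) simp_all
qed

text \<open>After the interchange, swapping \<open>A\<close> with \<open>E\<close> completes the
  move of \<open>E\<close> past \<open>A \<odot> B\<close> (\<open>left_swap_tensor\<close>), and
  swapping \<open>B\<close> with \<open>G\<close> completes that of \<open>G\<close>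
  (\<open>left_swap_swap\<close>). By the hexagon the two moves together are the symmetry of
  \<open>A \<odot> B\<close> with \<open>E \<odot> G\<close>.\<close>

lemma middle_swap_swap:
  assumes "A \<in> Ob C" "B \<in> Ob C" "E \<in> Ob C" "G \<in> Ob C"
  shows "(Swap C A E \<star> Swap C B G) \<cdot> middle_swap C A B E G =
    middle_swap C E G A B \<cdot> Swap C (A \<odot> B) (E \<odot> G)"
proof (rule iso_cancel_left [of "Assoc C E A (G \<odot> B)"])
  note [simp] = assms
  have "Assoc C E A (G \<odot> B) \<cdot> (Swap C A E \<star> Swap C B G) \<cdot> middle_swap C A B E G =
    (Assoc C E A (G \<odot> B) \<cdot> (Ide C (E \<odot> A) \<star> Swap C B G)) \<cdot>
      (Swap C A E \<star> Ide C (B \<odot> G)) \<cdot> middle_swap C A B E G"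
    by simp
  also have "\<dots> = ((Ide C E \<star> (Ide C A \<star> Swap C B G)) \<cdot> Assoc C E A (B \<odot> G)) \<cdot>
      (Swap C A E \<star> Ide C (B \<odot> G)) \<cdot> middle_swap C A B E G"
    using assoc_nat [of "Ide C E" "Ide C A" "Swap C B G"] by simp
  also have "\<dots> = (Ide C E \<star> (Ide C A \<star> Swap C B G)) \<cdot>
      (left_swap A E (B \<odot> G) \<cdot> (Ide C A \<star> left_swap B E G) \<cdot> Assoc C A B (E \<odot> G))"
    by (simp add: middle_swap_left_swap left_swap_def [of A])
  also have "\<dots> = (Ide C E \<star> ((Ide C A \<star> Swap C B G) \<cdot> Assoc C A B G)) \<cdot> left_swap (A \<odot> B) E G"
    unfolding left_swap_tensor [OF assms, symmetric] by simp
  also have "\<dots> = (Ide C E \<star> left_swap G A B) \<cdot>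
      ((Ide C E \<star> Swap C (A \<odot> B) G) \<cdot> left_swap (A \<odot> B) E G)"
    unfolding left_swap_swap [OF assms(1,2,4), symmetric] by simp
  also have "\<dots> = Assoc C E A (G \<odot> B) \<cdot> middle_swap C E G A B \<cdot> Swap C (A \<odot> B) (E \<odot> G)"
    by (simp add: assoc_swap [symmetric] middle_swap_left_swap)
  finally show "Assoc C E A (G \<odot> B) \<cdot> (Swap C A E \<star> Swap C B G) \<cdot> middle_swap C A B E G =
    Assoc C E A (G \<odot> B) \<cdot> middle_swap C E G A B \<cdot> Swap C (A \<odot> B) (E \<odot> G)" .
qed (use assms in simp_all)

end

context symmetric_monoidal_closed_category
begin

lemma ihom_ob [simp]: "A \<in> Ob C \<Longrightarrow> B \<in> Ob C \<Longrightarrow> A \<rightarrowtail> B \<in> Ob C"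
  using is_functorD(1) [OF ihom_functor, of "(A, B)"] by simp

lemma ihom_ar [simp]:
  assumes "f \<in> Ar C" "g \<in> Ar C"
  shows "f \<Zinj> g \<in> Ar C" "Dom C (f \<Zinj> g) = Cod C f \<rightarrowtail> Dom C g" "Cod C (f \<Zinj> g) = Dom C f \<rightarrowtail> Cod C g"
  using assms is_functorD(2-4) [OF ihom_functor, of "(f, g)"] by simp_all

lemma ihom_Ide [simp]: "A \<in> Ob C \<Longrightarrow> B \<in> Ob C \<Longrightarrow> Ide C A \<Zinj> Ide C B = Ide C (A \<rightarrowtail> B)"
  using is_functorD(5) [OF ihom_functor, of "(A, B)"] by simp

lemma ihom_Comp:
  assumes "f \<in> Ar C" "g \<in> Ar C" "h \<in> Ar C" "k \<in> Ar C" "Cod C h = Dom C f" "Dom C k = Cod C g"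
  shows "(h \<Zinj> k) \<cdot> (f \<Zinj> g) = (f \<cdot> h) \<Zinj> (k \<cdot> g)"
  using is_functorD(6) [OF ihom_functor, of "(f, g)" "(h, k)"] assms by simp

lemma Ev_ar [simp]:
  assumes "X \<in> Ob C" "A \<in> Ob C"
  shows "Ev C X A \<in> Ar C" "Dom C (Ev C X A) = (X \<rightarrowtail> A) \<odot> X" "Cod C (Ev C X A) = A"
  using ev_closed [OF assms] by (simp_all add: Hom_def)

lemma Coev_ar [simp]:
  assumes "X \<in> Ob C" "A \<in> Ob C"
  shows "Coev C X A \<in> Ar C" "Dom C (Coev C X A) = A" "Cod C (Coev C X A) = X \<rightarrowtail> (A \<odot> X)"
  using coev_closed [OF assms] by (simp_all add: Hom_def)

subsection \<open>Currying\<close>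

definition uncurry_arrow :: "'o \<Rightarrow> 'o \<Rightarrow> 'a \<Rightarrow> 'a" where
  "uncurry_arrow X B h = Ev C X B \<cdot> (h \<star> Ide C X)"

lemma uncurry_arrow_ar [simp]:
  assumes "X \<in> Ob C" "B \<in> Ob C" "h \<in> Ar C" "Cod C h = X \<rightarrowtail> B"
  shows "uncurry_arrow X B h \<in> Ar C" "Dom C (uncurry_arrow X B h) = Dom C h \<odot> X"
    "Cod C (uncurry_arrow X B h) = B"
  using assms by (simp_all add: uncurry_arrow_def)

lemma curry_arrow_ar [simp]:
  assumes "A \<in> Ob C" "X \<in> Ob C" "g \<in> Ar C" "Dom C g = A \<odot> X"
  shows "curry_arrow C A X g \<in> Ar C" "Dom C (curry_arrow C A X g) = A"
    "Cod C (curry_arrow C A X g) = X \<rightarrowtail> Cod C g"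
  using assms by (simp_all add: curry_arrow_def)

lemma Ev_nat:
  assumes "X \<in> Ob C" "g \<in> Ar C"
  shows "Ev C X (Cod C g) \<cdot> ((Ide C X \<Zinj> g) \<star> Ide C X) = g \<cdot> Ev C X (Dom C g)"
  using assms by (intro ev_natural) (simp_all add: Hom_def)

lemma Coev_nat:
  assumes "X \<in> Ob C" "g \<in> Ar C"
  shows "(Ide C X \<Zinj> (g \<star> Ide C X)) \<cdot> Coev C X (Dom C g) = Coev C X (Cod C g) \<cdot> g"
  using assms by (intro coev_natural [symmetric]) (simp_all add: Hom_def)

lemma uncurry_post:
  assumes "X \<in> Ob C" "g \<in> Ar C" "h \<in> Ar C" "Cod C h = X \<rightarrowtail> Dom C g" "Cod C g = B"
  shows "uncurry_arrow X B ((Ide C X \<Zinj> g) \<cdot> h) = g \<cdot> uncurry_arrow X (Dom C g) h"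
proof -
  have "(Ev C X (Cod C g) \<cdot> ((Ide C X \<Zinj> g) \<star> Ide C X)) \<cdot> (h \<star> Ide C X) =
    g \<cdot> uncurry_arrow X (Dom C g) h"
    using assms unfolding Ev_nat [OF assms(1,2)] by (simp add: uncurry_arrow_def)
  then show ?thesis
    using assms by (auto simp: uncurry_arrow_def)
qed

lemma uncurry_Comp:
  assumes "X \<in> Ob C" "B \<in> Ob C" "h \<in> Ar C" "Cod C h = X \<rightarrowtail> B" "k \<in> Ar C" "Cod C k = Dom C h"
  shows "uncurry_arrow X B (h \<cdot> k) = uncurry_arrow X B h \<cdot> (k \<star> Ide C X)"
  using assms by (simp add: uncurry_arrow_def)

lemma uncurry_curry [simp]:
  assumes "A \<in> Ob C" "X \<in> Ob C" "g \<in> Ar C" "Dom C g = A \<odot> X" "Cod C g = B"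
  shows "uncurry_arrow X B (curry_arrow C A X g) = g"
  using assms by (simp add: curry_arrow_def uncurry_post) (simp add: uncurry_arrow_def ev_coev)

text \<open>The second triangle identity, after naturality of the unit; \<open>uncurry_curry\<close>
  rests on the first. Together they make transposition injective.\<close>

lemma curry_uncurry:
  assumes "X \<in> Ob C" "B \<in> Ob C" "h \<in> Ar C" "Cod C h = X \<rightarrowtail> B"
  shows "curry_arrow C (Dom C h) X (uncurry_arrow X B h) = h"
proof -
  note [simp] = assms
  have "curry_arrow C (Dom C h) X (uncurry_arrow X B h) =
    ((Ide C X \<Zinj> Ev C X B) \<cdot> (Ide C X \<Zinj> (h \<star> Ide C X))) \<cdot> Coev C X (Dom C h)"
    by (subst ihom_Comp) (simp_all add: curry_arrow_def uncurry_arrow_def)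
  also have "\<dots> = (Ide C X \<Zinj> Ev C X B) \<cdot> Coev C X (X \<rightarrowtail> B) \<cdot> h"
    by (simp add: Coev_nat)
  also have "\<dots> = h"
    by (subst Comp_extend [OF coev_ev]) simp_all
  finally show ?thesis .
qed

lemma uncurry_inject:
  assumes "uncurry_arrow X B h = uncurry_arrow X B k" "X \<in> Ob C" "B \<in> Ob C"
    "h \<in> Ar C" "k \<in> Ar C" "Cod C h = X \<rightarrowtail> B" "Cod C k = X \<rightarrowtail> B" "Dom C h = Dom C k"
  shows "h = k"
  using assms curry_uncurry by metis

text \<open>This is naturality of the adjunctions in \<open>X\<close>: \<open>h\<close> is written
  as the curried form of its own transpose, so that \<open>curry_natural\<close> applies.\<close>

lemma uncurry_pre:
  assumes "x \<in> Ar C" "B \<in> Ob C" "h \<in> Ar C" "Cod C h = Cod C x \<rightarrowtail> B" "Dom C x = X"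
  shows "uncurry_arrow X B ((x \<Zinj> Ide C B) \<cdot> h) = uncurry_arrow (Cod C x) B h \<cdot> (Ide C (Dom C h) \<star> x)"
proof -
  note [simp] = assms(1-4) assms(5) [symmetric]
  have "(x \<Zinj> Ide C B) \<cdot> h =
    (x \<Zinj> Ide C B) \<cdot> curry_arrow C (Dom C h) (Cod C x) (uncurry_arrow (Cod C x) B h)"
    by (simp add: curry_uncurry)
  also have "\<dots> = curry_arrow C (Dom C h) X (uncurry_arrow (Cod C x) B h \<cdot> (Ide C (Dom C h) \<star> x))"
    by (rule curry_natural) (simp_all add: Hom_def)
  finally show ?thesis
    by simp
qed

text \<open>The transpose of an identity is evaluation, so \<open>uncurry_pre\<close> at an identity
  becomes extranaturality of evaluation.\<close>

lemma Ev_dinatural: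
  assumes "x \<in> Ar C" "B \<in> Ob C"
  shows "Ev C (Dom C x) B \<cdot> ((x \<Zinj> Ide C B) \<star> Ide C (Dom C x)) =
    Ev C (Cod C x) B \<cdot> (Ide C (Cod C x \<rightarrowtail> B) \<star> x)"
  using uncurry_pre [OF assms, of "Ide C (Cod C x \<rightarrowtail> B)"] assms by (simp add: uncurry_arrow_def)

end

section \<open>Categories with duality\<close>

text \<open>Collects the typing facts on which composites and products of duality preserving
  functors rely.\<close>

definition is_duality :: "('o, 'a, 'm) category_data_scheme \<times> ('o, 'a, 'o, 'a) functor_data
    \<times> ('o \<Rightarrow> 'a) \<Rightarrow> bool" where
  "is_duality X = (case X of (C, D, \<omega>) \<Rightarrow>
     category C \<and> is_functor (op_cat C) C D \<and> (\<forall>A\<in>Ob C. \<omega> A \<in> Hom C A (fo D (fo D A))))"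

lemma is_functor_op: "is_functor C D F \<Longrightarrow> is_functor (op_cat C) (op_cat D) F"
  by (rule is_functorI) (simp_all add: is_functorD)

lemma duality_preserving_functorD:
  assumes "duality_preserving_functor (C1, D1, \<omega>1) (C2, D2, \<omega>2) (F, \<phi>)"
  shows "is_functor C1 C2 F"
    and "A \<in> Ob C1 \<Longrightarrow> \<phi> A \<in> Ar C2"
    and "A \<in> Ob C1 \<Longrightarrow> Dom C2 (\<phi> A) = fo F (fo D1 A)"
    and "A \<in> Ob C1 \<Longrightarrow> Cod C2 (\<phi> A) = fo D2 (fo F A)"
    and "a \<in> Ar C1 \<Longrightarrow>
      \<phi> (Dom C1 a) \<cdot>\<^bsub>C2\<^esub> fa F (fa D1 a) = fa D2 (fa F a) \<cdot>\<^bsub>C2\<^esub> \<phi> (Cod C1 a)"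
    and "A \<in> Ob C1 \<Longrightarrow> \<phi> (fo D1 A) \<cdot>\<^bsub>C2\<^esub> fa F (\<omega>1 A) = fa D2 (\<phi> A) \<cdot>\<^bsub>C2\<^esub> \<omega>2 (fo F A)"
proof -
  have "nat_trans (op_cat C1) C2 (F \<circ>\<^sub>F D1) (D2 \<circ>\<^sub>F F) \<phi>"
    using assms by (simp add: duality_preserving_functor_def)
  note n = nat_transD [OF this, simplified]
  show "A \<in> Ob C1 \<Longrightarrow> \<phi> A \<in> Ar C2"
    and "A \<in> Ob C1 \<Longrightarrow> Dom C2 (\<phi> A) = fo F (fo D1 A)"
    and "A \<in> Ob C1 \<Longrightarrow> Cod C2 (\<phi> A) = fo D2 (fo F A)"
    and "a \<in> Ar C1 \<Longrightarrow>
      \<phi> (Dom C1 a) \<cdot>\<^bsub>C2\<^esub> fa F (fa D1 a) = fa D2 (fa F a) \<cdot>\<^bsub>C2\<^esub> \<phi> (Cod C1 a)"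
    by (fact n)+
qed (use assms in \<open>simp_all add: duality_preserving_functor_def\<close>)

lemma duality_preserving_functorI:
  assumes "is_functor C1 C2 F" "is_functor (op_cat C1) C1 D1" "is_functor (op_cat C2) C2 D2"
    and "\<And>A. A \<in> Ob C1 \<Longrightarrow> \<phi> A \<in> Ar C2"
    and "\<And>A. A \<in> Ob C1 \<Longrightarrow> Dom C2 (\<phi> A) = fo F (fo D1 A)"
    and "\<And>A. A \<in> Ob C1 \<Longrightarrow> Cod C2 (\<phi> A) = fo D2 (fo F A)"
    and "\<And>a. a \<in> Ar C1 \<Longrightarrow>
      \<phi> (Dom C1 a) \<cdot>\<^bsub>C2\<^esub> fa F (fa D1 a) = fa D2 (fa F a) \<cdot>\<^bsub>C2\<^esub> \<phi> (Cod C1 a)"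
    and "\<And>A. A \<in> Ob C1 \<Longrightarrow>
      \<phi> (fo D1 A) \<cdot>\<^bsub>C2\<^esub> fa F (\<omega>1 A) = fa D2 (\<phi> A) \<cdot>\<^bsub>C2\<^esub> \<omega>2 (fo F A)"
  shows "duality_preserving_functor (C1, D1, \<omega>1) (C2, D2, \<omega>2) (F, \<phi>)"
  using assms is_functor_comp [OF assms(2,1)]
    is_functor_comp [OF is_functor_op [OF assms(1)] assms(3)]
  by (auto simp: duality_preserving_functor_def intro!: nat_transI)

text \<open>The duality square of the composite is the \<open>G\<close>-image of the square for
  \<open>F\<close> pasted to the square for \<open>G\<close>; naturality of \<psi> at the arrow
  \<open>\<phi> A\<close> makes their edges match.\<close>

lemma duality_preserving_functor_comp:
  assumes XY: "duality_preserving_functor X Y \<Phi>" and YZ: "duality_preserving_functor Y (C3, D3, \<omega>3) \<Psi>"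
    and X: "is_duality X" and Y: "is_duality Y" and Z: "is_duality (C3, D3, \<omega>3)"
  shows "duality_preserving_functor X (C3, D3, \<omega>3) (dp_comp C3 \<Psi> \<Phi>)"
proof -
  obtain C1 D1 \<omega>1 C2 D2 \<omega>2 F \<phi> G \<psi>
    where e: "X = (C1, D1, \<omega>1)" "Y = (C2, D2, \<omega>2)" "\<Phi> = (F, \<phi>)" "\<Psi> = (G, \<psi>)"
    by (metis prod.collapse)
  interpret C1: category C1 using X by (simp add: e is_duality_def)
  interpret C2: category C2 using Y by (simp add: e is_duality_def)
  interpret C3: category C3 using Z by (simp add: is_duality_def)
  have D: "is_functor (op_cat C1) C1 D1" "is_functor (op_cat C2) C2 D2" "is_functor (op_cat C3) C3 D3"
    using X Y Z by (simp_all add: e is_duality_def)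
  note D1 [simp] = is_functorD [OF D(1), simplified]
  note D2 [simp] = is_functorD [OF D(2), simplified]
  note D3 [simp] = is_functorD(1-5) [OF D(3), simplified]
  note D3' = is_functorD(6) [OF D(3), simplified]
  note F = duality_preserving_functorD [OF XY [unfolded e]]
  note G = duality_preserving_functorD [OF YZ [unfolded e]]
  note [simp] = F(2-4) G(2-4) is_functorD(1-5) [OF F(1)] is_functorD(1-5) [OF G(1)]
  \<comment> \<open>Used from right to left: two images under \<open>G\<close> are merged so that an
    equation for \<open>F\<close> can be applied inside.\<close>
  note G' = is_functorD(6) [OF G(1), symmetric]
  have [simp]: "\<omega>1 A \<in> Ar C1" "Dom C1 (\<omega>1 A) = A" "Cod C1 (\<omega>1 A) = fo D1 (fo D1 A)"
    if "A \<in> Ob C1" for A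
    using X that by (simp_all add: e is_duality_def Hom_def)
  have [simp]: "\<omega>2 A \<in> Ar C2" "Dom C2 (\<omega>2 A) = A" "Cod C2 (\<omega>2 A) = fo D2 (fo D2 A)"
    if "A \<in> Ob C2" for A
    using Y that by (simp_all add: e is_duality_def Hom_def)
  have [simp]: "\<omega>3 A \<in> Ar C3" "Dom C3 (\<omega>3 A) = A" "Cod C3 (\<omega>3 A) = fo D3 (fo D3 A)"
    if "A \<in> Ob C3" for A
    using Z that by (simp_all add: is_duality_def Hom_def)
  show ?thesis
    unfolding e dp_comp_def prod.case
  proof (rule duality_preserving_functorI)
    show "is_functor C1 C3 (G \<circ>\<^sub>F F)"
      by (rule is_functor_comp [OF F(1) G(1)])
  next
    fix a assume [simp]: "a \<in> Ar C1"
    have "\<psi> (fo F (Dom C1 a)) \<cdot>\<^bsub>C3\<^esub> (fa G (\<phi> (Dom C1 a)) \<cdot>\<^bsub>C3\<^esub> fa G (fa F (fa D1 a))) =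
      (\<psi> (fo F (Dom C1 a)) \<cdot>\<^bsub>C3\<^esub> fa G (fa D2 (fa F a))) \<cdot>\<^bsub>C3\<^esub> fa G (\<phi> (Cod C1 a))"
      by (simp add: G' F(5))
    also have "\<dots> = (fa D3 (fa G (fa F a)) \<cdot>\<^bsub>C3\<^esub> \<psi> (fo F (Cod C1 a))) \<cdot>\<^bsub>C3\<^esub> fa G (\<phi> (Cod C1 a))"
      using G(5) [of "fa F a"] by simp
    finally show "(\<psi> (fo F (Dom C1 a)) \<cdot>\<^bsub>C3\<^esub> fa G (\<phi> (Dom C1 a))) \<cdot>\<^bsub>C3\<^esub> fa (G \<circ>\<^sub>F F) (fa D1 a) =
      fa D3 (fa (G \<circ>\<^sub>F F) a) \<cdot>\<^bsub>C3\<^esub> \<psi> (fo F (Cod C1 a)) \<cdot>\<^bsub>C3\<^esub> fa G (\<phi> (Cod C1 a))"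
      by simp
  next
    fix A assume [simp]: "A \<in> Ob C1"
    have "\<psi> (fo F (fo D1 A)) \<cdot>\<^bsub>C3\<^esub> (fa G (\<phi> (fo D1 A)) \<cdot>\<^bsub>C3\<^esub> fa G (fa F (\<omega>1 A))) =
      (\<psi> (fo F (fo D1 A)) \<cdot>\<^bsub>C3\<^esub> fa G (fa D2 (\<phi> A))) \<cdot>\<^bsub>C3\<^esub> fa G (\<omega>2 (fo F A))"
      by (simp add: G' F(6))
    also have "\<dots> = fa D3 (fa G (\<phi> A)) \<cdot>\<^bsub>C3\<^esub> (\<psi> (fo D2 (fo F A)) \<cdot>\<^bsub>C3\<^esub> fa G (\<omega>2 (fo F A)))"
      using G(5) [of "\<phi> A"] by simp
    also have "\<dots> = (fa D3 (fa G (\<phi> A)) \<cdot>\<^bsub>C3\<^esub> fa D3 (\<psi> (fo F A))) \<cdot>\<^bsub>C3\<^esub> \<omega>3 (fo G (fo F A))"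
      by (simp add: G(6))
    also have "\<dots> = fa D3 (\<psi> (fo F A) \<cdot>\<^bsub>C3\<^esub> fa G (\<phi> A)) \<cdot>\<^bsub>C3\<^esub> \<omega>3 (fo G (fo F A))"
      by (simp add: D3')
    finally show "(\<psi> (fo F (fo D1 A)) \<cdot>\<^bsub>C3\<^esub> fa G (\<phi> (fo D1 A))) \<cdot>\<^bsub>C3\<^esub> fa (G \<circ>\<^sub>F F) (\<omega>1 A) =
      fa D3 (\<psi> (fo F A) \<cdot>\<^bsub>C3\<^esub> fa G (\<phi> A)) \<cdot>\<^bsub>C3\<^esub> \<omega>3 (fo (G \<circ>\<^sub>F F) A)"
      by simp
  qed (simp_all add: D)
qed

lemma prod_category:
  assumes "category C" "category D"
  shows "category (prod_cat C D)"
proof -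
  interpret C: category C by fact
  interpret D: category D by fact
  show ?thesis
    by unfold_locales (auto simp: Hom_def)
qed

text \<open>\<open>op_cat (prod_cat C D)\<close> is not syntactically a product of opposite
  categories, so \<open>is_functor_prod\<close> does not match.\<close>

lemma is_functor_op_prod:
  assumes "is_functor (op_cat C) C' F" "is_functor (op_cat D) D' G"
  shows "is_functor (op_cat (prod_cat C D)) (prod_cat C' D') (F \<times>\<^sub>F G)"
  by (rule is_functorI)
    (auto simp: is_functorD [OF assms(1), simplified] is_functorD [OF assms(2), simplified])

lemma is_duality_prod:
  assumes "is_duality X" "is_duality Y"
  shows "is_duality (prod_duality X Y)"
  using assms
  by (auto simp: is_duality_def prod_duality_def prod_category is_functor_op_prod Hom_def
      split: prod.splits)

lemma duality_preserving_functor_prod: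
  assumes "duality_preserving_functor X Y \<Phi>" "duality_preserving_functor X' Y' \<Psi>"
    and "is_duality X" "is_duality Y" "is_duality X'" "is_duality Y'"
  shows "duality_preserving_functor (prod_duality X X') (prod_duality Y Y') (dp_prod \<Phi> \<Psi>)"
proof -
  obtain C1 D1 \<omega>1 C2 D2 \<omega>2 F \<phi> C1' D1' \<omega>1' C2' D2' \<omega>2' F' \<phi>'
    where e: "X = (C1, D1, \<omega>1)" "Y = (C2, D2, \<omega>2)" "\<Phi> = (F, \<phi>)"
      "X' = (C1', D1', \<omega>1')" "Y' = (C2', D2', \<omega>2')" "\<Psi> = (F', \<phi>')"
    by (metis prod.collapse)
  have D: "is_functor (op_cat C1) C1 D1" "is_functor (op_cat C2) C2 D2"
    "is_functor (op_cat C1') C1' D1'" "is_functor (op_cat C2') C2' D2'"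
    using assms(3-6) by (simp_all add: e is_duality_def)
  note F = duality_preserving_functorD [OF assms(1) [unfolded e]]
  note F' = duality_preserving_functorD [OF assms(2) [unfolded e]]
  show ?thesis
    unfolding e prod_duality_def dp_prod_def prod.case fst_conv snd_conv
    by (rule duality_preserving_functorI)
      (auto simp: F F' is_functor_prod is_functor_op_prod D)
qed

lemma dual_functor_simps [simp]:
  "fo (dual_functor C K) A = A \<rightarrowtail>\<^bsub>C\<^esub> K" "fa (dual_functor C K) a = a \<Zinj>\<^bsub>C\<^esub> Ide C K"
  by (simp_all add: dual_functor_def)

section \<open>Dualities given by the internal Hom: change of dualizing object and tensor
  product\<close>

context symmetric_monoidal_closed_category
begin

lemma is_functor_dual: "K \<in> Ob C \<Longrightarrow> is_functor (op_cat C) C (dual_functor C K)"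
  by (rule is_functorI) (simp_all add: ihom_Comp)

lemma bidual_ar [simp]:
  assumes "K \<in> Ob C" "A \<in> Ob C"
  shows "bidual C K A \<in> Ar C" "Dom C (bidual C K A) = A" "Cod C (bidual C K A) = (A \<rightarrowtail> K) \<rightarrowtail> K"
  using assms by (simp_all add: bidual_def ev_right_def)

lemma uncurry_bidual:
  assumes "K \<in> Ob C" "A \<in> Ob C"
  shows "uncurry_arrow (A \<rightarrowtail> K) K (bidual C K A) = Ev C A K \<cdot> Swap C A (A \<rightarrowtail> K)"
  using assms by (simp add: bidual_def ev_right_def)

lemma is_duality_dual: "K \<in> Ob C \<Longrightarrow> is_duality (with_duality C K)"
  by (simp add: is_duality_def with_duality_def category_axioms is_functor_dual Hom_def)

text \<open>Transposes the side \<open>D(h) \<circ> \<varpi>\<close> of a duality square: the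
  biduality map transposes to evaluation after a symmetry, and by naturality \<open>h\<close> slides
  through that symmetry. All duality squares for concrete functors below use it.\<close>

lemma uncurry_bidual_pre:
  assumes "K \<in> Ob C" "X \<in> Ob C" "h \<in> Ar C" "Cod C h = X \<rightarrowtail> K" "Dom C h = W"
  shows "uncurry_arrow W K ((h \<Zinj> Ide C K) \<cdot> bidual C K X) = uncurry_arrow X K h \<cdot> Swap C X W"
proof -
  note [simp] = assms(1-4) assms(5) [symmetric]
  have "uncurry_arrow W K ((h \<Zinj> Ide C K) \<cdot> bidual C K X) =
    Ev C X K \<cdot> Swap C X (X \<rightarrowtail> K) \<cdot> (Ide C X \<star> h)"
    by (simp add: uncurry_pre uncurry_bidual)
  also have "\<dots> = Ev C X K \<cdot> (h \<star> Ide C X) \<cdot> Swap C X W"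
    using swap_nat [of "Ide C X" h] by simp
  also have "\<dots> = uncurry_arrow X K h \<cdot> Swap C X W"
    by (simp add: uncurry_arrow_def)
  finally show ?thesis .
qed

text \<open>Both sides of the duality square transpose to \<iota> after evaluation after the
  symmetry, by naturality of evaluation in the target.\<close>

lemma change_dualizing_duality_preserving:
  assumes "\<iota> \<in> Ar C"
  shows "duality_preserving_functor (with_duality C (Dom C \<iota>)) (with_duality C (Cod C \<iota>))
    (change_dualizing C \<iota>)"
  unfolding with_duality_def change_dualizing_def
proof (rule duality_preserving_functorI)
  fix A assume A: "A \<in> Ob C"
  note [simp] = A assms
  let ?K = "Dom C \<iota>" and ?M = "Cod C \<iota>"
  have "uncurry_arrow (A \<rightarrowtail> ?K) ?M ((Ide C (A \<rightarrowtail> ?K) \<Zinj> \<iota>) \<cdot> bidual C ?K A) =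
    uncurry_arrow (A \<rightarrowtail> ?K) ?M (((Ide C A \<Zinj> \<iota>) \<Zinj> Ide C ?M) \<cdot> bidual C ?M A)"
    using Ev_nat [OF A assms]
    by (simp add: uncurry_post uncurry_bidual_pre uncurry_bidual uncurry_arrow_def [of A])
  then have "(Ide C (A \<rightarrowtail> ?K) \<Zinj> \<iota>) \<cdot> bidual C ?K A =
      ((Ide C A \<Zinj> \<iota>) \<Zinj> Ide C ?M) \<cdot> bidual C ?M A"
    by (rule uncurry_inject) simp_all
  then show "(Ide C (fo (dual_functor C ?K) A) \<Zinj> \<iota>) \<cdot> fa id_functor (bidual C ?K A) =
      fa (dual_functor C ?M) (Ide C A \<Zinj> \<iota>) \<cdot> bidual C ?M (fo id_functor A)"
    by simp
qed (use assms in \<open>simp_all add: is_functor_id is_functor_dual ihom_Comp\<close>)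

lemma tau_curry:
  assumes "K \<in> Ob C" "M \<in> Ob C" "A \<in> Ob C" "B \<in> Ob C"
  shows "tau C K M (A, B) = curry_arrow C ((A \<rightarrowtail> K) \<odot> (B \<rightarrowtail> M)) (A \<odot> B)
    ((Ev C A K \<star> Ev C B M) \<cdot> middle_swap C (A \<rightarrowtail> K) (B \<rightarrowtail> M) A B)"
proof -
  note [simp] = assms
  have "(Ide C (A \<odot> B) \<Zinj> ((Ev C A K \<star> Ev C B M) \<cdot> middle_swap C (A \<rightarrowtail> K) (B \<rightarrowtail> M) A B)) =
    (Ide C (A \<odot> B) \<Zinj> (Ev C A K \<star> Ev C B M)) \<cdot>
    (Ide C (A \<odot> B) \<Zinj> middle_swap C (A \<rightarrowtail> K) (B \<rightarrowtail> M) A B)"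
    by (subst ihom_Comp) simp_all
  then show ?thesis
    by (simp add: tau_def curry_arrow_def)
qed

lemma tau_ar [simp]:
  assumes "K \<in> Ob C" "M \<in> Ob C" "A \<in> Ob C" "B \<in> Ob C"
  shows "tau C K M (A, B) \<in> Ar C" "Dom C (tau C K M (A, B)) = (A \<rightarrowtail> K) \<odot> (B \<rightarrowtail> M)"
    "Cod C (tau C K M (A, B)) = (A \<odot> B) \<rightarrowtail> (K \<odot> M)"
  using assms by (simp_all add: tau_curry)

lemma uncurry_tau:
  assumes "K \<in> Ob C" "M \<in> Ob C" "A \<in> Ob C" "B \<in> Ob C"
  shows "uncurry_arrow (A \<odot> B) (K \<odot> M) (tau C K M (A, B)) =
    (Ev C A K \<star> Ev C B M) \<cdot> middle_swap C (A \<rightarrowtail> K) (B \<rightarrowtail> M) A B"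
  using assms by (simp add: tau_curry)

text \<open>Naturality of \<open>middle_swap\<close> lets \<open>h\<close> and \<open>k\<close>
  slide through the interchange to their own evaluations.\<close>

lemma uncurry_tau_pre:
  assumes "K \<in> Ob C" "M \<in> Ob C" "A \<in> Ob C" "B \<in> Ob C"
    and "h \<in> Ar C" "k \<in> Ar C" "Cod C h = A \<rightarrowtail> K" "Cod C k = B \<rightarrowtail> M"
  shows "uncurry_arrow (A \<odot> B) (K \<odot> M) (tau C K M (A, B) \<cdot> (h \<star> k)) =
    (uncurry_arrow A K h \<star> uncurry_arrow B M k) \<cdot> middle_swap C (Dom C h) (Dom C k) A B"
proof -
  note [simp] = assms
  have "uncurry_arrow (A \<odot> B) (K \<odot> M) (tau C K M (A, B) \<cdot> (h \<star> k)) =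
    (Ev C A K \<star> Ev C B M) \<cdot> (middle_swap C (A \<rightarrowtail> K) (B \<rightarrowtail> M) A B \<cdot>
      ((h \<star> k) \<star> Ide C (A \<odot> B)))"
    by (simp add: uncurry_Comp uncurry_tau)
  also have "\<dots> = (Ev C A K \<star> Ev C B M) \<cdot> (((h \<star> Ide C A) \<star> (k \<star> Ide C B)) \<cdot>
      middle_swap C (Dom C h) (Dom C k) A B)"
    using middle_swap_nat [of h k "Ide C A" "Ide C B"] by simp
  finally show ?thesis
    by (simp add: uncurry_arrow_def)
qed

text \<open>Naturality of \<tau> reduces to extranaturality of the two evaluations and
  \<open>middle_swap_nat\<close>. The duality square transposes to \<open>middle_swap_swap\<close>,
  the two symmetries coming from the biduality maps of the factors.\<close>

lemma product_duality_preserving: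
  assumes K [simp]: "K \<in> Ob C" and M [simp]: "M \<in> Ob C"
  shows "duality_preserving_functor (prod_duality (with_duality C K) (with_duality C M))
    (with_duality C (K \<odot> M)) (product_dp C K M)"
  unfolding with_duality_def product_dp_def prod_duality_def prod.case
proof (rule duality_preserving_functorI)
  fix x assume "x \<in> Ar (prod_cat C C)"
  then obtain a b where x: "x = (a, b)" and a [simp]: "a \<in> Ar C" and b [simp]: "b \<in> Ar C"
    by auto
  have e: "uncurry_arrow (Dom C d) N (d \<Zinj> Ide C N) =
      Ev C (Cod C d) N \<cdot> (Ide C (Cod C d \<rightarrowtail> N) \<star> d)" if "d \<in> Ar C" "N \<in> Ob C" for d N
    using Ev_dinatural [OF that] by (simp add: uncurry_arrow_def)
  have "uncurry_arrow (Dom C a \<odot> Dom C b) (K \<odot> M)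
      (((a \<star> b) \<Zinj> Ide C (K \<odot> M)) \<cdot> tau C K M (Cod C a, Cod C b)) =
    (Ev C (Cod C a) K \<star> Ev C (Cod C b) M) \<cdot>
      (middle_swap C (Cod C a \<rightarrowtail> K) (Cod C b \<rightarrowtail> M) (Cod C a) (Cod C b) \<cdot>
      (Ide C ((Cod C a \<rightarrowtail> K) \<odot> (Cod C b \<rightarrowtail> M)) \<star> (a \<star> b)))"
    by (simp add: uncurry_pre uncurry_tau)
  also have "\<dots> = (Ev C (Cod C a) K \<star> Ev C (Cod C b) M) \<cdot>
      (((Ide C (Cod C a \<rightarrowtail> K) \<star> a) \<star> (Ide C (Cod C b \<rightarrowtail> M) \<star> b)) \<cdot>
      middle_swap C (Cod C a \<rightarrowtail> K) (Cod C b \<rightarrowtail> M) (Dom C a) (Dom C b))"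
    using middle_swap_nat [of "Ide C (Cod C a \<rightarrowtail> K)" "Ide C (Cod C b \<rightarrowtail> M)" a b] by simp
  also have "\<dots> = uncurry_arrow (Dom C a \<odot> Dom C b) (K \<odot> M)
      (tau C K M (Dom C a, Dom C b) \<cdot> ((a \<Zinj> Ide C K) \<star> (b \<Zinj> Ide C M)))"
    by (simp add: uncurry_tau_pre e)
  finally have "tau C K M (Dom C a, Dom C b) \<cdot> ((a \<Zinj> Ide C K) \<star> (b \<Zinj> Ide C M)) =
      ((a \<star> b) \<Zinj> Ide C (K \<odot> M)) \<cdot> tau C K M (Cod C a, Cod C b)"
    by (rule uncurry_inject [OF sym]) simp_all
  then show "tau C K M (Dom (prod_cat C C) x) \<cdot>
      fa (Tensor C) (fa (dual_functor C K \<times>\<^sub>F dual_functor C M) x) =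
    fa (dual_functor C (K \<odot> M)) (fa (Tensor C) x) \<cdot> tau C K M (Cod (prod_cat C C) x)"
    by (simp add: x)
next
  fix P assume "P \<in> Ob (prod_cat C C)"
  then obtain A B where P: "P = (A, B)" and [simp]: "A \<in> Ob C" "B \<in> Ob C"
    by auto
  have "uncurry_arrow ((A \<rightarrowtail> K) \<odot> (B \<rightarrowtail> M)) (K \<odot> M)
      (tau C K M (A \<rightarrowtail> K, B \<rightarrowtail> M) \<cdot> (bidual C K A \<star> bidual C M B)) =
    (Ev C A K \<star> Ev C B M) \<cdot> ((Swap C A (A \<rightarrowtail> K) \<star> Swap C B (B \<rightarrowtail> M)) \<cdot>
      middle_swap C A B (A \<rightarrowtail> K) (B \<rightarrowtail> M))"
    by (simp add: uncurry_tau_pre uncurry_bidual)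
  also have "\<dots> = uncurry_arrow ((A \<rightarrowtail> K) \<odot> (B \<rightarrowtail> M)) (K \<odot> M)
      ((tau C K M (A, B) \<Zinj> Ide C (K \<odot> M)) \<cdot> bidual C (K \<odot> M) (A \<odot> B))"
    by (simp add: middle_swap_swap uncurry_bidual_pre uncurry_tau)
  finally have "tau C K M (A \<rightarrowtail> K, B \<rightarrowtail> M) \<cdot> (bidual C K A \<star> bidual C M B) =
      (tau C K M (A, B) \<Zinj> Ide C (K \<odot> M)) \<cdot> bidual C (K \<odot> M) (A \<odot> B)"
    by (rule uncurry_inject) simp_all
  then show "tau C K M (fo (dual_functor C K \<times>\<^sub>F dual_functor C M) P) \<cdot>
      fa (Tensor C) (map_prod (bidual C K) (bidual C M) P) =
    fa (dual_functor C (K \<odot> M)) (tau C K M P) \<cdot> bidual C (K \<odot> M) (fo (Tensor C) P)"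
    by (simp add: P)
qed (auto simp: is_functor_dual is_functor_op_prod tensor_functor)

end

section \<open>Symmetric monoidal functors\<close>

locale closed_monoidal_functor =
  C: symmetric_monoidal_closed_category C + D: symmetric_monoidal_closed_category D
  for C :: "('o, 'a, 'm) smcc_data_scheme" and D :: "('p, 'b, 'n) smcc_data_scheme" +
  fixes f :: "('o, 'a, 'p, 'b) functor_data" and \<alpha> :: "'o \<times> 'o \<Rightarrow> 'b"
  assumes monoidal: "symmetric_monoidal_functor C D f \<alpha>"
begin

lemma f_functor: "is_functor C D f"
  using monoidal by (simp add: symmetric_monoidal_functor_def)

lemmas f_simps [simp] = is_functorD [OF f_functor]

lemmas f_iso = functor_iso [OF C.category_axioms D.category_axioms f_functor]

lemma \<alpha>_nat_iso: "nat_iso (prod_cat C C) D (Tensor D \<circ>\<^sub>F f \<times>\<^sub>F f) (f \<circ>\<^sub>F Tensor C) \<alpha>"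
  using monoidal by (simp add: symmetric_monoidal_functor_def)

lemma \<alpha>_ar [simp]:
  assumes "A \<in> Ob C" "B \<in> Ob C"
  shows "\<alpha> (A, B) \<in> Ar D" "Dom D (\<alpha> (A, B)) = fo f A \<odot>\<^bsub>D\<^esub> fo f B"
    "Cod D (\<alpha> (A, B)) = fo f (A \<odot>\<^bsub>C\<^esub> B)" "is_isomorphism D (\<alpha> (A, B))"
proof -
  have n: "nat_trans (prod_cat C C) D (Tensor D \<circ>\<^sub>F f \<times>\<^sub>F f) (f \<circ>\<^sub>F Tensor C) \<alpha>"
    using \<alpha>_nat_iso by (simp add: nat_iso_def)
  show "\<alpha> (A, B) \<in> Ar D" "Dom D (\<alpha> (A, B)) = fo f A \<odot>\<^bsub>D\<^esub> fo f B"
    "Cod D (\<alpha> (A, B)) = fo f (A \<odot>\<^bsub>C\<^esub> B)"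
    using nat_transD(3-5) [OF n, of "(A, B)"] assms by simp_all
  show "is_isomorphism D (\<alpha> (A, B))"
    using \<alpha>_nat_iso assms by (simp add: nat_iso_def)
qed

lemma \<alpha>_nat:
  assumes "a \<in> Ar C" "b \<in> Ar C"
  shows "\<alpha> (Cod C a, Cod C b) \<cdot>\<^bsub>D\<^esub> (fa f a \<star>\<^bsub>D\<^esub> fa f b) =
    fa f (a \<star>\<^bsub>C\<^esub> b) \<cdot>\<^bsub>D\<^esub> \<alpha> (Dom C a, Dom C b)"
proof -
  have n: "nat_trans (prod_cat C C) D (Tensor D \<circ>\<^sub>F f \<times>\<^sub>F f) (f \<circ>\<^sub>F Tensor C) \<alpha>"
    using \<alpha>_nat_iso by (simp add: nat_iso_def)
  show ?thesis
    using nat_transD(6) [OF n, of "(a, b)"] assms by simp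
qed

section \<open>Compatibility of \<alpha> with the middle four interchange\<close>

lemma \<alpha>_assoc:
  assumes "A \<in> Ob C" "B \<in> Ob C" "E \<in> Ob C"
  shows "fa f (Assoc C A B E) \<cdot>\<^bsub>D\<^esub> \<alpha> (A \<odot>\<^bsub>C\<^esub> B, E) \<cdot>\<^bsub>D\<^esub> (\<alpha> (A, B) \<star>\<^bsub>D\<^esub> Ide D (fo f E)) =
    \<alpha> (A, B \<odot>\<^bsub>C\<^esub> E) \<cdot>\<^bsub>D\<^esub> (Ide D (fo f A) \<star>\<^bsub>D\<^esub> \<alpha> (B, E)) \<cdot>\<^bsub>D\<^esub>
      Assoc D (fo f A) (fo f B) (fo f E)"
  using monoidal assms by (simp add: symmetric_monoidal_functor_def)

lemma \<alpha>_swap: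
  assumes "A \<in> Ob C" "B \<in> Ob C"
  shows "fa f (Swap C A B) \<cdot>\<^bsub>D\<^esub> \<alpha> (A, B) = \<alpha> (B, A) \<cdot>\<^bsub>D\<^esub> Swap D (fo f A) (fo f B)"
  using monoidal assms by (simp add: symmetric_monoidal_functor_def)

text \<open>\<open>left_swap\<close> is built from two associators and a symmetry, and \<alpha>
  respects all three. Precomposing with an associator avoids its inverse in the calculation.\<close>

lemma \<alpha>_left_swap:
  assumes "A \<in> Ob C" "B \<in> Ob C" "E \<in> Ob C"
  shows "fa f (C.left_swap A B E) \<cdot>\<^bsub>D\<^esub> \<alpha> (A, B \<odot>\<^bsub>C\<^esub> E) \<cdot>\<^bsub>D\<^esub> (Ide D (fo f A) \<star>\<^bsub>D\<^esub> \<alpha> (B, E)) =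
    \<alpha> (B, A \<odot>\<^bsub>C\<^esub> E) \<cdot>\<^bsub>D\<^esub> (Ide D (fo f B) \<star>\<^bsub>D\<^esub> \<alpha> (A, E)) \<cdot>\<^bsub>D\<^esub>
      D.left_swap (fo f A) (fo f B) (fo f E)"
proof (rule D.iso_cancel_right [of "Assoc D (fo f A) (fo f B) (fo f E)"])
  note [simp] = assms
  have "(fa f (C.left_swap A B E) \<cdot>\<^bsub>D\<^esub> \<alpha> (A, B \<odot>\<^bsub>C\<^esub> E) \<cdot>\<^bsub>D\<^esub> (Ide D (fo f A) \<star>\<^bsub>D\<^esub> \<alpha> (B, E))) \<cdot>\<^bsub>D\<^esub>
      Assoc D (fo f A) (fo f B) (fo f E) =
    fa f (C.left_swap A B E) \<cdot>\<^bsub>D\<^esub> (fa f (Assoc C A B E) \<cdot>\<^bsub>D\<^esub> \<alpha> (A \<odot>\<^bsub>C\<^esub> B, E) \<cdot>\<^bsub>D\<^esub>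
      (\<alpha> (A, B) \<star>\<^bsub>D\<^esub> Ide D (fo f E)))"
    unfolding \<alpha>_assoc [OF assms] by simp
  also have "\<dots> = fa f (C.left_swap A B E \<cdot>\<^bsub>C\<^esub> Assoc C A B E) \<cdot>\<^bsub>D\<^esub> \<alpha> (A \<odot>\<^bsub>C\<^esub> B, E) \<cdot>\<^bsub>D\<^esub>
      (\<alpha> (A, B) \<star>\<^bsub>D\<^esub> Ide D (fo f E))"
    by simp
  also have "\<dots> = fa f (Assoc C B A E) \<cdot>\<^bsub>D\<^esub>
      (fa f (Swap C A B \<star>\<^bsub>C\<^esub> Ide C E) \<cdot>\<^bsub>D\<^esub> \<alpha> (A \<odot>\<^bsub>C\<^esub> B, E)) \<cdot>\<^bsub>D\<^esub>
      (\<alpha> (A, B) \<star>\<^bsub>D\<^esub> Ide D (fo f E))"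
    unfolding C.left_swap_assoc [OF assms] by simp
  also have "\<dots> = fa f (Assoc C B A E) \<cdot>\<^bsub>D\<^esub> (\<alpha> (B \<odot>\<^bsub>C\<^esub> A, E) \<cdot>\<^bsub>D\<^esub>
      ((fa f (Swap C A B) \<cdot>\<^bsub>D\<^esub> \<alpha> (A, B)) \<star>\<^bsub>D\<^esub> Ide D (fo f E)))"
    using \<alpha>_nat [of "Swap C A B" "Ide C E", symmetric] by simp
  also have "\<dots> = (fa f (Assoc C B A E) \<cdot>\<^bsub>D\<^esub> \<alpha> (B \<odot>\<^bsub>C\<^esub> A, E) \<cdot>\<^bsub>D\<^esub>
      (\<alpha> (B, A) \<star>\<^bsub>D\<^esub> Ide D (fo f E))) \<cdot>\<^bsub>D\<^esub> (Swap D (fo f A) (fo f B) \<star>\<^bsub>D\<^esub> Ide D (fo f E))"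
    by (simp add: \<alpha>_swap)
  also have "\<dots> = (\<alpha> (B, A \<odot>\<^bsub>C\<^esub> E) \<cdot>\<^bsub>D\<^esub> (Ide D (fo f B) \<star>\<^bsub>D\<^esub> \<alpha> (A, E)) \<cdot>\<^bsub>D\<^esub>
      D.left_swap (fo f A) (fo f B) (fo f E)) \<cdot>\<^bsub>D\<^esub> Assoc D (fo f A) (fo f B) (fo f E)"
    unfolding \<alpha>_assoc [OF assms(2,1,3)] by (simp add: D.left_swap_assoc)
  finally show "(fa f (C.left_swap A B E) \<cdot>\<^bsub>D\<^esub> \<alpha> (A, B \<odot>\<^bsub>C\<^esub> E) \<cdot>\<^bsub>D\<^esub>
      (Ide D (fo f A) \<star>\<^bsub>D\<^esub> \<alpha> (B, E))) \<cdot>\<^bsub>D\<^esub> Assoc D (fo f A) (fo f B) (fo f E) =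
    (\<alpha> (B, A \<odot>\<^bsub>C\<^esub> E) \<cdot>\<^bsub>D\<^esub> (Ide D (fo f B) \<star>\<^bsub>D\<^esub> \<alpha> (A, E)) \<cdot>\<^bsub>D\<^esub>
      D.left_swap (fo f A) (fo f B) (fo f E)) \<cdot>\<^bsub>D\<^esub> Assoc D (fo f A) (fo f B) (fo f E)" .
qed (use assms in simp_all)

text \<open>\<open>\<alpha>_assoc\<close> with a tensor product in the third variable, combined with
  naturality of the associator. Both associators of \<open>middle_swap\<close> are of this
  shape.\<close>

lemma \<alpha>_assoc4:
  assumes "A \<in> Ob C" "B \<in> Ob C" "E \<in> Ob C" "G \<in> Ob C"
  shows "fa f (Assoc C A B (E \<odot>\<^bsub>C\<^esub> G)) \<cdot>\<^bsub>D\<^esub> \<alpha> (A \<odot>\<^bsub>C\<^esub> B, E \<odot>\<^bsub>C\<^esub> G) \<cdot>\<^bsub>D\<^esub>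
      (\<alpha> (A, B) \<star>\<^bsub>D\<^esub> \<alpha> (E, G)) =
    \<alpha> (A, B \<odot>\<^bsub>C\<^esub> (E \<odot>\<^bsub>C\<^esub> G)) \<cdot>\<^bsub>D\<^esub>
      (Ide D (fo f A) \<star>\<^bsub>D\<^esub> (\<alpha> (B, E \<odot>\<^bsub>C\<^esub> G) \<cdot>\<^bsub>D\<^esub> (Ide D (fo f B) \<star>\<^bsub>D\<^esub> \<alpha> (E, G)))) \<cdot>\<^bsub>D\<^esub>
      Assoc D (fo f A) (fo f B) (fo f E \<odot>\<^bsub>D\<^esub> fo f G)"
proof -
  note [simp] = assms
  have "fa f (Assoc C A B (E \<odot>\<^bsub>C\<^esub> G)) \<cdot>\<^bsub>D\<^esub> \<alpha> (A \<odot>\<^bsub>C\<^esub> B, E \<odot>\<^bsub>C\<^esub> G) \<cdot>\<^bsub>D\<^esub>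
      (\<alpha> (A, B) \<star>\<^bsub>D\<^esub> \<alpha> (E, G)) =
    (fa f (Assoc C A B (E \<odot>\<^bsub>C\<^esub> G)) \<cdot>\<^bsub>D\<^esub> \<alpha> (A \<odot>\<^bsub>C\<^esub> B, E \<odot>\<^bsub>C\<^esub> G) \<cdot>\<^bsub>D\<^esub>
      (\<alpha> (A, B) \<star>\<^bsub>D\<^esub> Ide D (fo f (E \<odot>\<^bsub>C\<^esub> G)))) \<cdot>\<^bsub>D\<^esub>
      (Ide D (fo f A \<odot>\<^bsub>D\<^esub> fo f B) \<star>\<^bsub>D\<^esub> \<alpha> (E, G))"
    by simp
  also have "\<dots> = \<alpha> (A, B \<odot>\<^bsub>C\<^esub> (E \<odot>\<^bsub>C\<^esub> G)) \<cdot>\<^bsub>D\<^esub> (Ide D (fo f A) \<star>\<^bsub>D\<^esub> \<alpha> (B, E \<odot>\<^bsub>C\<^esub> G)) \<cdot>\<^bsub>D\<^esub>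
      (Assoc D (fo f A) (fo f B) (fo f (E \<odot>\<^bsub>C\<^esub> G)) \<cdot>\<^bsub>D\<^esub>
      (Ide D (fo f A \<odot>\<^bsub>D\<^esub> fo f B) \<star>\<^bsub>D\<^esub> \<alpha> (E, G)))"
    unfolding \<alpha>_assoc [OF assms(1,2) C.tensor_ob [OF assms(3,4)]] by simp
  also have "\<dots> = \<alpha> (A, B \<odot>\<^bsub>C\<^esub> (E \<odot>\<^bsub>C\<^esub> G)) \<cdot>\<^bsub>D\<^esub>
      (Ide D (fo f A) \<star>\<^bsub>D\<^esub> (\<alpha> (B, E \<odot>\<^bsub>C\<^esub> G) \<cdot>\<^bsub>D\<^esub> (Ide D (fo f B) \<star>\<^bsub>D\<^esub> \<alpha> (E, G)))) \<cdot>\<^bsub>D\<^esub>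
      Assoc D (fo f A) (fo f B) (fo f E \<odot>\<^bsub>D\<^esub> fo f G)"
    using D.assoc_nat [of "Ide D (fo f A)" "Ide D (fo f B)" "\<alpha> (E, G)"] by simp
  finally show ?thesis .
qed

text \<open>\<open>\<alpha>_assoc4\<close> handles the associators on both ends and
  \<open>\<alpha>_left_swap\<close> the arrow between them; the image of the last associator is
  cancelled on the left.\<close>

lemma \<alpha>_middle_swap:
  assumes "A \<in> Ob C" "B \<in> Ob C" "E \<in> Ob C" "G \<in> Ob C"
  shows "fa f (middle_swap C A B E G) \<cdot>\<^bsub>D\<^esub> \<alpha> (A \<odot>\<^bsub>C\<^esub> B, E \<odot>\<^bsub>C\<^esub> G) \<cdot>\<^bsub>D\<^esub>
      (\<alpha> (A, B) \<star>\<^bsub>D\<^esub> \<alpha> (E, G)) =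
    \<alpha> (A \<odot>\<^bsub>C\<^esub> E, B \<odot>\<^bsub>C\<^esub> G) \<cdot>\<^bsub>D\<^esub> (\<alpha> (A, E) \<star>\<^bsub>D\<^esub> \<alpha> (B, G)) \<cdot>\<^bsub>D\<^esub>
      middle_swap D (fo f A) (fo f B) (fo f E) (fo f G)"
proof (rule D.iso_cancel_left [of "fa f (Assoc C A E (B \<odot>\<^bsub>C\<^esub> G))"])
  note [simp] = assms
  have "fa f (Assoc C A E (B \<odot>\<^bsub>C\<^esub> G)) \<cdot>\<^bsub>D\<^esub> fa f (middle_swap C A B E G) \<cdot>\<^bsub>D\<^esub>
      \<alpha> (A \<odot>\<^bsub>C\<^esub> B, E \<odot>\<^bsub>C\<^esub> G) \<cdot>\<^bsub>D\<^esub> (\<alpha> (A, B) \<star>\<^bsub>D\<^esub> \<alpha> (E, G)) =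
    fa f (Assoc C A E (B \<odot>\<^bsub>C\<^esub> G) \<cdot>\<^bsub>C\<^esub> middle_swap C A B E G) \<cdot>\<^bsub>D\<^esub>
      \<alpha> (A \<odot>\<^bsub>C\<^esub> B, E \<odot>\<^bsub>C\<^esub> G) \<cdot>\<^bsub>D\<^esub> (\<alpha> (A, B) \<star>\<^bsub>D\<^esub> \<alpha> (E, G))"
    by simp
  also have "\<dots> = fa f (Ide C A \<star>\<^bsub>C\<^esub> C.left_swap B E G) \<cdot>\<^bsub>D\<^esub> (fa f (Assoc C A B (E \<odot>\<^bsub>C\<^esub> G)) \<cdot>\<^bsub>D\<^esub>
      \<alpha> (A \<odot>\<^bsub>C\<^esub> B, E \<odot>\<^bsub>C\<^esub> G) \<cdot>\<^bsub>D\<^esub> (\<alpha> (A, B) \<star>\<^bsub>D\<^esub> \<alpha> (E, G)))"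
    unfolding C.assoc_middle_swap [OF assms] by simp
  also have "\<dots> = (fa f (Ide C A \<star>\<^bsub>C\<^esub> C.left_swap B E G) \<cdot>\<^bsub>D\<^esub> \<alpha> (A, B \<odot>\<^bsub>C\<^esub> (E \<odot>\<^bsub>C\<^esub> G))) \<cdot>\<^bsub>D\<^esub>
      (Ide D (fo f A) \<star>\<^bsub>D\<^esub> (\<alpha> (B, E \<odot>\<^bsub>C\<^esub> G) \<cdot>\<^bsub>D\<^esub> (Ide D (fo f B) \<star>\<^bsub>D\<^esub> \<alpha> (E, G)))) \<cdot>\<^bsub>D\<^esub>
      Assoc D (fo f A) (fo f B) (fo f E \<odot>\<^bsub>D\<^esub> fo f G)"
    unfolding \<alpha>_assoc4 [OF assms] by simp
  also have "\<dots> = \<alpha> (A, E \<odot>\<^bsub>C\<^esub> (B \<odot>\<^bsub>C\<^esub> G)) \<cdot>\<^bsub>D\<^esub>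
      (Ide D (fo f A) \<star>\<^bsub>D\<^esub> (fa f (C.left_swap B E G) \<cdot>\<^bsub>D\<^esub> \<alpha> (B, E \<odot>\<^bsub>C\<^esub> G) \<cdot>\<^bsub>D\<^esub>
        (Ide D (fo f B) \<star>\<^bsub>D\<^esub> \<alpha> (E, G)))) \<cdot>\<^bsub>D\<^esub>
      Assoc D (fo f A) (fo f B) (fo f E \<odot>\<^bsub>D\<^esub> fo f G)"
    using \<alpha>_nat [of "Ide C A" "C.left_swap B E G", symmetric] by simp
  also have "\<dots> = \<alpha> (A, E \<odot>\<^bsub>C\<^esub> (B \<odot>\<^bsub>C\<^esub> G)) \<cdot>\<^bsub>D\<^esub>
      (Ide D (fo f A) \<star>\<^bsub>D\<^esub> (\<alpha> (E, B \<odot>\<^bsub>C\<^esub> G) \<cdot>\<^bsub>D\<^esub> (Ide D (fo f E) \<star>\<^bsub>D\<^esub> \<alpha> (B, G)))) \<cdot>\<^bsub>D\<^esub>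
      ((Ide D (fo f A) \<star>\<^bsub>D\<^esub> D.left_swap (fo f B) (fo f E) (fo f G)) \<cdot>\<^bsub>D\<^esub>
      Assoc D (fo f A) (fo f B) (fo f E \<odot>\<^bsub>D\<^esub> fo f G))"
    by (simp add: \<alpha>_left_swap)
  also have "\<dots> = (\<alpha> (A, E \<odot>\<^bsub>C\<^esub> (B \<odot>\<^bsub>C\<^esub> G)) \<cdot>\<^bsub>D\<^esub>
      (Ide D (fo f A) \<star>\<^bsub>D\<^esub> (\<alpha> (E, B \<odot>\<^bsub>C\<^esub> G) \<cdot>\<^bsub>D\<^esub> (Ide D (fo f E) \<star>\<^bsub>D\<^esub> \<alpha> (B, G)))) \<cdot>\<^bsub>D\<^esub>
      Assoc D (fo f A) (fo f E) (fo f B \<odot>\<^bsub>D\<^esub> fo f G)) \<cdot>\<^bsub>D\<^esub>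
      middle_swap D (fo f A) (fo f B) (fo f E) (fo f G)"
    by (simp add: D.assoc_middle_swap)
  also have "\<dots> = fa f (Assoc C A E (B \<odot>\<^bsub>C\<^esub> G)) \<cdot>\<^bsub>D\<^esub> \<alpha> (A \<odot>\<^bsub>C\<^esub> E, B \<odot>\<^bsub>C\<^esub> G) \<cdot>\<^bsub>D\<^esub>
      (\<alpha> (A, E) \<star>\<^bsub>D\<^esub> \<alpha> (B, G)) \<cdot>\<^bsub>D\<^esub> middle_swap D (fo f A) (fo f B) (fo f E) (fo f G)"
    unfolding \<alpha>_assoc4 [OF assms(1,3,2,4), symmetric] by simp
  finally show "fa f (Assoc C A E (B \<odot>\<^bsub>C\<^esub> G)) \<cdot>\<^bsub>D\<^esub> fa f (middle_swap C A B E G) \<cdot>\<^bsub>D\<^esub>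
      \<alpha> (A \<odot>\<^bsub>C\<^esub> B, E \<odot>\<^bsub>C\<^esub> G) \<cdot>\<^bsub>D\<^esub> (\<alpha> (A, B) \<star>\<^bsub>D\<^esub> \<alpha> (E, G)) =
    fa f (Assoc C A E (B \<odot>\<^bsub>C\<^esub> G)) \<cdot>\<^bsub>D\<^esub> \<alpha> (A \<odot>\<^bsub>C\<^esub> E, B \<odot>\<^bsub>C\<^esub> G) \<cdot>\<^bsub>D\<^esub>
      (\<alpha> (A, E) \<star>\<^bsub>D\<^esub> \<alpha> (B, G)) \<cdot>\<^bsub>D\<^esub> middle_swap D (fo f A) (fo f B) (fo f E) (fo f G)" .
qed (use assms in \<open>simp_all add: f_iso\<close>)

section \<open>Pull-back as a duality preserving functor, and its interaction with the tensor
  product\<close>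

lemma beta_curry:
  assumes "K \<in> Ob C" "A \<in> Ob C"
  shows "beta C D f \<alpha> K A = curry_arrow D (fo f (A \<rightarrowtail>\<^bsub>C\<^esub> K)) (fo f A)
    (fa f (Ev C A K) \<cdot>\<^bsub>D\<^esub> \<alpha> (A \<rightarrowtail>\<^bsub>C\<^esub> K, A))"
proof -
  note [simp] = assms
  have "Ide D (fo f A) \<Zinj>\<^bsub>D\<^esub> (fa f (Ev C A K) \<cdot>\<^bsub>D\<^esub> \<alpha> (A \<rightarrowtail>\<^bsub>C\<^esub> K, A)) =
    (Ide D (fo f A) \<Zinj>\<^bsub>D\<^esub> fa f (Ev C A K)) \<cdot>\<^bsub>D\<^esub> (Ide D (fo f A) \<Zinj>\<^bsub>D\<^esub> \<alpha> (A \<rightarrowtail>\<^bsub>C\<^esub> K, A))"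
    by (subst D.ihom_Comp) simp_all
  then show ?thesis
    by (simp add: beta_def curry_arrow_def)
qed

lemma beta_ar [simp]:
  assumes "K \<in> Ob C" "A \<in> Ob C"
  shows "beta C D f \<alpha> K A \<in> Ar D" "Dom D (beta C D f \<alpha> K A) = fo f (A \<rightarrowtail>\<^bsub>C\<^esub> K)"
    "Cod D (beta C D f \<alpha> K A) = fo f A \<rightarrowtail>\<^bsub>D\<^esub> fo f K"
  using assms by (simp_all add: beta_curry)

lemma uncurry_beta:
  assumes "K \<in> Ob C" "A \<in> Ob C"
  shows "D.uncurry_arrow (fo f A) (fo f K) (beta C D f \<alpha> K A) =
    fa f (Ev C A K) \<cdot>\<^bsub>D\<^esub> \<alpha> (A \<rightarrowtail>\<^bsub>C\<^esub> K, A)"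
  using assms by (simp add: beta_curry)

text \<open>The analogue of \<open>uncurry_tau_pre\<close>, with naturality of \<alpha> in the role
  of naturality of the interchange.\<close>

lemma uncurry_beta_pre:
  assumes "K \<in> Ob C" "A \<in> Ob C" "h \<in> Ar C" "Cod C h = A \<rightarrowtail>\<^bsub>C\<^esub> K"
  shows "D.uncurry_arrow (fo f A) (fo f K) (beta C D f \<alpha> K A \<cdot>\<^bsub>D\<^esub> fa f h) =
    fa f (C.uncurry_arrow A K h) \<cdot>\<^bsub>D\<^esub> \<alpha> (Dom C h, A)"
proof -
  note [simp] = assms
  have "D.uncurry_arrow (fo f A) (fo f K) (beta C D f \<alpha> K A \<cdot>\<^bsub>D\<^esub> fa f h) =
    fa f (Ev C A K) \<cdot>\<^bsub>D\<^esub> (\<alpha> (A \<rightarrowtail>\<^bsub>C\<^esub> K, A) \<cdot>\<^bsub>D\<^esub> (fa f h \<star>\<^bsub>D\<^esub> Ide D (fo f A)))"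
    by (simp add: D.uncurry_Comp uncurry_beta)
  also have "\<dots> = fa f (Ev C A K) \<cdot>\<^bsub>D\<^esub> (fa f (h \<star>\<^bsub>C\<^esub> Ide C A) \<cdot>\<^bsub>D\<^esub> \<alpha> (Dom C h, A))"
    using \<alpha>_nat [of h "Ide C A"] by simp
  finally show ?thesis
    by (simp add: C.uncurry_arrow_def)
qed

text \<open>After transposition, naturality of \<beta> is extranaturality of evaluation with
  \<open>\<alpha>_nat\<close>, and the duality square is \<open>\<alpha>_swap\<close>.\<close>

lemma pullback_duality_preserving:
  assumes [simp]: "K \<in> Ob C"
  shows "duality_preserving_functor (with_duality C K) (with_duality D (fo f K))
    (pullback_dp C D f \<alpha> K)"
  unfolding with_duality_def pullback_dp_def
proof (rule duality_preserving_functorI)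
  fix a assume [simp]: "a \<in> Ar C"
  have e: "C.uncurry_arrow (Dom C a) K (a \<Zinj>\<^bsub>C\<^esub> Ide C K) =
      Ev C (Cod C a) K \<cdot>\<^bsub>C\<^esub> (Ide C (Cod C a \<rightarrowtail>\<^bsub>C\<^esub> K) \<star>\<^bsub>C\<^esub> a)"
    using C.Ev_dinatural [of a K] by (simp add: C.uncurry_arrow_def)
  have "D.uncurry_arrow (fo f (Dom C a)) (fo f K)
      (beta C D f \<alpha> K (Dom C a) \<cdot>\<^bsub>D\<^esub> fa f (a \<Zinj>\<^bsub>C\<^esub> Ide C K)) =
    fa f (Ev C (Cod C a) K) \<cdot>\<^bsub>D\<^esub> (\<alpha> (Cod C a \<rightarrowtail>\<^bsub>C\<^esub> K, Cod C a) \<cdot>\<^bsub>D\<^esub>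
      (Ide D (fo f (Cod C a \<rightarrowtail>\<^bsub>C\<^esub> K)) \<star>\<^bsub>D\<^esub> fa f a))"
    using \<alpha>_nat [of "Ide C (Cod C a \<rightarrowtail>\<^bsub>C\<^esub> K)" a] by (simp add: uncurry_beta_pre e)
  also have "\<dots> = D.uncurry_arrow (fo f (Dom C a)) (fo f K)
      ((fa f a \<Zinj>\<^bsub>D\<^esub> Ide D (fo f K)) \<cdot>\<^bsub>D\<^esub> beta C D f \<alpha> K (Cod C a))"
    by (simp add: D.uncurry_pre uncurry_beta)
  finally have "beta C D f \<alpha> K (Dom C a) \<cdot>\<^bsub>D\<^esub> fa f (a \<Zinj>\<^bsub>C\<^esub> Ide C K) =
      (fa f a \<Zinj>\<^bsub>D\<^esub> Ide D (fo f K)) \<cdot>\<^bsub>D\<^esub> beta C D f \<alpha> K (Cod C a)"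
    by (rule D.uncurry_inject) simp_all
  then show "beta C D f \<alpha> K (Dom C a) \<cdot>\<^bsub>D\<^esub> fa f (fa (dual_functor C K) a) =
      fa (dual_functor D (fo f K)) (fa f a) \<cdot>\<^bsub>D\<^esub> beta C D f \<alpha> K (Cod C a)"
    by simp
next
  fix A assume [simp]: "A \<in> Ob C"
  have "D.uncurry_arrow (fo f (A \<rightarrowtail>\<^bsub>C\<^esub> K)) (fo f K)
      (beta C D f \<alpha> K (A \<rightarrowtail>\<^bsub>C\<^esub> K) \<cdot>\<^bsub>D\<^esub> fa f (bidual C K A)) =
    fa f (Ev C A K) \<cdot>\<^bsub>D\<^esub> (fa f (Swap C A (A \<rightarrowtail>\<^bsub>C\<^esub> K)) \<cdot>\<^bsub>D\<^esub> \<alpha> (A, A \<rightarrowtail>\<^bsub>C\<^esub> K))"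
    by (simp add: uncurry_beta_pre C.uncurry_bidual)
  also have "\<dots> = D.uncurry_arrow (fo f (A \<rightarrowtail>\<^bsub>C\<^esub> K)) (fo f K)
      ((beta C D f \<alpha> K A \<Zinj>\<^bsub>D\<^esub> Ide D (fo f K)) \<cdot>\<^bsub>D\<^esub> bidual D (fo f K) (fo f A))"
    by (simp add: \<alpha>_swap D.uncurry_bidual_pre uncurry_beta)
  finally have "beta C D f \<alpha> K (A \<rightarrowtail>\<^bsub>C\<^esub> K) \<cdot>\<^bsub>D\<^esub> fa f (bidual C K A) =
      (beta C D f \<alpha> K A \<Zinj>\<^bsub>D\<^esub> Ide D (fo f K)) \<cdot>\<^bsub>D\<^esub> bidual D (fo f K) (fo f A)"
    by (rule D.uncurry_inject) simp_all
  then show "beta C D f \<alpha> K (fo (dual_functor C K) A) \<cdot>\<^bsub>D\<^esub> fa f (bidual C K A) =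
      fa (dual_functor D (fo f K)) (beta C D f \<alpha> K A) \<cdot>\<^bsub>D\<^esub> bidual D (fo f K) (fo f A)"
    by simp
qed (simp_all add: f_functor C.is_functor_dual D.is_functor_dual)

text \<open>The defining equation of a morphism of duality preserving functors. Both sides transpose
  to \<open>f(ev \<otimes> ev) \<circ> f(\<varrho>) \<circ> \<alpha> \<circ> (\<alpha> \<otimes>
  \<alpha>)\<close>: on the left \<open>\<alpha> (K, M)\<close> first passes the evaluations by
  naturality, then the interchange by \<open>\<alpha>_middle_swap\<close>.\<close>

lemma \<alpha>_beta_tau:
  assumes "K \<in> Ob C" "M \<in> Ob C" "A \<in> Ob C" "B \<in> Ob C"
  shows "(Ide D (fo f A \<odot>\<^bsub>D\<^esub> fo f B) \<Zinj>\<^bsub>D\<^esub> \<alpha> (K, M)) \<cdot>\<^bsub>D\<^esub>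
      tau D (fo f K) (fo f M) (fo f A, fo f B) \<cdot>\<^bsub>D\<^esub>
      (beta C D f \<alpha> K A \<star>\<^bsub>D\<^esub> beta C D f \<alpha> M B) =
    (\<alpha> (A, B) \<Zinj>\<^bsub>D\<^esub> Ide D (fo f (K \<odot>\<^bsub>C\<^esub> M))) \<cdot>\<^bsub>D\<^esub>
      (beta C D f \<alpha> (K \<odot>\<^bsub>C\<^esub> M) (A \<odot>\<^bsub>C\<^esub> B) \<cdot>\<^bsub>D\<^esub> fa f (tau C K M (A, B))) \<cdot>\<^bsub>D\<^esub>
      \<alpha> (A \<rightarrowtail>\<^bsub>C\<^esub> K, B \<rightarrowtail>\<^bsub>C\<^esub> M)"
    (is "?l = ?r")
proof (rule D.uncurry_inject [of "fo f A \<odot>\<^bsub>D\<^esub> fo f B" "fo f (K \<odot>\<^bsub>C\<^esub> M)"])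
  note [simp] = assms
  let ?DA = "A \<rightarrowtail>\<^bsub>C\<^esub> K" and ?DB = "B \<rightarrowtail>\<^bsub>C\<^esub> M"
  let ?u = "D.uncurry_arrow (fo f A \<odot>\<^bsub>D\<^esub> fo f B) (fo f (K \<odot>\<^bsub>C\<^esub> M))"
  have "?u ?l = (\<alpha> (K, M) \<cdot>\<^bsub>D\<^esub> (fa f (Ev C A K) \<star>\<^bsub>D\<^esub> fa f (Ev C B M))) \<cdot>\<^bsub>D\<^esub>
      (\<alpha> (?DA, A) \<star>\<^bsub>D\<^esub> \<alpha> (?DB, B)) \<cdot>\<^bsub>D\<^esub> middle_swap D (fo f ?DA) (fo f ?DB) (fo f A) (fo f B)"
    by (simp add: D.uncurry_post D.uncurry_tau_pre uncurry_beta)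
  also have "\<dots> = fa f (Ev C A K \<star>\<^bsub>C\<^esub> Ev C B M) \<cdot>\<^bsub>D\<^esub> (\<alpha> (?DA \<odot>\<^bsub>C\<^esub> A, ?DB \<odot>\<^bsub>C\<^esub> B) \<cdot>\<^bsub>D\<^esub>
      (\<alpha> (?DA, A) \<star>\<^bsub>D\<^esub> \<alpha> (?DB, B)) \<cdot>\<^bsub>D\<^esub> middle_swap D (fo f ?DA) (fo f ?DB) (fo f A) (fo f B))"
    \<comment> \<open>Fusing tensor products would merge the evaluations with the \<alpha> next to
      them and hide the instance of naturality.\<close>
    using \<alpha>_nat [of "Ev C A K" "Ev C B M"] by (simp del: D.tensor_Comp D.tensor_Comp_extend)
  also have "\<dots> = fa f (Ev C A K \<star>\<^bsub>C\<^esub> Ev C B M) \<cdot>\<^bsub>D\<^esub> fa f (middle_swap C ?DA ?DB A B) \<cdot>\<^bsub>D\<^esub>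
      \<alpha> (?DA \<odot>\<^bsub>C\<^esub> ?DB, A \<odot>\<^bsub>C\<^esub> B) \<cdot>\<^bsub>D\<^esub> (\<alpha> (?DA, ?DB) \<star>\<^bsub>D\<^esub> \<alpha> (A, B))"
    by (subst \<alpha>_middle_swap) simp_all
  also have "\<dots> = (fa f (Ev C A K \<star>\<^bsub>C\<^esub> Ev C B M) \<cdot>\<^bsub>D\<^esub> fa f (middle_swap C ?DA ?DB A B) \<cdot>\<^bsub>D\<^esub>
      \<alpha> (?DA \<odot>\<^bsub>C\<^esub> ?DB, A \<odot>\<^bsub>C\<^esub> B)) \<cdot>\<^bsub>D\<^esub> (\<alpha> (?DA, ?DB) \<star>\<^bsub>D\<^esub> \<alpha> (A, B))"
    by simp
  also have "\<dots> = D.uncurry_arrow (fo f (A \<odot>\<^bsub>C\<^esub> B)) (fo f (K \<odot>\<^bsub>C\<^esub> M))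
      (beta C D f \<alpha> (K \<odot>\<^bsub>C\<^esub> M) (A \<odot>\<^bsub>C\<^esub> B) \<cdot>\<^bsub>D\<^esub> fa f (tau C K M (A, B))) \<cdot>\<^bsub>D\<^esub>
      (\<alpha> (?DA, ?DB) \<star>\<^bsub>D\<^esub> \<alpha> (A, B))"
    by (simp add: uncurry_beta_pre C.uncurry_tau)
  also have "\<dots> = ?u ?r"
    by (subst D.uncurry_pre) (simp_all add: D.uncurry_Comp)
  finally show "?u ?l = ?u ?r" .
qed (use assms in simp_all)

lemma \<alpha>_duality_preserving_iso:
  assumes K [simp]: "K \<in> Ob C" and M [simp]: "M \<in> Ob C"
  shows "duality_preserving_iso (prod_duality (with_duality C K) (with_duality C M))
    (with_duality D (fo f (K \<odot>\<^bsub>C\<^esub> M)))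
    (dp_comp D (change_dualizing D (\<alpha> (K, M)))
      (dp_comp D (product_dp D (fo f K) (fo f M))
        (dp_prod (pullback_dp C D f \<alpha> K) (pullback_dp C D f \<alpha> M))))
    (dp_comp D (pullback_dp C D f \<alpha> (K \<odot>\<^bsub>C\<^esub> M)) (product_dp C K M)) \<alpha>"
proof -
  note dual [simp] = C.is_duality_dual D.is_duality_dual
  have prod: "is_duality (prod_duality (with_duality C K) (with_duality C M))"
    "is_duality (prod_duality (with_duality D (fo f K)) (with_duality D (fo f M)))"
    by (simp_all add: is_duality_prod)
  have p: "duality_preserving_functor (prod_duality (with_duality C K) (with_duality C M))
      (prod_duality (with_duality D (fo f K)) (with_duality D (fo f M)))
      (dp_prod (pullback_dp C D f \<alpha> K) (pullback_dp C D f \<alpha> M))"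
    by (simp add: duality_preserving_functor_prod pullback_duality_preserving)
  have q: "duality_preserving_functor (prod_duality (with_duality C K) (with_duality C M))
      (with_duality D (fo f K \<odot>\<^bsub>D\<^esub> fo f M))
      (dp_comp D (product_dp D (fo f K) (fo f M))
        (dp_prod (pullback_dp C D f \<alpha> K) (pullback_dp C D f \<alpha> M)))"
    \<comment> \<open>The composition rule displays its final target as a triple, so exactly that
      one is unfolded.\<close>
    unfolding with_duality_def [of D "fo f K \<odot>\<^bsub>D\<^esub> fo f M"]
    by (rule duality_preserving_functor_comp [OF p _ prod])
      (simp_all add: D.product_duality_preserving flip: with_duality_def)
  have \<Phi>: "duality_preserving_functor (prod_duality (with_duality C K) (with_duality C M))
      (with_duality D (fo f (K \<odot>\<^bsub>C\<^esub> M)))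
      (dp_comp D (change_dualizing D (\<alpha> (K, M))) (dp_comp D (product_dp D (fo f K) (fo f M))
        (dp_prod (pullback_dp C D f \<alpha> K) (pullback_dp C D f \<alpha> M))))"
    unfolding with_duality_def [of D "fo f (K \<odot>\<^bsub>C\<^esub> M)"]
    using D.change_dualizing_duality_preserving [of "\<alpha> (K, M)"]
    by (intro duality_preserving_functor_comp [OF q _ prod(1)])
      (simp_all flip: with_duality_def)
  have \<Psi>: "duality_preserving_functor (prod_duality (with_duality C K) (with_duality C M))
      (with_duality D (fo f (K \<odot>\<^bsub>C\<^esub> M)))
      (dp_comp D (pullback_dp C D f \<alpha> (K \<odot>\<^bsub>C\<^esub> M)) (product_dp C K M))"
    unfolding with_duality_def [of D "fo f (K \<odot>\<^bsub>C\<^esub> M)"]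
    by (rule duality_preserving_functor_comp [OF C.product_duality_preserving [OF K M] _ prod(1)])
      (simp_all add: pullback_duality_preserving flip: with_duality_def)
  \<comment> \<open>The identity functor contributed by \<open>change_dualizing\<close> must
    disappear as an equality of functor data, so that the source of \<alpha> takes the form in
    \<open>\<alpha>_nat_iso\<close>.\<close>
  have e: "id_functor \<circ>\<^sub>F G = G" for G :: "('x, 'y, 'p, 'b) functor_data"
    by (simp add: id_functor_def comp_functor_def comp_def)
  show ?thesis
    using \<Phi> \<Psi> \<alpha>_nat_iso
    unfolding duality_preserving_iso_def
    by (auto simp: e dp_comp_def prod_duality_def with_duality_def change_dualizing_def
        product_dp_def pullback_dp_def dp_prod_def \<alpha>_beta_tau)
qed

end

section \<open>Suspended symmetric monoidal closed categories\<close>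

locale suspended_closed_category = symmetric_monoidal_closed_category C
  for C :: "('o, 'a, 'm) smcc_data_scheme" (structure) +
  fixes S :: "('o, 'a, 'k) tensor_suspension_data_scheme"
  assumes suspended: "suspended_smcc C S"
begin

abbreviation T\<^sub>o :: "'o \<Rightarrow> 'o" where "T\<^sub>o \<equiv> fo (Susp S)"
abbreviation T\<^sub>a :: "'a \<Rightarrow> 'a" where "T\<^sub>a \<equiv> fa (Susp S)"

section \<open>Moving the suspension through the middle four interchange\<close>

lemma susp_functor: "is_functor C C (Susp S)"
  using suspended by (simp add: suspended_smcc_def suspended_category_def additive_functor_def)

lemmas susp_simps [simp] = is_functorD [OF susp_functor]

lemmas susp_iso = functor_iso [OF category_axioms category_axioms susp_functor]

lemma tp1_ar [simp]:
  assumes "A \<in> Ob C" "B \<in> Ob C"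
  shows "tp1 S (A, B) \<in> Ar C" "Dom C (tp1 S (A, B)) = T\<^sub>o A \<odot> B" "Cod C (tp1 S (A, B)) = T\<^sub>o (A \<odot> B)"
    "is_isomorphism C (tp1 S (A, B))"
proof -
  have n: "nat_iso (prod_cat C C) C (Tensor C \<circ>\<^sub>F Susp S \<times>\<^sub>F id_functor) (Susp S \<circ>\<^sub>F Tensor C) (tp1 S)"
    using suspended by (simp add: suspended_smcc_def suspended_bifunctor_def)
  then have "nat_trans (prod_cat C C) C (Tensor C \<circ>\<^sub>F Susp S \<times>\<^sub>F id_functor) (Susp S \<circ>\<^sub>F Tensor C) (tp1 S)"
    by (simp add: nat_iso_def)
  from nat_transD(3-5) [OF this, of "(A, B)"] n
  show "tp1 S (A, B) \<in> Ar C" "Dom C (tp1 S (A, B)) = T\<^sub>o A \<odot> B"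
    "Cod C (tp1 S (A, B)) = T\<^sub>o (A \<odot> B)" "is_isomorphism C (tp1 S (A, B))"
    using assms by (simp_all add: nat_iso_def)
qed

lemma tp2_ar [simp]:
  assumes "A \<in> Ob C" "B \<in> Ob C"
  shows "tp2 S (A, B) \<in> Ar C" "Dom C (tp2 S (A, B)) = A \<odot> T\<^sub>o B" "Cod C (tp2 S (A, B)) = T\<^sub>o (A \<odot> B)"
    "is_isomorphism C (tp2 S (A, B))"
proof -
  have n: "nat_iso (prod_cat C C) C (Tensor C \<circ>\<^sub>F id_functor \<times>\<^sub>F Susp S) (Susp S \<circ>\<^sub>F Tensor C) (tp2 S)"
    using suspended by (simp add: suspended_smcc_def suspended_bifunctor_def)
  then have "nat_trans (prod_cat C C) C (Tensor C \<circ>\<^sub>F id_functor \<times>\<^sub>F Susp S) (Susp S \<circ>\<^sub>F Tensor C) (tp2 S)"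
    by (simp add: nat_iso_def)
  from nat_transD(3-5) [OF this, of "(A, B)"] n
  show "tp2 S (A, B) \<in> Ar C" "Dom C (tp2 S (A, B)) = A \<odot> T\<^sub>o B"
    "Cod C (tp2 S (A, B)) = T\<^sub>o (A \<odot> B)" "is_isomorphism C (tp2 S (A, B))"
    using assms by (simp_all add: nat_iso_def)
qed

lemma tp1_nat:
  assumes "a \<in> Ar C" "b \<in> Ar C"
  shows "T\<^sub>a (a \<star> b) \<cdot> tp1 S (Dom C a, Dom C b) = tp1 S (Cod C a, Cod C b) \<cdot> (T\<^sub>a a \<star> b)"
proof -
  have "nat_trans (prod_cat C C) C (Tensor C \<circ>\<^sub>F Susp S \<times>\<^sub>F id_functor) (Susp S \<circ>\<^sub>F Tensor C) (tp1 S)"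
    using suspended by (simp add: suspended_smcc_def suspended_bifunctor_def nat_iso_def)
  from nat_transD(6) [OF this, of "(a, b)"] show ?thesis
    using assms by simp
qed

lemma tp2_nat:
  assumes "a \<in> Ar C" "b \<in> Ar C"
  shows "T\<^sub>a (a \<star> b) \<cdot> tp2 S (Dom C a, Dom C b) = tp2 S (Cod C a, Cod C b) \<cdot> (a \<star> T\<^sub>a b)"
proof -
  have "nat_trans (prod_cat C C) C (Tensor C \<circ>\<^sub>F id_functor \<times>\<^sub>F Susp S) (Susp S \<circ>\<^sub>F Tensor C) (tp2 S)"
    using suspended by (simp add: suspended_smcc_def suspended_bifunctor_def nat_iso_def)
  from nat_transD(6) [OF this, of "(a, b)"] show ?thesis
    using assms by simp
qed

lemma assoc_tp:
  assumes "A \<in> Ob C" "B \<in> Ob C" "E \<in> Ob C"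
  shows "T\<^sub>a (Assoc C A B E) \<cdot> tp1 S (A \<odot> B, E) \<cdot> (tp1 S (A, B) \<star> Ide C E) =
      tp1 S (A, B \<odot> E) \<cdot> Assoc C (T\<^sub>o A) B E"
    and "T\<^sub>a (Assoc C A B E) \<cdot> tp1 S (A \<odot> B, E) \<cdot> (tp2 S (A, B) \<star> Ide C E) =
      tp2 S (A, B \<odot> E) \<cdot> (Ide C A \<star> tp1 S (B, E)) \<cdot> Assoc C A (T\<^sub>o B) E"
    and "T\<^sub>a (Assoc C A B E) \<cdot> tp2 S (A \<odot> B, E) =
      tp2 S (A, B \<odot> E) \<cdot> (Ide C A \<star> tp2 S (B, E)) \<cdot> Assoc C A B (T\<^sub>o E)"
  using suspended assms by (simp_all add: suspended_smcc_def)

lemma swap_tp1: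
  assumes "A \<in> Ob C" "B \<in> Ob C"
  shows "T\<^sub>a (Swap C A B) \<cdot> tp1 S (A, B) = tp2 S (B, A) \<cdot> Swap C (T\<^sub>o A) B"
  using suspended assms by (simp add: suspended_smcc_def)

text \<open>Obtained from \<open>swap_tp1\<close> by composing with the symmetry on both sides, the
  symmetry being an involution.\<close>

lemma swap_tp2:
  assumes "A \<in> Ob C" "B \<in> Ob C"
  shows "T\<^sub>a (Swap C A B) \<cdot> tp2 S (A, B) = tp1 S (B, A) \<cdot> Swap C A (T\<^sub>o B)"
proof -
  note [simp] = assms
  have "T\<^sub>a (Swap C A B) \<cdot> tp2 S (A, B) =
    T\<^sub>a (Swap C A B) \<cdot> (tp2 S (A, B) \<cdot> Swap C (T\<^sub>o B) A) \<cdot> Swap C A (T\<^sub>o B)"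
    by simp
  also have "\<dots> = T\<^sub>a (Swap C A B \<cdot> Swap C B A) \<cdot> tp1 S (B, A) \<cdot> Swap C A (T\<^sub>o B)"
    unfolding swap_tp1 [OF assms(2,1), symmetric] by (simp del: swap_swap)
  also have "\<dots> = tp1 S (B, A) \<cdot> Swap C A (T\<^sub>o B)"
    by (simp del: susp_simps(6))
  finally show ?thesis .
qed

text \<open>\<open>left_swap_assoc\<close> under the suspension and with a trailing arrow:
  simplification splits images of composites and nests to the right, so the plain equation no longer
  matches.\<close>

lemma susp_left_swap:
  assumes "A \<in> Ob C" "B \<in> Ob C" "E \<in> Ob C" "x \<in> Ar C" "Cod C x = T\<^sub>o ((A \<odot> B) \<odot> E)"
  shows "T\<^sub>a (left_swap A B E) \<cdot> T\<^sub>a (Assoc C A B E) \<cdot> x =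
    T\<^sub>a (Assoc C B A E) \<cdot> T\<^sub>a (Swap C A B \<star> Ide C E) \<cdot> x"
proof -
  have "T\<^sub>a (left_swap A B E \<cdot> Assoc C A B E) \<cdot> x =
    T\<^sub>a (Assoc C B A E \<cdot> (Swap C A B \<star> Ide C E)) \<cdot> x"
    using assms(1-3) by (simp only: left_swap_assoc)
  then show ?thesis
    using assms by simp
qed

text \<open>One equation per position of \<open>T\<close> among the three factors. Each is checked
  after an associator, where it splits into \<open>assoc_tp\<close> for the source, the matching
  rule for the symmetry, and \<open>assoc_tp\<close> for the target.\<close>

lemma left_swap_tp:
  assumes "A \<in> Ob C" "B \<in> Ob C" "E \<in> Ob C"
  shows "T\<^sub>a (left_swap A B E) \<cdot> tp1 S (A, B \<odot> E) =
      tp2 S (B, A \<odot> E) \<cdot> (Ide C B \<star> tp1 S (A, E)) \<cdot> left_swap (T\<^sub>o A) B E"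
    and "T\<^sub>a (left_swap A B E) \<cdot> tp2 S (A, B \<odot> E) \<cdot> (Ide C A \<star> tp1 S (B, E)) =
      tp1 S (B, A \<odot> E) \<cdot> left_swap A (T\<^sub>o B) E"
    and "T\<^sub>a (left_swap A B E) \<cdot> tp2 S (A, B \<odot> E) \<cdot> (Ide C A \<star> tp2 S (B, E)) =
      tp2 S (B, A \<odot> E) \<cdot> (Ide C B \<star> tp2 S (A, E)) \<cdot> left_swap A B (T\<^sub>o E)"
proof -
  note [simp] = assms
  have "(T\<^sub>a (left_swap A B E) \<cdot> tp1 S (A, B \<odot> E)) \<cdot> Assoc C (T\<^sub>o A) B E =
    T\<^sub>a (left_swap A B E) \<cdot> T\<^sub>a (Assoc C A B E) \<cdot> tp1 S (A \<odot> B, E) \<cdot> (tp1 S (A, B) \<star> Ide C E)"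
    unfolding assoc_tp(1) [OF assms] by simp
  also have "\<dots> = T\<^sub>a (Assoc C B A E) \<cdot> (T\<^sub>a (Swap C A B \<star> Ide C E) \<cdot> tp1 S (A \<odot> B, E)) \<cdot>
      (tp1 S (A, B) \<star> Ide C E)"
    by (simp add: susp_left_swap)
  also have "\<dots> = T\<^sub>a (Assoc C B A E) \<cdot> tp1 S (B \<odot> A, E) \<cdot>
      ((T\<^sub>a (Swap C A B) \<cdot> tp1 S (A, B)) \<star> Ide C E)"
    using tp1_nat [of "Swap C A B" "Ide C E"] by simp
  also have "\<dots> = (T\<^sub>a (Assoc C B A E) \<cdot> tp1 S (B \<odot> A, E) \<cdot> (tp2 S (B, A) \<star> Ide C E)) \<cdot>
      (Swap C (T\<^sub>o A) B \<star> Ide C E)"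
    by (simp add: swap_tp1)
  also have "\<dots> = (tp2 S (B, A \<odot> E) \<cdot> (Ide C B \<star> tp1 S (A, E)) \<cdot> left_swap (T\<^sub>o A) B E) \<cdot>
      Assoc C (T\<^sub>o A) B E"
    unfolding assoc_tp(2) [OF assms(2,1,3)] by (simp add: left_swap_assoc)
  finally show "T\<^sub>a (left_swap A B E) \<cdot> tp1 S (A, B \<odot> E) =
      tp2 S (B, A \<odot> E) \<cdot> (Ide C B \<star> tp1 S (A, E)) \<cdot> left_swap (T\<^sub>o A) B E"
    by (rule iso_cancel_right [rotated -1]) simp_all
  have "(T\<^sub>a (left_swap A B E) \<cdot> tp2 S (A, B \<odot> E) \<cdot> (Ide C A \<star> tp1 S (B, E))) \<cdot> Assoc C A (T\<^sub>o B) E =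
    T\<^sub>a (left_swap A B E) \<cdot> (tp2 S (A, B \<odot> E) \<cdot> (Ide C A \<star> tp1 S (B, E)) \<cdot> Assoc C A (T\<^sub>o B) E)"
    by simp
  also have "\<dots> =
    T\<^sub>a (left_swap A B E) \<cdot> T\<^sub>a (Assoc C A B E) \<cdot> tp1 S (A \<odot> B, E) \<cdot> (tp2 S (A, B) \<star> Ide C E)"
    unfolding assoc_tp(2) [OF assms] by simp
  also have "\<dots> = T\<^sub>a (Assoc C B A E) \<cdot> (T\<^sub>a (Swap C A B \<star> Ide C E) \<cdot> tp1 S (A \<odot> B, E)) \<cdot>
      (tp2 S (A, B) \<star> Ide C E)"
    by (simp add: susp_left_swap)
  also have "\<dots> = T\<^sub>a (Assoc C B A E) \<cdot> tp1 S (B \<odot> A, E) \<cdot>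
      ((T\<^sub>a (Swap C A B) \<cdot> tp2 S (A, B)) \<star> Ide C E)"
    using tp1_nat [of "Swap C A B" "Ide C E"] by simp
  also have "\<dots> = (T\<^sub>a (Assoc C B A E) \<cdot> tp1 S (B \<odot> A, E) \<cdot> (tp1 S (B, A) \<star> Ide C E)) \<cdot>
      (Swap C A (T\<^sub>o B) \<star> Ide C E)"
    by (simp add: swap_tp2)
  also have "\<dots> = (tp1 S (B, A \<odot> E) \<cdot> left_swap A (T\<^sub>o B) E) \<cdot> Assoc C A (T\<^sub>o B) E"
    unfolding assoc_tp(1) [OF assms(2,1,3)] by (simp add: left_swap_assoc)
  finally show "T\<^sub>a (left_swap A B E) \<cdot> tp2 S (A, B \<odot> E) \<cdot> (Ide C A \<star> tp1 S (B, E)) =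
      tp1 S (B, A \<odot> E) \<cdot> left_swap A (T\<^sub>o B) E"
    by (rule iso_cancel_right [rotated -1]) simp_all
  have "(T\<^sub>a (left_swap A B E) \<cdot> tp2 S (A, B \<odot> E) \<cdot> (Ide C A \<star> tp2 S (B, E))) \<cdot> Assoc C A B (T\<^sub>o E) =
    T\<^sub>a (left_swap A B E) \<cdot> (tp2 S (A, B \<odot> E) \<cdot> (Ide C A \<star> tp2 S (B, E)) \<cdot> Assoc C A B (T\<^sub>o E))"
    by simp
  also have "\<dots> =
    T\<^sub>a (left_swap A B E) \<cdot> T\<^sub>a (Assoc C A B E) \<cdot> tp2 S (A \<odot> B, E)"
    unfolding assoc_tp(3) [OF assms] by simp
  also have "\<dots> = T\<^sub>a (Assoc C B A E) \<cdot> (T\<^sub>a (Swap C A B \<star> Ide C E) \<cdot> tp2 S (A \<odot> B, E))"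
    by (simp add: susp_left_swap)
  also have "\<dots> = (T\<^sub>a (Assoc C B A E) \<cdot> tp2 S (B \<odot> A, E)) \<cdot> (Swap C A B \<star> Ide C (T\<^sub>o E))"
    using tp2_nat [of "Swap C A B" "Ide C E"] by simp
  also have "\<dots> = (tp2 S (B, A \<odot> E) \<cdot> (Ide C B \<star> tp2 S (A, E)) \<cdot> left_swap A B (T\<^sub>o E)) \<cdot>
      Assoc C A B (T\<^sub>o E)"
    unfolding assoc_tp(3) [OF assms(2,1,3)] by (simp add: left_swap_assoc)
  finally show "T\<^sub>a (left_swap A B E) \<cdot> tp2 S (A, B \<odot> E) \<cdot> (Ide C A \<star> tp2 S (B, E)) =
      tp2 S (B, A \<odot> E) \<cdot> (Ide C B \<star> tp2 S (A, E)) \<cdot> left_swap A B (T\<^sub>o E)"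
    by (rule iso_cancel_right [rotated -1]) simp_all
qed

lemma susp_assoc_middle_swap:
  assumes "A \<in> Ob C" "B \<in> Ob C" "E \<in> Ob C" "G \<in> Ob C" "x \<in> Ar C" "Cod C x = T\<^sub>o ((A \<odot> B) \<odot> (E \<odot> G))"
  shows "T\<^sub>a (Assoc C A E (B \<odot> G)) \<cdot> T\<^sub>a (middle_swap C A B E G) \<cdot> x =
    T\<^sub>a (Ide C A \<star> left_swap B E G) \<cdot> T\<^sub>a (Assoc C A B (E \<odot> G)) \<cdot> x"
proof -
  have "T\<^sub>a (Assoc C A E (B \<odot> G) \<cdot> middle_swap C A B E G) \<cdot> x =
    T\<^sub>a ((Ide C A \<star> left_swap B E G) \<cdot> Assoc C A B (E \<odot> G)) \<cdot> x"
    using assms(1-4) by (simp only: assoc_middle_swap)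
  then show ?thesis
    using assms by simp
qed

text \<open>One equation per position of \<open>T\<close> among the four factors. After an image of
  an associator, the fixed factor \<open>A\<close> contributes only \<open>assoc_tp\<close> and
  naturality of the suspension maps; for the other three positions \<open>left_swap_tp\<close> does
  the work inside the second factor.\<close>

lemma middle_swap_tp:
  assumes "A \<in> Ob C" "B \<in> Ob C" "E \<in> Ob C" "G \<in> Ob C"
  shows "T\<^sub>a (middle_swap C A B E G) \<cdot> tp1 S (A \<odot> B, E \<odot> G) \<cdot> (tp1 S (A, B) \<star> Ide C (E \<odot> G)) =
      tp1 S (A \<odot> E, B \<odot> G) \<cdot> (tp1 S (A, E) \<star> Ide C (B \<odot> G)) \<cdot> middle_swap C (T\<^sub>o A) B E G" (is ?P1)
    and "T\<^sub>a (middle_swap C A B E G) \<cdot> tp1 S (A \<odot> B, E \<odot> G) \<cdot> (tp2 S (A, B) \<star> Ide C (E \<odot> G)) =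
      tp2 S (A \<odot> E, B \<odot> G) \<cdot> (Ide C (A \<odot> E) \<star> tp1 S (B, G)) \<cdot> middle_swap C A (T\<^sub>o B) E G" (is ?P2)
    and "T\<^sub>a (middle_swap C A B E G) \<cdot> tp2 S (A \<odot> B, E \<odot> G) \<cdot> (Ide C (A \<odot> B) \<star> tp1 S (E, G)) =
      tp1 S (A \<odot> E, B \<odot> G) \<cdot> (tp2 S (A, E) \<star> Ide C (B \<odot> G)) \<cdot> middle_swap C A B (T\<^sub>o E) G" (is ?P3)
    and "T\<^sub>a (middle_swap C A B E G) \<cdot> tp2 S (A \<odot> B, E \<odot> G) \<cdot> (Ide C (A \<odot> B) \<star> tp2 S (E, G)) =
      tp2 S (A \<odot> E, B \<odot> G) \<cdot> (Ide C (A \<odot> E) \<star> tp2 S (B, G)) \<cdot> middle_swap C A B E (T\<^sub>o G)" (is ?P4)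
proof -
  note [simp] = assms
  let ?a = "T\<^sub>a (Assoc C A E (B \<odot> G))"
  have cancel: "x = y" if "?a \<cdot> x = ?a \<cdot> y" "x \<in> Ar C" "y \<in> Ar C"
      "Cod C x = T\<^sub>o ((A \<odot> E) \<odot> (B \<odot> G))" "Cod C y = T\<^sub>o ((A \<odot> E) \<odot> (B \<odot> G))" for x y
    using iso_cancel_left [of ?a x y] that by (simp add: susp_iso)
  have "?a \<cdot> T\<^sub>a (middle_swap C A B E G) \<cdot> tp1 S (A \<odot> B, E \<odot> G) \<cdot> (tp1 S (A, B) \<star> Ide C (E \<odot> G)) =
    T\<^sub>a (Ide C A \<star> left_swap B E G) \<cdot> (T\<^sub>a (Assoc C A B (E \<odot> G)) \<cdot> tp1 S (A \<odot> B, E \<odot> G) \<cdot>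
      (tp1 S (A, B) \<star> Ide C (E \<odot> G)))"
    by (simp add: susp_assoc_middle_swap)
  also have "\<dots> = (T\<^sub>a (Ide C A \<star> left_swap B E G) \<cdot> tp1 S (A, B \<odot> (E \<odot> G))) \<cdot>
      Assoc C (T\<^sub>o A) B (E \<odot> G)"
    by (subst assoc_tp) simp_all
  also have "\<dots> = tp1 S (A, E \<odot> (B \<odot> G)) \<cdot>
      (Ide C (T\<^sub>o A) \<star> left_swap B E G) \<cdot> Assoc C (T\<^sub>o A) B (E \<odot> G)"
    using tp1_nat [of "Ide C A" "left_swap B E G"] by simp
  also have "\<dots> = (tp1 S (A, E \<odot> (B \<odot> G)) \<cdot> Assoc C (T\<^sub>o A) E (B \<odot> G)) \<cdot>
      middle_swap C (T\<^sub>o A) B E G"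
    by (simp add: assoc_middle_swap)
  also have "\<dots> = ?a \<cdot> tp1 S (A \<odot> E, B \<odot> G) \<cdot> (tp1 S (A, E) \<star> Ide C (B \<odot> G)) \<cdot>
      middle_swap C (T\<^sub>o A) B E G"
    by (subst assoc_tp(1) [symmetric]) simp_all
  finally show ?P1
    by (rule cancel) simp_all
  have "?a \<cdot> T\<^sub>a (middle_swap C A B E G) \<cdot> tp1 S (A \<odot> B, E \<odot> G) \<cdot> (tp2 S (A, B) \<star> Ide C (E \<odot> G)) =
    T\<^sub>a (Ide C A \<star> left_swap B E G) \<cdot> (T\<^sub>a (Assoc C A B (E \<odot> G)) \<cdot> tp1 S (A \<odot> B, E \<odot> G) \<cdot>
      (tp2 S (A, B) \<star> Ide C (E \<odot> G)))"
    by (simp add: susp_assoc_middle_swap)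
  also have "\<dots> = (T\<^sub>a (Ide C A \<star> left_swap B E G) \<cdot> tp2 S (A, B \<odot> (E \<odot> G))) \<cdot>
      (Ide C A \<star> tp1 S (B, E \<odot> G)) \<cdot> Assoc C A (T\<^sub>o B) (E \<odot> G)"
    by (subst assoc_tp) simp_all
  also have "\<dots> = tp2 S (A, E \<odot> (B \<odot> G)) \<cdot>
      (Ide C A \<star> (T\<^sub>a (left_swap B E G) \<cdot> tp1 S (B, E \<odot> G))) \<cdot> Assoc C A (T\<^sub>o B) (E \<odot> G)"
    using tp2_nat [of "Ide C A" "left_swap B E G"] by simp
  also have "\<dots> = tp2 S (A, E \<odot> (B \<odot> G)) \<cdot> (Ide C A \<star> tp2 S (E, B \<odot> G)) \<cdot>
      (Ide C A \<star> (Ide C E \<star> tp1 S (B, G))) \<cdot>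
      ((Ide C A \<star> left_swap (T\<^sub>o B) E G) \<cdot> Assoc C A (T\<^sub>o B) (E \<odot> G))"
    by (simp add: left_swap_tp)
  also have "\<dots> = tp2 S (A, E \<odot> (B \<odot> G)) \<cdot> (Ide C A \<star> tp2 S (E, B \<odot> G)) \<cdot>
      ((Ide C A \<star> (Ide C E \<star> tp1 S (B, G))) \<cdot> Assoc C A E (T\<^sub>o B \<odot> G)) \<cdot>
      middle_swap C A (T\<^sub>o B) E G"
    \<comment> \<open>The factor containing \<open>left_swap\<close> must stay unfused, or it would
      no longer match \<open>assoc_middle_swap\<close>.\<close>
    by (simp add: assoc_middle_swap [symmetric] del: tensor_Comp tensor_Comp_extend)
  also have "\<dots> = (tp2 S (A, E \<odot> (B \<odot> G)) \<cdot> (Ide C A \<star> tp2 S (E, B \<odot> G)) \<cdot>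
      Assoc C A E (T\<^sub>o (B \<odot> G))) \<cdot> (Ide C (A \<odot> E) \<star> tp1 S (B, G)) \<cdot> middle_swap C A (T\<^sub>o B) E G"
    using assoc_nat [of "Ide C A" "Ide C E" "tp1 S (B, G)", symmetric]
    by (simp del: tensor_Comp tensor_Comp_extend)
  also have "\<dots> = ?a \<cdot> tp2 S (A \<odot> E, B \<odot> G) \<cdot> (Ide C (A \<odot> E) \<star> tp1 S (B, G)) \<cdot>
      middle_swap C A (T\<^sub>o B) E G"
    by (subst assoc_tp(3) [symmetric]) simp_all
  finally show ?P2
    by (rule cancel) simp_all
  have "?a \<cdot> T\<^sub>a (middle_swap C A B E G) \<cdot> tp2 S (A \<odot> B, E \<odot> G) \<cdot> (Ide C (A \<odot> B) \<star> tp1 S (E, G)) =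
    T\<^sub>a (Ide C A \<star> left_swap B E G) \<cdot> (T\<^sub>a (Assoc C A B (E \<odot> G)) \<cdot> tp2 S (A \<odot> B, E \<odot> G)) \<cdot>
      (Ide C (A \<odot> B) \<star> tp1 S (E, G))"
    by (simp add: susp_assoc_middle_swap)
  also have "\<dots> = (T\<^sub>a (Ide C A \<star> left_swap B E G) \<cdot> tp2 S (A, B \<odot> (E \<odot> G))) \<cdot>
      (Ide C A \<star> tp2 S (B, E \<odot> G)) \<cdot>
      (Assoc C A B (T\<^sub>o (E \<odot> G)) \<cdot> (Ide C (A \<odot> B) \<star> tp1 S (E, G)))"
    by (subst assoc_tp) simp_all
  also have "\<dots> = tp2 S (A, E \<odot> (B \<odot> G)) \<cdot>
      (Ide C A \<star> (T\<^sub>a (left_swap B E G) \<cdot> tp2 S (B, E \<odot> G) \<cdot> (Ide C B \<star> tp1 S (E, G)))) \<cdot>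
      Assoc C A B (T\<^sub>o E \<odot> G)"
    using tp2_nat [of "Ide C A" "left_swap B E G"] assoc_nat [of "Ide C A" "Ide C B" "tp1 S (E, G)"]
    by simp
  also have "\<dots> = tp2 S (A, E \<odot> (B \<odot> G)) \<cdot> (Ide C A \<star> tp1 S (E, B \<odot> G)) \<cdot>
      ((Ide C A \<star> left_swap B (T\<^sub>o E) G) \<cdot> Assoc C A B (T\<^sub>o E \<odot> G))"
    by (simp add: left_swap_tp)
  also have "\<dots> = (tp2 S (A, E \<odot> (B \<odot> G)) \<cdot> (Ide C A \<star> tp1 S (E, B \<odot> G)) \<cdot>
      Assoc C A (T\<^sub>o E) (B \<odot> G)) \<cdot> middle_swap C A B (T\<^sub>o E) G"
    by (simp add: assoc_middle_swap [symmetric] del: tensor_Comp tensor_Comp_extend)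
  also have "\<dots> = ?a \<cdot> tp1 S (A \<odot> E, B \<odot> G) \<cdot> (tp2 S (A, E) \<star> Ide C (B \<odot> G)) \<cdot>
      middle_swap C A B (T\<^sub>o E) G"
    by (subst assoc_tp(2) [symmetric]) simp_all
  finally show ?P3
    by (rule cancel) simp_all
  have "?a \<cdot> T\<^sub>a (middle_swap C A B E G) \<cdot> tp2 S (A \<odot> B, E \<odot> G) \<cdot> (Ide C (A \<odot> B) \<star> tp2 S (E, G)) =
    T\<^sub>a (Ide C A \<star> left_swap B E G) \<cdot> (T\<^sub>a (Assoc C A B (E \<odot> G)) \<cdot> tp2 S (A \<odot> B, E \<odot> G)) \<cdot>
      (Ide C (A \<odot> B) \<star> tp2 S (E, G))"
    by (simp add: susp_assoc_middle_swap)
  also have "\<dots> = (T\<^sub>a (Ide C A \<star> left_swap B E G) \<cdot> tp2 S (A, B \<odot> (E \<odot> G))) \<cdot>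
      (Ide C A \<star> tp2 S (B, E \<odot> G)) \<cdot>
      (Assoc C A B (T\<^sub>o (E \<odot> G)) \<cdot> (Ide C (A \<odot> B) \<star> tp2 S (E, G)))"
    by (subst assoc_tp) simp_all
  also have "\<dots> = tp2 S (A, E \<odot> (B \<odot> G)) \<cdot>
      (Ide C A \<star> (T\<^sub>a (left_swap B E G) \<cdot> tp2 S (B, E \<odot> G) \<cdot> (Ide C B \<star> tp2 S (E, G)))) \<cdot>
      Assoc C A B (E \<odot> T\<^sub>o G)"
    using tp2_nat [of "Ide C A" "left_swap B E G"] assoc_nat [of "Ide C A" "Ide C B" "tp2 S (E, G)"]
    by simp
  also have "\<dots> = tp2 S (A, E \<odot> (B \<odot> G)) \<cdot> (Ide C A \<star> tp2 S (E, B \<odot> G)) \<cdot>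
      (Ide C A \<star> (Ide C E \<star> tp2 S (B, G))) \<cdot>
      ((Ide C A \<star> left_swap B E (T\<^sub>o G)) \<cdot> Assoc C A B (E \<odot> T\<^sub>o G))"
    by (simp add: left_swap_tp)
  also have "\<dots> = tp2 S (A, E \<odot> (B \<odot> G)) \<cdot> (Ide C A \<star> tp2 S (E, B \<odot> G)) \<cdot>
      ((Ide C A \<star> (Ide C E \<star> tp2 S (B, G))) \<cdot> Assoc C A E (B \<odot> T\<^sub>o G)) \<cdot>
      middle_swap C A B E (T\<^sub>o G)"
    by (simp add: assoc_middle_swap [symmetric] del: tensor_Comp tensor_Comp_extend)
  also have "\<dots> = (tp2 S (A, E \<odot> (B \<odot> G)) \<cdot> (Ide C A \<star> tp2 S (E, B \<odot> G)) \<cdot>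
      Assoc C A E (T\<^sub>o (B \<odot> G))) \<cdot> (Ide C (A \<odot> E) \<star> tp2 S (B, G)) \<cdot> middle_swap C A B E (T\<^sub>o G)"
    using assoc_nat [of "Ide C A" "Ide C E" "tp2 S (B, G)", symmetric]
    by (simp del: tensor_Comp tensor_Comp_extend)
  also have "\<dots> = ?a \<cdot> tp2 S (A \<odot> E, B \<odot> G) \<cdot> (Ide C (A \<odot> E) \<star> tp2 S (B, G)) \<cdot>
      middle_swap C A B E (T\<^sub>o G)"
    by (subst assoc_tp(3) [symmetric]) simp_all
  finally show ?P4
    by (rule cancel) simp_all
qed

subsection \<open>The suspension of a duality\<close>

lemma dual_suspension_ar [simp]:
  assumes "K \<in> Ob C" "A \<in> Ob C"
  shows "dual_suspension C S K A \<in> Ar C" "Dom C (dual_suspension C S K A) = T\<^sub>o (T\<^sub>o A \<rightarrowtail> K)"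
    "Cod C (dual_suspension C S K A) = A \<rightarrowtail> K"
  using assms by (simp_all add: dual_suspension_def Let_def)

lemma uncurry_dual_suspension:
  assumes "K \<in> Ob C" "A \<in> Ob C"
  shows "uncurry_arrow A K (dual_suspension C S K A) = Ev C (T\<^sub>o A) K \<cdot>
    inverse_arrow C (tp2 S (T\<^sub>o A \<rightarrowtail> K, A)) \<cdot> tp1 S (T\<^sub>o A \<rightarrowtail> K, A)"
  using assms by (simp add: dual_suspension_def Let_def)

lemma tp2_inverse_nat:
  assumes "a \<in> Ar C" "b \<in> Ar C"
  shows "inverse_arrow C (tp2 S (Cod C a, Cod C b)) \<cdot> T\<^sub>a (a \<star> b) =
    (a \<star> T\<^sub>a b) \<cdot> inverse_arrow C (tp2 S (Dom C a, Dom C b))"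
  using assms tp2_nat [OF assms] by (intro inverse_square) simp_all

text \<open>Naturality of the carrying map
  \<open>T A \<otimes> B \<rightarrow> A \<otimes> T B\<close>, through which
  \<open>dual_suspension\<close> is defined.\<close>

lemma tp12_nat:
  assumes "a \<in> Ar C" "b \<in> Ar C"
  shows "inverse_arrow C (tp2 S (Cod C a, Cod C b)) \<cdot> tp1 S (Cod C a, Cod C b) \<cdot> (T\<^sub>a a \<star> b) =
    (a \<star> T\<^sub>a b) \<cdot> inverse_arrow C (tp2 S (Dom C a, Dom C b)) \<cdot> tp1 S (Dom C a, Dom C b)"
proof -
  have "inverse_arrow C (tp2 S (Cod C a, Cod C b)) \<cdot> tp1 S (Cod C a, Cod C b) \<cdot> (T\<^sub>a a \<star> b) =
    (inverse_arrow C (tp2 S (Cod C a, Cod C b)) \<cdot> T\<^sub>a (a \<star> b)) \<cdot> tp1 S (Dom C a, Dom C b)"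
    using assms by (simp add: tp1_nat)
  also have "\<dots> = (a \<star> T\<^sub>a b) \<cdot> inverse_arrow C (tp2 S (Dom C a, Dom C b)) \<cdot> tp1 S (Dom C a, Dom C b)"
    using assms by (simp add: tp2_inverse_nat)
  finally show ?thesis .
qed

text \<open>\<open>h\<close> slides through the carrying map by its naturality in the first factor
  and meets the evaluation at \<open>T A\<close>. The suspension rules for \<tau> and \<beta> begin
  with this.\<close>

lemma uncurry_dual_suspension_pre:
  assumes "K \<in> Ob C" "A \<in> Ob C" "h \<in> Ar C" "Cod C h = T\<^sub>o A \<rightarrowtail> K" "Dom C h = W"
  shows "uncurry_arrow A K (dual_suspension C S K A \<cdot> T\<^sub>a h) =
    uncurry_arrow (T\<^sub>o A) K h \<cdot> inverse_arrow C (tp2 S (W, A)) \<cdot> tp1 S (W, A)"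
proof -
  note [simp] = assms(1-4) assms(5) [symmetric]
  have "uncurry_arrow A K (dual_suspension C S K A \<cdot> T\<^sub>a h) =
    Ev C (T\<^sub>o A) K \<cdot> (inverse_arrow C (tp2 S (T\<^sub>o A \<rightarrowtail> K, A)) \<cdot> tp1 S (T\<^sub>o A \<rightarrowtail> K, A) \<cdot>
      (T\<^sub>a h \<star> Ide C A))"
    by (simp add: uncurry_Comp uncurry_dual_suspension)
  also have "\<dots> = Ev C (T\<^sub>o A) K \<cdot> ((h \<star> Ide C (T\<^sub>o A)) \<cdot>
      inverse_arrow C (tp2 S (W, A)) \<cdot> tp1 S (W, A))"
    using tp12_nat [of h "Ide C A"] by simp
  finally show ?thesis
    by (simp add: uncurry_arrow_def)
qed

text \<open>Naturality of \<open>T D T \<rightarrow> D\<close>, by \<open>tp12_nat\<close> in the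
  second factor and extranaturality of evaluation. It is what allows compatibility to be transported
  along \<alpha>.\<close>

lemma dual_suspension_nat:
  assumes "L \<in> Ob C" "a \<in> Ar C"
  shows "(a \<Zinj> Ide C L) \<cdot> dual_suspension C S L (Cod C a) =
    dual_suspension C S L (Dom C a) \<cdot> T\<^sub>a (T\<^sub>a a \<Zinj> Ide C L)"
proof (rule uncurry_inject [of "Dom C a" L])
  note [simp] = assms
  let ?W = "T\<^sub>o (Cod C a) \<rightarrowtail> L"
  have "uncurry_arrow (Dom C a) L ((a \<Zinj> Ide C L) \<cdot> dual_suspension C S L (Cod C a)) =
    Ev C (T\<^sub>o (Cod C a)) L \<cdot> (inverse_arrow C (tp2 S (?W, Cod C a)) \<cdot> tp1 S (?W, Cod C a) \<cdot>
      (Ide C (T\<^sub>o ?W) \<star> a))"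
    by (simp add: uncurry_pre uncurry_dual_suspension)
  also have "\<dots> = (Ev C (T\<^sub>o (Cod C a)) L \<cdot> (Ide C ?W \<star> T\<^sub>a a)) \<cdot>
      inverse_arrow C (tp2 S (?W, Dom C a)) \<cdot> tp1 S (?W, Dom C a)"
    using tp12_nat [of "Ide C ?W" a] by simp
  also have "\<dots> = uncurry_arrow (Dom C a) L
      (dual_suspension C S L (Dom C a) \<cdot> T\<^sub>a (T\<^sub>a a \<Zinj> Ide C L))"
    using Ev_dinatural [of "T\<^sub>a a" L]
    by (simp add: uncurry_dual_suspension_pre uncurry_arrow_def [of "T\<^sub>o (Dom C a)"])
  finally show "uncurry_arrow (Dom C a) L ((a \<Zinj> Ide C L) \<cdot> dual_suspension C S L (Cod C a)) =
    uncurry_arrow (Dom C a) L (dual_suspension C S L (Dom C a) \<cdot> T\<^sub>a (T\<^sub>a a \<Zinj> Ide C L))" .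
qed (use assms in simp_all)

text \<open>Carrying \<open>T\<close> from the pair \<open>H\<close>, \<open>N\<close> to the pair
  \<open>A\<close>, \<open>B\<close> becomes, after the interchange, carrying it from
  \<open>H\<close> to \<open>A\<close> or from \<open>N\<close> to \<open>B\<close>. Each case
  pastes one square of \<open>middle_swap_tp\<close>, moving \<open>T\<close> out, to the inverse of
  another, moving it back in.\<close>

lemma middle_swap_tp12:
  assumes "H \<in> Ob C" "N \<in> Ob C" "A \<in> Ob C" "B \<in> Ob C"
  shows "middle_swap C H N (T\<^sub>o A) B \<cdot> (Ide C (H \<odot> N) \<star> inverse_arrow C (tp1 S (A, B))) \<cdot>
      inverse_arrow C (tp2 S (H \<odot> N, A \<odot> B)) \<cdot> tp1 S (H \<odot> N, A \<odot> B) \<cdot>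
      (tp1 S (H, N) \<star> Ide C (A \<odot> B)) =
    ((inverse_arrow C (tp2 S (H, A)) \<cdot> tp1 S (H, A)) \<star> Ide C (N \<odot> B)) \<cdot> middle_swap C (T\<^sub>o H) N A B"
    and "middle_swap C H N A (T\<^sub>o B) \<cdot> (Ide C (H \<odot> N) \<star> inverse_arrow C (tp2 S (A, B))) \<cdot>
      inverse_arrow C (tp2 S (H \<odot> N, A \<odot> B)) \<cdot> tp1 S (H \<odot> N, A \<odot> B) \<cdot>
      (tp2 S (H, N) \<star> Ide C (A \<odot> B)) =
    (Ide C (H \<odot> A) \<star> (inverse_arrow C (tp2 S (N, B)) \<cdot> tp1 S (N, B))) \<cdot> middle_swap C H (T\<^sub>o N) A B"
proof -
  note [simp] = assms tensor_iso
  let ?T = "T\<^sub>a (middle_swap C H N A B)"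
  let ?x = "tp2 S (H \<odot> N, A \<odot> B) \<cdot> (Ide C (H \<odot> N) \<star> tp1 S (A, B))"
  let ?y = "tp1 S (H \<odot> A, N \<odot> B) \<cdot> (tp2 S (H, A) \<star> Ide C (N \<odot> B))"
  \<comment> \<open>The square for \<open>T\<close> in the third factor, with both composite
    suspension maps inverted.\<close>
  have sq: "inverse_arrow C ?y \<cdot> ?T = middle_swap C H N (T\<^sub>o A) B \<cdot> inverse_arrow C ?x"
    using middle_swap_tp(3) [OF assms] by (intro inverse_square) simp_all
  have "(middle_swap C H N (T\<^sub>o A) B \<cdot> inverse_arrow C ?x) \<cdot> tp1 S (H \<odot> N, A \<odot> B) \<cdot>
      (tp1 S (H, N) \<star> Ide C (A \<odot> B)) =
    inverse_arrow C ?y \<cdot> (?T \<cdot> tp1 S (H \<odot> N, A \<odot> B) \<cdot> (tp1 S (H, N) \<star> Ide C (A \<odot> B)))"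
    unfolding sq [symmetric] by simp
  also have "\<dots> = inverse_arrow C ?y \<cdot>
      tp1 S (H \<odot> A, N \<odot> B) \<cdot> (tp1 S (H, A) \<star> Ide C (N \<odot> B)) \<cdot> middle_swap C (T\<^sub>o H) N A B"
    unfolding middle_swap_tp(1) [OF assms] by simp
  finally show "middle_swap C H N (T\<^sub>o A) B \<cdot> (Ide C (H \<odot> N) \<star> inverse_arrow C (tp1 S (A, B))) \<cdot>
      inverse_arrow C (tp2 S (H \<odot> N, A \<odot> B)) \<cdot> tp1 S (H \<odot> N, A \<odot> B) \<cdot>
      (tp1 S (H, N) \<star> Ide C (A \<odot> B)) =
    ((inverse_arrow C (tp2 S (H, A)) \<cdot> tp1 S (H, A)) \<star> Ide C (N \<odot> B)) \<cdot> middle_swap C (T\<^sub>o H) N A B"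
    by (simp add: inverse_Comp)
  let ?x = "tp2 S (H \<odot> N, A \<odot> B) \<cdot> (Ide C (H \<odot> N) \<star> tp2 S (A, B))"
  let ?y = "tp2 S (H \<odot> A, N \<odot> B) \<cdot> (Ide C (H \<odot> A) \<star> tp2 S (N, B))"
  have sq: "inverse_arrow C ?y \<cdot> ?T = middle_swap C H N A (T\<^sub>o B) \<cdot> inverse_arrow C ?x"
    using middle_swap_tp(4) [OF assms] by (intro inverse_square) simp_all
  have "(middle_swap C H N A (T\<^sub>o B) \<cdot> inverse_arrow C ?x) \<cdot> tp1 S (H \<odot> N, A \<odot> B) \<cdot>
      (tp2 S (H, N) \<star> Ide C (A \<odot> B)) =
    inverse_arrow C ?y \<cdot> (?T \<cdot> tp1 S (H \<odot> N, A \<odot> B) \<cdot> (tp2 S (H, N) \<star> Ide C (A \<odot> B)))"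
    unfolding sq [symmetric] by simp
  also have "\<dots> = inverse_arrow C ?y \<cdot>
      tp2 S (H \<odot> A, N \<odot> B) \<cdot> (Ide C (H \<odot> A) \<star> tp1 S (N, B)) \<cdot> middle_swap C H (T\<^sub>o N) A B"
    unfolding middle_swap_tp(2) [OF assms] by simp
  finally show "middle_swap C H N A (T\<^sub>o B) \<cdot> (Ide C (H \<odot> N) \<star> inverse_arrow C (tp2 S (A, B))) \<cdot>
      inverse_arrow C (tp2 S (H \<odot> N, A \<odot> B)) \<cdot> tp1 S (H \<odot> N, A \<odot> B) \<cdot>
      (tp2 S (H, N) \<star> Ide C (A \<odot> B)) =
    (Ide C (H \<odot> A) \<star> (inverse_arrow C (tp2 S (N, B)) \<cdot> tp1 S (N, B))) \<cdot> middle_swap C H (T\<^sub>o N) A B"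
    by (simp add: inverse_Comp)
qed

text \<open>After transposition the evaluations split off on the left and what remains is
  \<open>middle_swap_tp12\<close>.\<close>

lemma tau_suspended:
  assumes "K \<in> Ob C" "M \<in> Ob C" "A \<in> Ob C" "B \<in> Ob C"
  shows "tau C K M (A, B) \<cdot> (dual_suspension C S K A \<star> Ide C (B \<rightarrowtail> M)) =
      dual_suspension C S (K \<odot> M) (A \<odot> B) \<cdot>
      T\<^sub>a (inverse_arrow C (tp1 S (A, B)) \<Zinj> Ide C (K \<odot> M)) \<cdot>
      T\<^sub>a (tau C K M (T\<^sub>o A, B)) \<cdot> tp1 S (T\<^sub>o A \<rightarrowtail> K, B \<rightarrowtail> M)"
      (is "?l1 = ?r1")
    and "tau C K M (A, B) \<cdot> (Ide C (A \<rightarrowtail> K) \<star> dual_suspension C S M B) =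
      dual_suspension C S (K \<odot> M) (A \<odot> B) \<cdot>
      T\<^sub>a (inverse_arrow C (tp2 S (A, B)) \<Zinj> Ide C (K \<odot> M)) \<cdot>
      T\<^sub>a (tau C K M (A, T\<^sub>o B)) \<cdot> tp2 S (A \<rightarrowtail> K, T\<^sub>o B \<rightarrowtail> M)"
      (is "?l2 = ?r2")
proof -
  note [simp] = assms
  let ?u = "uncurry_arrow (A \<odot> B) (K \<odot> M)"
  let ?D = "dual_suspension C S (K \<odot> M) (A \<odot> B)"
  have Ide: "uncurry_arrow X N (Ide C (X \<rightarrowtail> N)) = Ev C X N" if "X \<in> Ob C" "N \<in> Ob C" for X N
    using that by (simp add: uncurry_arrow_def)
  let ?H = "T\<^sub>o A \<rightarrowtail> K" and ?N = "B \<rightarrowtail> M"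
  \<comment> \<open>The two arrows under separate \<open>T\<close> are collected under one, which is
    the shape that \<open>uncurry_dual_suspension_pre\<close> transposes.\<close>
  let ?h = "(inverse_arrow C (tp1 S (A, B)) \<Zinj> Ide C (K \<odot> M)) \<cdot> tau C K M (T\<^sub>o A, B)"
  have "?u ?r1 = ?u ((?D \<cdot> T\<^sub>a ?h) \<cdot> tp1 S (?H, ?N))"
    by simp
  also have "\<dots> = ?u (?D \<cdot> T\<^sub>a ?h) \<cdot> (tp1 S (?H, ?N) \<star> Ide C (A \<odot> B))"
    by (subst uncurry_Comp) simp_all
  also have "?u (?D \<cdot> T\<^sub>a ?h) = (Ev C (T\<^sub>o A) K \<star> Ev C B M) \<cdot> middle_swap C ?H ?N (T\<^sub>o A) B \<cdot>
      (Ide C (?H \<odot> ?N) \<star> inverse_arrow C (tp1 S (A, B))) \<cdot>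
      inverse_arrow C (tp2 S (?H \<odot> ?N, A \<odot> B)) \<cdot> tp1 S (?H \<odot> ?N, A \<odot> B)"
    by (subst uncurry_dual_suspension_pre [where W = "?H \<odot> ?N"]) (simp_all add: uncurry_pre uncurry_tau)
  also have "\<dots> \<cdot> (tp1 S (?H, ?N) \<star> Ide C (A \<odot> B)) = (Ev C (T\<^sub>o A) K \<star> Ev C B M) \<cdot>
      (middle_swap C ?H ?N (T\<^sub>o A) B \<cdot>
      (Ide C (?H \<odot> ?N) \<star> inverse_arrow C (tp1 S (A, B))) \<cdot>
      inverse_arrow C (tp2 S (?H \<odot> ?N, A \<odot> B)) \<cdot> tp1 S (?H \<odot> ?N, A \<odot> B) \<cdot>
      (tp1 S (?H, ?N) \<star> Ide C (A \<odot> B)))"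
    by simp
  also have "\<dots> = ?u ?l1"
    by (subst middle_swap_tp12(1)) (simp_all add: uncurry_tau_pre Ide uncurry_dual_suspension)
  finally show "?l1 = ?r1"
    by (rule uncurry_inject [OF sym]) simp_all
  let ?H = "A \<rightarrowtail> K" and ?N = "T\<^sub>o B \<rightarrowtail> M"
  let ?h = "(inverse_arrow C (tp2 S (A, B)) \<Zinj> Ide C (K \<odot> M)) \<cdot> tau C K M (A, T\<^sub>o B)"
  have "?u ?r2 = ?u ((?D \<cdot> T\<^sub>a ?h) \<cdot> tp2 S (?H, ?N))"
    by simp
  also have "\<dots> = ?u (?D \<cdot> T\<^sub>a ?h) \<cdot> (tp2 S (?H, ?N) \<star> Ide C (A \<odot> B))"
    by (subst uncurry_Comp) simp_all
  also have "?u (?D \<cdot> T\<^sub>a ?h) = (Ev C A K \<star> Ev C (T\<^sub>o B) M) \<cdot> middle_swap C ?H ?N A (T\<^sub>o B) \<cdot>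
      (Ide C (?H \<odot> ?N) \<star> inverse_arrow C (tp2 S (A, B))) \<cdot>
      inverse_arrow C (tp2 S (?H \<odot> ?N, A \<odot> B)) \<cdot> tp1 S (?H \<odot> ?N, A \<odot> B)"
    by (subst uncurry_dual_suspension_pre [where W = "?H \<odot> ?N"]) (simp_all add: uncurry_pre uncurry_tau)
  also have "\<dots> \<cdot> (tp2 S (?H, ?N) \<star> Ide C (A \<odot> B)) = (Ev C A K \<star> Ev C (T\<^sub>o B) M) \<cdot>
      (middle_swap C ?H ?N A (T\<^sub>o B) \<cdot>
      (Ide C (?H \<odot> ?N) \<star> inverse_arrow C (tp2 S (A, B))) \<cdot>
      inverse_arrow C (tp2 S (?H \<odot> ?N, A \<odot> B)) \<cdot> tp1 S (?H \<odot> ?N, A \<odot> B) \<cdot>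
      (tp2 S (?H, ?N) \<star> Ide C (A \<odot> B)))"
    by simp
  also have "\<dots> = ?u ?l2"
    by (subst middle_swap_tp12(2)) (simp_all add: uncurry_tau_pre Ide uncurry_dual_suspension)
  finally show "?l2 = ?r2"
    by (rule uncurry_inject [OF sym]) simp_all
qed

end

section \<open>Suspended symmetric monoidal functors\<close>

locale suspended_monoidal_functor =
  closed_monoidal_functor C D f \<alpha> +
  C: suspended_closed_category C S + D: suspended_closed_category D S'
  for C :: "('o, 'a, 'm) smcc_data_scheme" and D :: "('p, 'b, 'n) smcc_data_scheme"
    and f :: "('o, 'a, 'p, 'b) functor_data" and \<alpha> :: "'o \<times> 'o \<Rightarrow> 'b"
    and S :: "('o, 'a, 'k) tensor_suspension_data_scheme"
    and S' :: "('p, 'b, 'l) tensor_suspension_data_scheme" +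
  fixes t :: "'o \<Rightarrow> 'b"
  assumes suspended_functor: "suspended_symmetric_monoidal_functor C S D S' f t \<alpha>"
begin

lemma t_nat_iso: "nat_iso C D (f \<circ>\<^sub>F Susp S) (Susp S' \<circ>\<^sub>F f) t"
  using suspended_functor
  by (simp add: suspended_symmetric_monoidal_functor_def suspended_functor_def)

lemma t_ar [simp]:
  assumes "A \<in> Ob C"
  shows "t A \<in> Ar D" "Dom D (t A) = fo f (C.T\<^sub>o A)" "Cod D (t A) = D.T\<^sub>o (fo f A)"
    "is_isomorphism D (t A)"
  using assms t_nat_iso nat_transD(3-5) [of C D "f \<circ>\<^sub>F Susp S" "Susp S' \<circ>\<^sub>F f" t A]
  by (simp_all add: nat_iso_def)

lemma t_nat:
  assumes "a \<in> Ar C"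
  shows "t (Cod C a) \<cdot>\<^bsub>D\<^esub> fa f (C.T\<^sub>a a) = D.T\<^sub>a (fa f a) \<cdot>\<^bsub>D\<^esub> t (Dom C a)"
  using assms t_nat_iso nat_transD(6) [of C D "f \<circ>\<^sub>F Susp S" "Susp S' \<circ>\<^sub>F f" t a]
  by (simp add: nat_iso_def)

lemma \<alpha>_tp:
  assumes "A \<in> Ob C" "B \<in> Ob C"
  shows "D.T\<^sub>a (\<alpha> (A, B)) \<cdot>\<^bsub>D\<^esub> tp1 S' (fo f A, fo f B) \<cdot>\<^bsub>D\<^esub> (t A \<star>\<^bsub>D\<^esub> Ide D (fo f B)) =
      t (A \<odot>\<^bsub>C\<^esub> B) \<cdot>\<^bsub>D\<^esub> fa f (tp1 S (A, B)) \<cdot>\<^bsub>D\<^esub> \<alpha> (C.T\<^sub>o A, B)"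
    and "D.T\<^sub>a (\<alpha> (A, B)) \<cdot>\<^bsub>D\<^esub> tp2 S' (fo f A, fo f B) \<cdot>\<^bsub>D\<^esub> (Ide D (fo f A) \<star>\<^bsub>D\<^esub> t B) =
      t (A \<odot>\<^bsub>C\<^esub> B) \<cdot>\<^bsub>D\<^esub> fa f (tp2 S (A, B)) \<cdot>\<^bsub>D\<^esub> \<alpha> (A, C.T\<^sub>o B)"
  using suspended_functor assms
  by (simp_all add: suspended_symmetric_monoidal_functor_def suspended_bifunctor_iso_def
      suspended_precomp_def suspended_postcomp_def)

text \<open>The counterpart of \<open>middle_swap_tp12\<close> for \<alpha>: the compatibility in
  the second variable is inverted and pasted to that in the first.\<close>

lemma \<alpha>_tp12:
  assumes "H \<in> Ob C" "A \<in> Ob C"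
  shows "\<alpha> (H, C.T\<^sub>o A) \<cdot>\<^bsub>D\<^esub> (Ide D (fo f H) \<star>\<^bsub>D\<^esub> inverse_arrow D (t A)) \<cdot>\<^bsub>D\<^esub>
      inverse_arrow D (tp2 S' (fo f H, fo f A)) \<cdot>\<^bsub>D\<^esub> tp1 S' (fo f H, fo f A) \<cdot>\<^bsub>D\<^esub>
      (t H \<star>\<^bsub>D\<^esub> Ide D (fo f A)) =
    fa f (inverse_arrow C (tp2 S (H, A))) \<cdot>\<^bsub>D\<^esub> fa f (tp1 S (H, A)) \<cdot>\<^bsub>D\<^esub> \<alpha> (C.T\<^sub>o H, A)"
proof -
  note [simp] = assms D.tensor_iso f_iso
  let ?x = "tp2 S' (fo f H, fo f A) \<cdot>\<^bsub>D\<^esub> (Ide D (fo f H) \<star>\<^bsub>D\<^esub> t A)"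
  let ?y = "t (H \<odot>\<^bsub>C\<^esub> A) \<cdot>\<^bsub>D\<^esub> fa f (tp2 S (H, A))"
  have sq: "inverse_arrow D ?y \<cdot>\<^bsub>D\<^esub> D.T\<^sub>a (\<alpha> (H, A)) = \<alpha> (H, C.T\<^sub>o A) \<cdot>\<^bsub>D\<^esub> inverse_arrow D ?x"
    using \<alpha>_tp(2) [OF assms] by (intro D.inverse_square) simp_all
  have "(\<alpha> (H, C.T\<^sub>o A) \<cdot>\<^bsub>D\<^esub> inverse_arrow D ?x) \<cdot>\<^bsub>D\<^esub> tp1 S' (fo f H, fo f A) \<cdot>\<^bsub>D\<^esub>
      (t H \<star>\<^bsub>D\<^esub> Ide D (fo f A)) =
    inverse_arrow D ?y \<cdot>\<^bsub>D\<^esub> (D.T\<^sub>a (\<alpha> (H, A)) \<cdot>\<^bsub>D\<^esub> tp1 S' (fo f H, fo f A) \<cdot>\<^bsub>D\<^esub>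
      (t H \<star>\<^bsub>D\<^esub> Ide D (fo f A)))"
    unfolding sq [symmetric] by simp
  also have "\<dots> = inverse_arrow D ?y \<cdot>\<^bsub>D\<^esub>
      t (H \<odot>\<^bsub>C\<^esub> A) \<cdot>\<^bsub>D\<^esub> fa f (tp1 S (H, A)) \<cdot>\<^bsub>D\<^esub> \<alpha> (C.T\<^sub>o H, A)"
    unfolding \<alpha>_tp(1) [OF assms] by simp
  finally show ?thesis
    by (simp add: D.inverse_Comp)
qed

text \<open>Compatibility of \<beta> with suspension in one variable; transposed, it is the image of
  evaluation applied to \<open>\<alpha>_tp12\<close>.\<close>

lemma beta_suspended:
  assumes "K \<in> Ob C" "A \<in> Ob C"
  shows "beta C D f \<alpha> K A \<cdot>\<^bsub>D\<^esub> fa f (dual_suspension C S K A) =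
    dual_suspension D S' (fo f K) (fo f A) \<cdot>\<^bsub>D\<^esub>
      D.T\<^sub>a (inverse_arrow D (t A) \<Zinj>\<^bsub>D\<^esub> Ide D (fo f K)) \<cdot>\<^bsub>D\<^esub>
      D.T\<^sub>a (beta C D f \<alpha> K (C.T\<^sub>o A)) \<cdot>\<^bsub>D\<^esub> t (C.T\<^sub>o A \<rightarrowtail>\<^bsub>C\<^esub> K)"
    (is "?l = ?r")
proof -
  note [simp] = assms
  let ?u = "D.uncurry_arrow (fo f A) (fo f K)" and ?H = "C.T\<^sub>o A \<rightarrowtail>\<^bsub>C\<^esub> K"
  let ?D = "dual_suspension D S' (fo f K) (fo f A)"
  let ?h = "(inverse_arrow D (t A) \<Zinj>\<^bsub>D\<^esub> Ide D (fo f K)) \<cdot>\<^bsub>D\<^esub> beta C D f \<alpha> K (C.T\<^sub>o A)"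
  have "?u ?r = ?u ((?D \<cdot>\<^bsub>D\<^esub> D.T\<^sub>a ?h) \<cdot>\<^bsub>D\<^esub> t ?H)"
    by simp
  also have "\<dots> = ?u (?D \<cdot>\<^bsub>D\<^esub> D.T\<^sub>a ?h) \<cdot>\<^bsub>D\<^esub> (t ?H \<star>\<^bsub>D\<^esub> Ide D (fo f A))"
    by (subst D.uncurry_Comp) simp_all
  also have "?u (?D \<cdot>\<^bsub>D\<^esub> D.T\<^sub>a ?h) = fa f (Ev C (C.T\<^sub>o A) K) \<cdot>\<^bsub>D\<^esub> \<alpha> (?H, C.T\<^sub>o A) \<cdot>\<^bsub>D\<^esub>
      (Ide D (fo f ?H) \<star>\<^bsub>D\<^esub> inverse_arrow D (t A)) \<cdot>\<^bsub>D\<^esub>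
      inverse_arrow D (tp2 S' (fo f ?H, fo f A)) \<cdot>\<^bsub>D\<^esub> tp1 S' (fo f ?H, fo f A)"
    by (subst D.uncurry_dual_suspension_pre [where W = "fo f ?H"])
      (simp_all add: D.uncurry_pre uncurry_beta)
  also have "\<dots> \<cdot>\<^bsub>D\<^esub> (t ?H \<star>\<^bsub>D\<^esub> Ide D (fo f A)) = fa f (Ev C (C.T\<^sub>o A) K) \<cdot>\<^bsub>D\<^esub>
      (\<alpha> (?H, C.T\<^sub>o A) \<cdot>\<^bsub>D\<^esub> (Ide D (fo f ?H) \<star>\<^bsub>D\<^esub> inverse_arrow D (t A)) \<cdot>\<^bsub>D\<^esub>
      inverse_arrow D (tp2 S' (fo f ?H, fo f A)) \<cdot>\<^bsub>D\<^esub> tp1 S' (fo f ?H, fo f A) \<cdot>\<^bsub>D\<^esub>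
      (t ?H \<star>\<^bsub>D\<^esub> Ide D (fo f A)))"
    by simp
  also have "\<dots> = ?u ?l"
    by (subst \<alpha>_tp12) (simp_all add: uncurry_beta_pre C.uncurry_dual_suspension)
  finally show "?l = ?r"
    by (rule D.uncurry_inject [OF sym]) simp_all
qed

lemma beta_nat:
  assumes "K \<in> Ob C" "a \<in> Ar C"
  shows "beta C D f \<alpha> K (Dom C a) \<cdot>\<^bsub>D\<^esub> fa f (a \<Zinj>\<^bsub>C\<^esub> Ide C K) =
    (fa f a \<Zinj>\<^bsub>D\<^esub> Ide D (fo f K)) \<cdot>\<^bsub>D\<^esub> beta C D f \<alpha> K (Cod C a)"
  using duality_preserving_functorD(5)
    [OF pullback_duality_preserving [OF assms(1), unfolded with_duality_def pullback_dp_def] assms(2)]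
  by simp

text \<open>Compatibility with suspensions is inherited by the composite with \<open>{f\<^sup>*, \<beta>}\<close>. Here
  \<open>x : P \<rightarrow> T X\<close> moves the suspension out of one variable of a bifunctor, \<open>y\<close> is its
  counterpart on dual objects, and \<open>u\<close> is induced by the suspension of the duality.\<close>

lemma beta_comp_suspended:
  assumes "L \<in> Ob C" "X \<in> Ob C"
    and x: "is_isomorphism C x" "Dom C x = P" "Cod C x = C.T\<^sub>o X"
    and \<tau>: "\<tau> \<in> Ar C" "Cod C \<tau> = X \<rightarrowtail>\<^bsub>C\<^esub> L"
    and u: "u \<in> Ar C" "Cod C u = Dom C \<tau>"
    and \<tau>': "\<tau>' \<in> Ar C" "Dom C \<tau>' = W'" "Cod C \<tau>' = P \<rightarrowtail>\<^bsub>C\<^esub> L"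
    and y: "y \<in> Ar C" "Cod C y = C.T\<^sub>o W'"
    and eq: "\<tau> \<cdot>\<^bsub>C\<^esub> u = dual_suspension C S L X \<cdot>\<^bsub>C\<^esub> C.T\<^sub>a (inverse_arrow C x \<Zinj>\<^bsub>C\<^esub> Ide C L) \<cdot>\<^bsub>C\<^esub>
      C.T\<^sub>a \<tau>' \<cdot>\<^bsub>C\<^esub> y"
  shows "(beta C D f \<alpha> L X \<cdot>\<^bsub>D\<^esub> fa f \<tau>) \<cdot>\<^bsub>D\<^esub> fa f u =
    dual_suspension D S' (fo f L) (fo f X) \<cdot>\<^bsub>D\<^esub>
      D.T\<^sub>a (inverse_arrow D (t X \<cdot>\<^bsub>D\<^esub> fa f x) \<Zinj>\<^bsub>D\<^esub> Ide D (fo f L)) \<cdot>\<^bsub>D\<^esub>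
      D.T\<^sub>a (beta C D f \<alpha> L P \<cdot>\<^bsub>D\<^esub> fa f \<tau>') \<cdot>\<^bsub>D\<^esub> t W' \<cdot>\<^bsub>D\<^esub> fa f y"
proof -
  note [simp] = assms(1,2) x \<tau> u \<tau>' y C.iso_arrow [OF x(1)]
  have [simp]: "P \<in> Ob C" "W' \<in> Ob C"
    using C.Dom_in_Ob [of x] C.Dom_in_Ob [of \<tau>'] by simp_all
  let ?i = "inverse_arrow C x" and ?d = "dual_suspension D S' (fo f L) (fo f X)"
  let ?t = "D.T\<^sub>a (inverse_arrow D (t X) \<Zinj>\<^bsub>D\<^esub> Ide D (fo f L))"
  let ?L = "Ide C L" and ?fL = "Ide D (fo f L)"
  let ?\<beta> = "beta C D f \<alpha> L"
  have "(?\<beta> X \<cdot>\<^bsub>D\<^esub> fa f \<tau>) \<cdot>\<^bsub>D\<^esub> fa f u = ?\<beta> X \<cdot>\<^bsub>D\<^esub> fa f (\<tau> \<cdot>\<^bsub>C\<^esub> u)"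
    by simp
  also have "\<dots> = (?\<beta> X \<cdot>\<^bsub>D\<^esub> fa f (dual_suspension C S L X)) \<cdot>\<^bsub>D\<^esub>
      fa f (C.T\<^sub>a (?i \<Zinj>\<^bsub>C\<^esub> ?L)) \<cdot>\<^bsub>D\<^esub> fa f (C.T\<^sub>a \<tau>') \<cdot>\<^bsub>D\<^esub> fa f y"
    unfolding eq by simp
  also have "\<dots> = ?d \<cdot>\<^bsub>D\<^esub> ?t \<cdot>\<^bsub>D\<^esub> D.T\<^sub>a (?\<beta> (C.T\<^sub>o X)) \<cdot>\<^bsub>D\<^esub>
      ((t (C.T\<^sub>o X \<rightarrowtail>\<^bsub>C\<^esub> L) \<cdot>\<^bsub>D\<^esub> fa f (C.T\<^sub>a ((?i \<Zinj>\<^bsub>C\<^esub> ?L) \<cdot>\<^bsub>C\<^esub> \<tau>'))) \<cdot>\<^bsub>D\<^esub> fa f y)"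
    unfolding beta_suspended [OF assms(1,2)] by simp
  also have "\<dots> = ?d \<cdot>\<^bsub>D\<^esub> ?t \<cdot>\<^bsub>D\<^esub> D.T\<^sub>a ((?\<beta> (C.T\<^sub>o X) \<cdot>\<^bsub>D\<^esub> fa f (?i \<Zinj>\<^bsub>C\<^esub> ?L)) \<cdot>\<^bsub>D\<^esub> fa f \<tau>') \<cdot>\<^bsub>D\<^esub>
      t W' \<cdot>\<^bsub>D\<^esub> fa f y"
    using t_nat [of "(?i \<Zinj>\<^bsub>C\<^esub> ?L) \<cdot>\<^bsub>C\<^esub> \<tau>'"] by simp
  also have "?\<beta> (C.T\<^sub>o X) \<cdot>\<^bsub>D\<^esub> fa f (?i \<Zinj>\<^bsub>C\<^esub> ?L) = (fa f ?i \<Zinj>\<^bsub>D\<^esub> ?fL) \<cdot>\<^bsub>D\<^esub> ?\<beta> P"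
    using beta_nat [of L ?i] by simp
  also have "?d \<cdot>\<^bsub>D\<^esub> ?t \<cdot>\<^bsub>D\<^esub> D.T\<^sub>a (((fa f ?i \<Zinj>\<^bsub>D\<^esub> ?fL) \<cdot>\<^bsub>D\<^esub> ?\<beta> P) \<cdot>\<^bsub>D\<^esub> fa f \<tau>') \<cdot>\<^bsub>D\<^esub> t W' \<cdot>\<^bsub>D\<^esub> fa f y =
    ?d \<cdot>\<^bsub>D\<^esub> D.T\<^sub>a ((inverse_arrow D (t X) \<Zinj>\<^bsub>D\<^esub> ?fL) \<cdot>\<^bsub>D\<^esub> (fa f ?i \<Zinj>\<^bsub>D\<^esub> ?fL)) \<cdot>\<^bsub>D\<^esub>
      D.T\<^sub>a (?\<beta> P \<cdot>\<^bsub>D\<^esub> fa f \<tau>') \<cdot>\<^bsub>D\<^esub> t W' \<cdot>\<^bsub>D\<^esub> fa f y"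
    by simp
  also have "(inverse_arrow D (t X) \<Zinj>\<^bsub>D\<^esub> ?fL) \<cdot>\<^bsub>D\<^esub> (fa f ?i \<Zinj>\<^bsub>D\<^esub> ?fL) =
      inverse_arrow D (t X \<cdot>\<^bsub>D\<^esub> fa f x) \<Zinj>\<^bsub>D\<^esub> ?fL"
    by (subst D.ihom_Comp) (simp_all add: D.inverse_Comp f_iso)
  finally show ?thesis .
qed

text \<open>Compatibility with suspensions is invariant under the isomorphism \<open>\<alpha>\<close> of duality preserving
  functors: \<open>b'\<close>, \<open>c'\<close> and \<open>\<phi>'\<close> belong to one functor and \<open>b\<close>, \<open>c\<close> and \<open>\<phi>\<close> to the other.\<close>

lemma suspended_transport:
  assumes "L \<in> Ob D"
    and a: "a \<in> Ar D" "Dom D a = X" "Cod D a = X'"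
    and p: "p \<in> Ar D" "Dom D p = Y" "Cod D p = Y'"
    and w: "w \<in> Ar D" "Dom D w = W" "Cod D w = W'"
    and v: "v \<in> Ar D" "Cod D v = Dom D c'"
    and b: "is_isomorphism D b" "Dom D b = Y" "Cod D b = D.T\<^sub>o X"
    and b': "is_isomorphism D b'" "Dom D b' = Y'" "Cod D b' = D.T\<^sub>o X'"
    and c: "c \<in> Ar D" "Dom D c = Dom D v" "Cod D c = D.T\<^sub>o W"
    and c': "c' \<in> Ar D" "Cod D c' = D.T\<^sub>o W'"
    and \<phi>': "\<phi>' \<in> Ar D" "Dom D \<phi>' = W'" "Cod D \<phi>' = Y' \<rightarrowtail>\<^bsub>D\<^esub> L"
    and ab: "D.T\<^sub>a a \<cdot>\<^bsub>D\<^esub> b = b' \<cdot>\<^bsub>D\<^esub> p" and wc: "D.T\<^sub>a w \<cdot>\<^bsub>D\<^esub> c = c' \<cdot>\<^bsub>D\<^esub> v"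
  shows "(a \<Zinj>\<^bsub>D\<^esub> Ide D L) \<cdot>\<^bsub>D\<^esub> (dual_suspension D S' L X' \<cdot>\<^bsub>D\<^esub>
      D.T\<^sub>a (inverse_arrow D b' \<Zinj>\<^bsub>D\<^esub> Ide D L) \<cdot>\<^bsub>D\<^esub> D.T\<^sub>a \<phi>' \<cdot>\<^bsub>D\<^esub> c') \<cdot>\<^bsub>D\<^esub> v =
    dual_suspension D S' L X \<cdot>\<^bsub>D\<^esub> D.T\<^sub>a (inverse_arrow D b \<Zinj>\<^bsub>D\<^esub> Ide D L) \<cdot>\<^bsub>D\<^esub>
      D.T\<^sub>a ((p \<Zinj>\<^bsub>D\<^esub> Ide D L) \<cdot>\<^bsub>D\<^esub> \<phi>' \<cdot>\<^bsub>D\<^esub> w) \<cdot>\<^bsub>D\<^esub> c"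
proof -
  note [simp] = assms(1) a p w v b b' c c' \<phi>' D.iso_arrow [OF b(1)] D.iso_arrow [OF b'(1)]
  have [simp]: "X \<in> Ob D" "X' \<in> Ob D" "Y \<in> Ob D" "Y' \<in> Ob D" "W \<in> Ob D" "W' \<in> Ob D"
    using D.Dom_in_Ob [of a] D.Cod_in_Ob [of a] D.Dom_in_Ob [of p] D.Cod_in_Ob [of p]
      D.Dom_in_Ob [of w] D.Cod_in_Ob [of w] by simp_all
  let ?L = "Ide D L"
  \<comment> \<open>The square \<open>ab\<close> with its suspension maps inverted; its dual
    exchanges \<open>a\<close> for \<open>p\<close> once \<open>dual_suspension_nat\<close> has
    brought \<open>a\<close> under \<open>T\<close>.\<close>
  have sq: "inverse_arrow D b' \<cdot>\<^bsub>D\<^esub> D.T\<^sub>a a = p \<cdot>\<^bsub>D\<^esub> inverse_arrow D b"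
    using ab by (intro D.inverse_square) simp_all
  have "(a \<Zinj>\<^bsub>D\<^esub> ?L) \<cdot>\<^bsub>D\<^esub> (dual_suspension D S' L X' \<cdot>\<^bsub>D\<^esub>
      D.T\<^sub>a (inverse_arrow D b' \<Zinj>\<^bsub>D\<^esub> ?L) \<cdot>\<^bsub>D\<^esub> D.T\<^sub>a \<phi>' \<cdot>\<^bsub>D\<^esub> c') \<cdot>\<^bsub>D\<^esub> v =
    ((a \<Zinj>\<^bsub>D\<^esub> ?L) \<cdot>\<^bsub>D\<^esub> dual_suspension D S' L X') \<cdot>\<^bsub>D\<^esub>
      D.T\<^sub>a (inverse_arrow D b' \<Zinj>\<^bsub>D\<^esub> ?L) \<cdot>\<^bsub>D\<^esub> D.T\<^sub>a \<phi>' \<cdot>\<^bsub>D\<^esub> (c' \<cdot>\<^bsub>D\<^esub> v)"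
    by simp
  also have "\<dots> = dual_suspension D S' L X \<cdot>\<^bsub>D\<^esub>
      D.T\<^sub>a ((D.T\<^sub>a a \<Zinj>\<^bsub>D\<^esub> ?L) \<cdot>\<^bsub>D\<^esub> (inverse_arrow D b' \<Zinj>\<^bsub>D\<^esub> ?L)) \<cdot>\<^bsub>D\<^esub>
      D.T\<^sub>a \<phi>' \<cdot>\<^bsub>D\<^esub> (D.T\<^sub>a w \<cdot>\<^bsub>D\<^esub> c)"
    using D.dual_suspension_nat [of L a] wc by simp
  also have "(D.T\<^sub>a a \<Zinj>\<^bsub>D\<^esub> ?L) \<cdot>\<^bsub>D\<^esub> (inverse_arrow D b' \<Zinj>\<^bsub>D\<^esub> ?L) =
      (inverse_arrow D b \<Zinj>\<^bsub>D\<^esub> ?L) \<cdot>\<^bsub>D\<^esub> (p \<Zinj>\<^bsub>D\<^esub> ?L)"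
    by (simp add: D.ihom_Comp sq)
  finally show ?thesis
    by simp
qed

end

section \<open>Suspended and exact bifunctors\<close>

text \<open>Serves to drop identity factors, which cancel only at objects. The sign condition
  evaluates \<open>b\<close> and \<open>c\<close> at suspended objects, hence the functoriality of
  the suspensions.\<close>

lemma suspended_bifunctor_cong:
  assumes "category C1" "category C2" "is_functor C1 C1 (Susp S1)" "is_functor C2 C2 (Susp S2)"
    and "\<And>A B. A \<in> Ob C1 \<Longrightarrow> B \<in> Ob C2 \<Longrightarrow> b (A, B) = b' (A, B) \<and> c (A, B) = c' (A, B)"
  shows "suspended_bifunctor C1 S1 C2 S2 D S (F, b, c) \<longleftrightarrow>
    suspended_bifunctor C1 S1 C2 S2 D S (F, b', c')"
proof -
  have nat: "nat_iso (prod_cat C1 C2) D G H \<eta> \<longleftrightarrow> nat_iso (prod_cat C1 C2) D G H \<theta>"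
    if "\<And>A B. A \<in> Ob C1 \<Longrightarrow> B \<in> Ob C2 \<Longrightarrow> \<eta> (A, B) = \<theta> (A, B)" for G H \<eta> \<theta>
    using nat_trans_cong [OF prod_category [OF assms(1,2)], of \<eta> \<theta> D G H] that
    by (auto simp: nat_iso_def)
  have b: "nat_iso (prod_cat C1 C2) D G H b \<longleftrightarrow> nat_iso (prod_cat C1 C2) D G H b'" for G H
    by (rule nat) (simp add: assms(5))
  have c: "nat_iso (prod_cat C1 C2) D G H c \<longleftrightarrow> nat_iso (prod_cat C1 C2) D G H c'" for G H
    by (rule nat) (simp add: assms(5))
  show ?thesis
    using assms(5) is_functorD(1) [OF assms(3)] is_functorD(1) [OF assms(4)]
    by (simp add: suspended_bifunctor_def b c)
qed

lemma fix_simps [simp]: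
  "fo (fix_snd C B F) A = fo F (A, B)" "fa (fix_snd C B F) a = fa F (a, Ide C B)"
  "fo (fix_fst C' A' F) B' = fo F (A', B')" "fa (fix_fst C' A' F) b = fa F (Ide C' A', b)"
  by (simp_all add: fix_snd_def fix_fst_def)

text \<open>Naturality in one variable is naturality at a pair of arrows whose other component is an
  identity.\<close>

lemma suspended_bifunctor_fix:
  assumes "suspended_bifunctor C1 S1 C2 S2 D S (F, b, c)"
    and "is_functor C1 C1 (Susp S1)" "is_functor C2 C2 (Susp S2)" "is_functor D D (Susp S)"
    and "category C1" "category C2"
  shows "B \<in> Ob C2 \<Longrightarrow> suspended_functor C1 S1 D S (fix_snd C2 B F, \<lambda>A. b (A, B))"
    and "A \<in> Ob C1 \<Longrightarrow> suspended_functor C2 S2 D S (fix_fst C1 A F, \<lambda>B. c (A, B))"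
proof -
  interpret C1: category C1 by fact
  interpret C2: category C2 by fact
  have n: "nat_iso (prod_cat C1 C2) D (F \<circ>\<^sub>F Susp S1 \<times>\<^sub>F id_functor) (Susp S \<circ>\<^sub>F F) b"
    "nat_iso (prod_cat C1 C2) D (F \<circ>\<^sub>F id_functor \<times>\<^sub>F Susp S2) (Susp S \<circ>\<^sub>F F) c"
    using assms(1) by (simp_all add: suspended_bifunctor_def)
  then have nt: "nat_trans (prod_cat C1 C2) D (F \<circ>\<^sub>F Susp S1 \<times>\<^sub>F id_functor) (Susp S \<circ>\<^sub>F F) b"
    "nat_trans (prod_cat C1 C2) D (F \<circ>\<^sub>F id_functor \<times>\<^sub>F Susp S2) (Susp S \<circ>\<^sub>F F) c"
    by (simp_all add: nat_iso_def)
  {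
    assume B: "B \<in> Ob C2"
    have add: "additive_functor C1 S1 D S (fix_snd C2 B F)"
      using assms(1) B by (simp add: suspended_bifunctor_def)
    then have func: "is_functor C1 D (fix_snd C2 B F)"
      by (simp add: additive_functor_def)
    have "nat_trans C1 D (fix_snd C2 B F \<circ>\<^sub>F Susp S1) (Susp S \<circ>\<^sub>F fix_snd C2 B F) (\<lambda>A. b (A, B))"
    proof (rule nat_transI)
      show "b (Cod C1 a, B) \<cdot>\<^bsub>D\<^esub> fa (fix_snd C2 B F \<circ>\<^sub>F Susp S1) a =
          fa (Susp S \<circ>\<^sub>F fix_snd C2 B F) a \<cdot>\<^bsub>D\<^esub> b (Dom C1 a, B)" if "a \<in> Ar C1" for a
        using nat_transD(6) [OF nt(1), of "(a, Ide C2 B)"] that B by simp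
    qed (use nat_transD(3-5) [OF nt(1)] B in
        \<open>simp_all add: is_functor_comp [OF assms(2) func] is_functor_comp [OF func assms(4)]\<close>)
    then show "suspended_functor C1 S1 D S (fix_snd C2 B F, \<lambda>A. b (A, B))"
      using add n(1) B by (simp add: suspended_functor_def nat_iso_def)
  }
  {
    assume A: "A \<in> Ob C1"
    have add: "additive_functor C2 S2 D S (fix_fst C1 A F)"
      using assms(1) A by (simp add: suspended_bifunctor_def)
    then have func: "is_functor C2 D (fix_fst C1 A F)"
      by (simp add: additive_functor_def)
    have "nat_trans C2 D (fix_fst C1 A F \<circ>\<^sub>F Susp S2) (Susp S \<circ>\<^sub>F fix_fst C1 A F) (\<lambda>B. c (A, B))"
    proof (rule nat_transI)
      show "c (A, Cod C2 a) \<cdot>\<^bsub>D\<^esub> fa (fix_fst C1 A F \<circ>\<^sub>F Susp S2) a =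
          fa (Susp S \<circ>\<^sub>F fix_fst C1 A F) a \<cdot>\<^bsub>D\<^esub> c (A, Dom C2 a)" if "a \<in> Ar C2" for a
        using nat_transD(6) [OF nt(2), of "(Ide C1 A, a)"] that A by simp
    qed (use nat_transD(3-5) [OF nt(2)] A in
        \<open>simp_all add: is_functor_comp [OF assms(3) func] is_functor_comp [OF func assms(4)]\<close>)
    then show "suspended_functor C2 S2 D S (fix_fst C1 A F, \<lambda>B. c (A, B))"
      using add n(2) A by (simp add: suspended_functor_def nat_iso_def)
  }
qed

text \<open>The suspended structure in each variable is inherited from the bifunctor, which leaves
  only the condition on triangles.\<close>

lemma exact_bifunctorI:
  assumes "suspended_bifunctor C1 S1 C2 S2 D S (F, b, c)"
    and "is_functor C1 C1 (Susp S1)" "is_functor C2 C2 (Susp S2)" "is_functor D D (Susp S)"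
    and "category C1" "category C2"
    and "\<And>B u v w. B \<in> Ob C2 \<Longrightarrow> (u, v, w) \<in> \<Delta>1 \<Longrightarrow>
      (fa F (u, Ide C2 B), fa F (v, Ide C2 B), b (Dom C1 u, B) \<cdot>\<^bsub>D\<^esub> fa F (w, Ide C2 B)) \<in> \<Delta>"
    and "\<And>A u v w. A \<in> Ob C1 \<Longrightarrow> (u, v, w) \<in> \<Delta>2 \<Longrightarrow>
      (fa F (Ide C1 A, u), fa F (Ide C1 A, v), c (A, Dom C2 u) \<cdot>\<^bsub>D\<^esub> fa F (Ide C1 A, w)) \<in> \<Delta>"
  shows "exact_bifunctor C1 S1 \<Delta>1 C2 S2 \<Delta>2 D S \<Delta> (F, b, c)"
  unfolding exact_bifunctor_def exact_functor_def
  using assms(1) suspended_bifunctor_fix [OF assms(1-6)] assms(7,8)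
  by auto

lemma exact_functorD:
  "exact_functor C S \<Delta> D S' \<Delta>' (F, t) \<Longrightarrow> (u, v, w) \<in> \<Delta> \<Longrightarrow>
    (fa F u, fa F v, t (Dom C u) \<cdot>\<^bsub>D\<^esub> fa F w) \<in> \<Delta>'"
  by (auto simp: exact_functor_def)

lemma exact_bifunctorD:
  assumes "exact_bifunctor C1 S1 \<Delta>1 C2 S2 \<Delta>2 D S \<Delta> (F, b, c)"
  shows "B \<in> Ob C2 \<Longrightarrow> (u, v, w) \<in> \<Delta>1 \<Longrightarrow>
      (fa F (u, Ide C2 B), fa F (v, Ide C2 B), b (Dom C1 u, B) \<cdot>\<^bsub>D\<^esub> fa F (w, Ide C2 B)) \<in> \<Delta>"
    and "A \<in> Ob C1 \<Longrightarrow> (u, v, w) \<in> \<Delta>2 \<Longrightarrow>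
      (fa F (Ide C1 A, u), fa F (Ide C1 A, v), c (A, Dom C2 u) \<cdot>\<^bsub>D\<^esub> fa F (Ide C1 A, w)) \<in> \<Delta>"
  using assms exact_functorD [of C1 S1 \<Delta>1 D S \<Delta> "fix_snd C2 B F" "\<lambda>A. b (A, B)" u v w]
    exact_functorD [of C2 S2 \<Delta>2 D S \<Delta> "fix_fst C1 A F" "\<lambda>B. c (A, B)" u v w]
  by (auto simp: exact_bifunctor_def)

lemma triangulated_smcc_triangle:
  assumes "triangulated_smcc C S \<Delta>" "(u, v, w) \<in> \<Delta>"
  shows "u \<in> Ar C" "v \<in> Ar C" "w \<in> Ar C" "Cod C w = fo (Susp S) (Dom C u)"
proof -
  have "candidate_triangle C S (u, v, w)"
    using assms by (auto simp: triangulated_smcc_def triangulated_category_def)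
  then show "u \<in> Ar C" "v \<in> Ar C" "w \<in> Ar C" "Cod C w = fo (Susp S) (Dom C u)"
    by (simp_all add: candidate_triangle_def Hom_def)
qed

section \<open>The two composites\<close>

context suspended_monoidal_functor
begin

text \<open>Composition with \<open>suspended_id\<close> accounts for the functor underlying
  \<open>change_dualizing\<close>; it leaves an identity factor in both structure maps.\<close>

abbreviation tensor_after_f where
  "tensor_after_f \<equiv> suspended_postcomp D (suspended_id D S')
    (suspended_precomp D D D (suspended_tensor D S') (f, t) (f, t))"

abbreviation f_after_tensor where
  "f_after_tensor \<equiv> suspended_postcomp D (f, t) (suspended_tensor C S)"

lemma tensor_after_f_eq:
  "tensor_after_f = (Tensor D \<circ>\<^sub>F f \<times>\<^sub>F f,
    (\<lambda>P. Ide D (D.T\<^sub>o (fo f (fst P) \<odot>\<^bsub>D\<^esub> fo f (snd P))) \<cdot>\<^bsub>D\<^esub>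
      tp1 S' (fo f (fst P), fo f (snd P)) \<cdot>\<^bsub>D\<^esub> (t (fst P) \<star>\<^bsub>D\<^esub> Ide D (fo f (snd P)))),
    (\<lambda>P. Ide D (D.T\<^sub>o (fo f (fst P) \<odot>\<^bsub>D\<^esub> fo f (snd P))) \<cdot>\<^bsub>D\<^esub>
      tp2 S' (fo f (fst P), fo f (snd P)) \<cdot>\<^bsub>D\<^esub> (Ide D (fo f (fst P)) \<star>\<^bsub>D\<^esub> t (snd P))))"
  by (auto simp: suspended_postcomp_def suspended_precomp_def suspended_id_def id_functor_def
      comp_functor_def prod_functor_def comp_def fun_eq_iff split_beta map_prod_def)

lemma f_after_tensor_eq:
  "f_after_tensor = (f \<circ>\<^sub>F Tensor C,
    (\<lambda>P. t (fo (Tensor C) P) \<cdot>\<^bsub>D\<^esub> fa f (tp1 S P)),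
    (\<lambda>P. t (fo (Tensor C) P) \<cdot>\<^bsub>D\<^esub> fa f (tp2 S P)))"
  by (simp add: suspended_postcomp_def)

text \<open>The hypothesis on \<alpha> concerns the composite without \<open>suspended_id\<close>;
  the two differ by identity factors that vanish at objects.\<close>

lemma \<alpha>_suspended_iso:
  "suspended_bifunctor_iso C S C S D S' tensor_after_f f_after_tensor \<alpha>"
proof -
  let ?b = "\<lambda>P. tp1 S' (fo f (fst P), fo f (snd P)) \<cdot>\<^bsub>D\<^esub> (t (fst P) \<star>\<^bsub>D\<^esub> Ide D (fo f (snd P)))"
  let ?c = "\<lambda>P. tp2 S' (fo f (fst P), fo f (snd P)) \<cdot>\<^bsub>D\<^esub> (Ide D (fo f (fst P)) \<star>\<^bsub>D\<^esub> t (snd P))"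
  have pre: "suspended_precomp D D D (suspended_tensor D S') (f, t) (f, t) = (Tensor D \<circ>\<^sub>F f \<times>\<^sub>F f, ?b, ?c)"
    by (auto simp: suspended_precomp_def fun_eq_iff)
  have iso: "suspended_bifunctor_iso C S C S D S' (Tensor D \<circ>\<^sub>F f \<times>\<^sub>F f, ?b, ?c) f_after_tensor \<alpha>"
    using suspended_functor by (simp add: suspended_symmetric_monoidal_functor_def pre)
  then have "suspended_bifunctor C S C S D S' (Tensor D \<circ>\<^sub>F f \<times>\<^sub>F f, ?b, ?c)"
    by (simp add: suspended_bifunctor_iso_def)
  then have "suspended_bifunctor C S C S D S' tensor_after_f"
    unfolding tensor_after_f_eq
    by (subst suspended_bifunctor_cong [where b' = ?b and c' = ?c])
      (simp_all add: C.category_axioms C.susp_functor)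
  then show ?thesis
    using iso by (simp add: suspended_bifunctor_iso_def tensor_after_f_eq f_after_tensor_eq)
qed

section \<open>Suspension compatibility and exactness of both composites\<close>

lemma f_after_tensor_suspended:
  assumes [simp]: "K \<in> Ob C" "M \<in> Ob C"
  shows "suspended_duality_compatible
    C S (dual_functor C K) (dual_suspension C S K) C S (dual_functor C M) (dual_suspension C S M)
    D S' (dual_functor D (fo f (K \<odot>\<^bsub>C\<^esub> M))) (dual_suspension D S' (fo f (K \<odot>\<^bsub>C\<^esub> M)))
    f_after_tensor (snd (dp_comp D (pullback_dp C D f \<alpha> (K \<odot>\<^bsub>C\<^esub> M)) (product_dp C K M)))"
  unfolding suspended_duality_compatible_def f_after_tensor_eq prod.case Let_def
proof (intro ballI conjI)
  fix A B assume [simp]: "A \<in> Ob C" "B \<in> Ob C"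
  let ?\<phi> = "snd (dp_comp D (pullback_dp C D f \<alpha> (K \<odot>\<^bsub>C\<^esub> M)) (product_dp C K M))"
  have \<phi>: "?\<phi> (X, Y) = beta C D f \<alpha> (K \<odot>\<^bsub>C\<^esub> M) (X \<odot>\<^bsub>C\<^esub> Y) \<cdot>\<^bsub>D\<^esub> fa f (tau C K M (X, Y))" for X Y
    by (simp add: dp_comp_def pullback_dp_def product_dp_def)
  note tau = C.tau_suspended [OF assms \<open>A \<in> Ob C\<close> \<open>B \<in> Ob C\<close>]
  show "?\<phi> (A, B) \<cdot>\<^bsub>D\<^esub> fa (f \<circ>\<^sub>F Tensor C) (dual_suspension C S K A, Ide C (fo (dual_functor C M) B)) =
    dual_suspension D S' (fo f (K \<odot>\<^bsub>C\<^esub> M)) (fo (f \<circ>\<^sub>F Tensor C) (A, B)) \<cdot>\<^bsub>D\<^esub>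
      D.T\<^sub>a (fa (dual_functor D (fo f (K \<odot>\<^bsub>C\<^esub> M)))
        (inverse_arrow D (t (A \<odot>\<^bsub>C\<^esub> B) \<cdot>\<^bsub>D\<^esub> fa f (tp1 S (A, B))))) \<cdot>\<^bsub>D\<^esub>
      D.T\<^sub>a (?\<phi> (C.T\<^sub>o A, B)) \<cdot>\<^bsub>D\<^esub>
      t (fo (dual_functor C K) (C.T\<^sub>o A) \<odot>\<^bsub>C\<^esub> fo (dual_functor C M) B) \<cdot>\<^bsub>D\<^esub>
        fa f (tp1 S (fo (dual_functor C K) (C.T\<^sub>o A), fo (dual_functor C M) B))"
    unfolding \<phi> functor_data_simps dual_functor_simps
    \<comment> \<open>The last premise, matched with the rule for \<tau>, determines all arrows; the
      fourteen open ones are typing.\<close>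
    by (rule beta_comp_suspended [OF _ _ _ _ _ _ _ _ _ _ _ _ _ _ tau(1)]) simp_all
  show "?\<phi> (A, B) \<cdot>\<^bsub>D\<^esub> fa (f \<circ>\<^sub>F Tensor C) (Ide C (fo (dual_functor C K) A), dual_suspension C S M B) =
    dual_suspension D S' (fo f (K \<odot>\<^bsub>C\<^esub> M)) (fo (f \<circ>\<^sub>F Tensor C) (A, B)) \<cdot>\<^bsub>D\<^esub>
      D.T\<^sub>a (fa (dual_functor D (fo f (K \<odot>\<^bsub>C\<^esub> M)))
        (inverse_arrow D (t (A \<odot>\<^bsub>C\<^esub> B) \<cdot>\<^bsub>D\<^esub> fa f (tp2 S (A, B))))) \<cdot>\<^bsub>D\<^esub>
      D.T\<^sub>a (?\<phi> (A, C.T\<^sub>o B)) \<cdot>\<^bsub>D\<^esub>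
      t (fo (dual_functor C K) A \<odot>\<^bsub>C\<^esub> fo (dual_functor C M) (C.T\<^sub>o B)) \<cdot>\<^bsub>D\<^esub>
        fa f (tp2 S (fo (dual_functor C K) A, fo (dual_functor C M) (C.T\<^sub>o B)))"
    unfolding \<phi> functor_data_simps dual_functor_simps
    by (rule beta_comp_suspended [OF _ _ _ _ _ _ _ _ _ _ _ _ _ _ tau(2)]) simp_all
qed

text \<open>By \<open>\<alpha>_beta_tau\<close> this transformation is that of the other composite
  with \<alpha> on both sides, so the compatibility proved there carries over by
  \<open>suspended_transport\<close>.\<close>

lemma tensor_after_f_suspended:
  assumes [simp]: "K \<in> Ob C" "M \<in> Ob C"
  shows "suspended_duality_compatible
    C S (dual_functor C K) (dual_suspension C S K) C S (dual_functor C M) (dual_suspension C S M)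
    D S' (dual_functor D (fo f (K \<odot>\<^bsub>C\<^esub> M))) (dual_suspension D S' (fo f (K \<odot>\<^bsub>C\<^esub> M)))
    tensor_after_f (snd (dp_comp D (change_dualizing D (\<alpha> (K, M)))
      (dp_comp D (product_dp D (fo f K) (fo f M))
        (dp_prod (pullback_dp C D f \<alpha> K) (pullback_dp C D f \<alpha> M)))))"
  unfolding suspended_duality_compatible_def tensor_after_f_eq prod.case Let_def
proof (intro ballI, goal_cases)
  case (1 A B)
  then have AB [simp]: "A \<in> Ob C" "B \<in> Ob C"
    by simp_all
  let ?\<phi> = "snd (dp_comp D (change_dualizing D (\<alpha> (K, M)))
      (dp_comp D (product_dp D (fo f K) (fo f M))
        (dp_prod (pullback_dp C D f \<alpha> K) (pullback_dp C D f \<alpha> M))))"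
  let ?\<psi> = "\<lambda>X Y. beta C D f \<alpha> (K \<odot>\<^bsub>C\<^esub> M) (X \<odot>\<^bsub>C\<^esub> Y) \<cdot>\<^bsub>D\<^esub> fa f (tau C K M (X, Y))"
  let ?L = "fo f (K \<odot>\<^bsub>C\<^esub> M)"
  let ?d = "dual_suspension D S' ?L"
  have \<phi>: "?\<phi> (X, Y) = (\<alpha> (X, Y) \<Zinj>\<^bsub>D\<^esub> Ide D ?L) \<cdot>\<^bsub>D\<^esub> ?\<psi> X Y \<cdot>\<^bsub>D\<^esub> \<alpha> (X \<rightarrowtail>\<^bsub>C\<^esub> K, Y \<rightarrowtail>\<^bsub>C\<^esub> M)"
    if "X \<in> Ob C" "Y \<in> Ob C" for X Y
    using \<alpha>_beta_tau [OF assms that]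
    by (simp add: dp_comp_def pullback_dp_def product_dp_def change_dualizing_def dp_prod_def)
  have \<psi>: "?\<psi> A B \<cdot>\<^bsub>D\<^esub> fa f (dual_suspension C S K A \<star>\<^bsub>C\<^esub> Ide C (B \<rightarrowtail>\<^bsub>C\<^esub> M)) =
      ?d (fo f (A \<odot>\<^bsub>C\<^esub> B)) \<cdot>\<^bsub>D\<^esub>
      D.T\<^sub>a (inverse_arrow D (t (A \<odot>\<^bsub>C\<^esub> B) \<cdot>\<^bsub>D\<^esub> fa f (tp1 S (A, B))) \<Zinj>\<^bsub>D\<^esub> Ide D ?L) \<cdot>\<^bsub>D\<^esub>
      D.T\<^sub>a (?\<psi> (C.T\<^sub>o A) B) \<cdot>\<^bsub>D\<^esub> t ((C.T\<^sub>o A \<rightarrowtail>\<^bsub>C\<^esub> K) \<odot>\<^bsub>C\<^esub> (B \<rightarrowtail>\<^bsub>C\<^esub> M)) \<cdot>\<^bsub>D\<^esub>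
      fa f (tp1 S (C.T\<^sub>o A \<rightarrowtail>\<^bsub>C\<^esub> K, B \<rightarrowtail>\<^bsub>C\<^esub> M))"
    "?\<psi> A B \<cdot>\<^bsub>D\<^esub> fa f (Ide C (A \<rightarrowtail>\<^bsub>C\<^esub> K) \<star>\<^bsub>C\<^esub> dual_suspension C S M B) =
      ?d (fo f (A \<odot>\<^bsub>C\<^esub> B)) \<cdot>\<^bsub>D\<^esub>
      D.T\<^sub>a (inverse_arrow D (t (A \<odot>\<^bsub>C\<^esub> B) \<cdot>\<^bsub>D\<^esub> fa f (tp2 S (A, B))) \<Zinj>\<^bsub>D\<^esub> Ide D ?L) \<cdot>\<^bsub>D\<^esub>
      D.T\<^sub>a (?\<psi> A (C.T\<^sub>o B)) \<cdot>\<^bsub>D\<^esub> t ((A \<rightarrowtail>\<^bsub>C\<^esub> K) \<odot>\<^bsub>C\<^esub> (C.T\<^sub>o B \<rightarrowtail>\<^bsub>C\<^esub> M)) \<cdot>\<^bsub>D\<^esub>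
      fa f (tp2 S (A \<rightarrowtail>\<^bsub>C\<^esub> K, C.T\<^sub>o B \<rightarrowtail>\<^bsub>C\<^esub> M))"
    \<comment> \<open>Rules that expand or rebracket composites are switched off, so that the groups
      expected by \<open>suspended_transport\<close> survive.\<close>
    using f_after_tensor_suspended [OF assms] AB
    by (simp_all add: suspended_duality_compatible_def f_after_tensor_eq Let_def
        dp_comp_def pullback_dp_def product_dp_def del: D.Comp_assoc f_simps(6) D.susp_simps(6))
  have fst_eq: "?\<phi> (A, B) \<cdot>\<^bsub>D\<^esub> (fa f (dual_suspension C S K A) \<star>\<^bsub>D\<^esub> fa f (Ide C (B \<rightarrowtail>\<^bsub>C\<^esub> M))) =
      ?d (fo f A \<odot>\<^bsub>D\<^esub> fo f B) \<cdot>\<^bsub>D\<^esub>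
      D.T\<^sub>a (inverse_arrow D (tp1 S' (fo f A, fo f B) \<cdot>\<^bsub>D\<^esub> (t A \<star>\<^bsub>D\<^esub> Ide D (fo f B))) \<Zinj>\<^bsub>D\<^esub> Ide D ?L) \<cdot>\<^bsub>D\<^esub>
      D.T\<^sub>a (?\<phi> (C.T\<^sub>o A, B)) \<cdot>\<^bsub>D\<^esub>
      tp1 S' (fo f (C.T\<^sub>o A \<rightarrowtail>\<^bsub>C\<^esub> K), fo f (B \<rightarrowtail>\<^bsub>C\<^esub> M)) \<cdot>\<^bsub>D\<^esub> (t (C.T\<^sub>o A \<rightarrowtail>\<^bsub>C\<^esub> K) \<star>\<^bsub>D\<^esub> Ide D (fo f (B \<rightarrowtail>\<^bsub>C\<^esub> M)))"
  proof -
    have "?\<phi> (A, B) \<cdot>\<^bsub>D\<^esub> (fa f (dual_suspension C S K A) \<star>\<^bsub>D\<^esub> fa f (Ide C (B \<rightarrowtail>\<^bsub>C\<^esub> M))) =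
      (\<alpha> (A, B) \<Zinj>\<^bsub>D\<^esub> Ide D ?L) \<cdot>\<^bsub>D\<^esub>
        (?\<psi> A B \<cdot>\<^bsub>D\<^esub> fa f (dual_suspension C S K A \<star>\<^bsub>C\<^esub> Ide C (B \<rightarrowtail>\<^bsub>C\<^esub> M))) \<cdot>\<^bsub>D\<^esub> \<alpha> (C.T\<^sub>o (C.T\<^sub>o A \<rightarrowtail>\<^bsub>C\<^esub> K), B \<rightarrowtail>\<^bsub>C\<^esub> M)"
      using \<alpha>_nat [of "dual_suspension C S K A" "Ide C (B \<rightarrowtail>\<^bsub>C\<^esub> M)"] by (simp add: \<phi>)
    also have "\<dots> = ?d (fo f A \<odot>\<^bsub>D\<^esub> fo f B) \<cdot>\<^bsub>D\<^esub>
      D.T\<^sub>a (inverse_arrow D (tp1 S' (fo f A, fo f B) \<cdot>\<^bsub>D\<^esub> (t A \<star>\<^bsub>D\<^esub> Ide D (fo f B))) \<Zinj>\<^bsub>D\<^esub> Ide D ?L) \<cdot>\<^bsub>D\<^esub>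
      D.T\<^sub>a ((\<alpha> (C.T\<^sub>o A, B) \<Zinj>\<^bsub>D\<^esub> Ide D ?L) \<cdot>\<^bsub>D\<^esub> ?\<psi> (C.T\<^sub>o A) B \<cdot>\<^bsub>D\<^esub> \<alpha> (C.T\<^sub>o A \<rightarrowtail>\<^bsub>C\<^esub> K, B \<rightarrowtail>\<^bsub>C\<^esub> M)) \<cdot>\<^bsub>D\<^esub>
      tp1 S' (fo f (C.T\<^sub>o A \<rightarrowtail>\<^bsub>C\<^esub> K), fo f (B \<rightarrowtail>\<^bsub>C\<^esub> M)) \<cdot>\<^bsub>D\<^esub> (t (C.T\<^sub>o A \<rightarrowtail>\<^bsub>C\<^esub> K) \<star>\<^bsub>D\<^esub> Ide D (fo f (B \<rightarrowtail>\<^bsub>C\<^esub> M)))"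
      \<comment> \<open>Here \<open>a\<close>, \<open>p\<close>, \<open>w\<close> and
        \<open>v\<close> are \<alpha> at \<open>(A, B)\<close>, at \<open>(T A, B)\<close>, at the
        duals of the latter pair, and at those duals with \<open>T\<close> applied to the first.
        Both squares are then instances of \<open>\<alpha>_tp\<close>.\<close>
      unfolding \<psi>
      by (rule suspended_transport) (simp_all add: D.tensor_iso f_iso \<alpha>_tp)
    finally show ?thesis
      by (simp only: \<phi> AB C.susp_simps(1))
  qed
  have snd_eq: "?\<phi> (A, B) \<cdot>\<^bsub>D\<^esub> (fa f (Ide C (A \<rightarrowtail>\<^bsub>C\<^esub> K)) \<star>\<^bsub>D\<^esub> fa f (dual_suspension C S M B)) =
      ?d (fo f A \<odot>\<^bsub>D\<^esub> fo f B) \<cdot>\<^bsub>D\<^esub>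
      D.T\<^sub>a (inverse_arrow D (tp2 S' (fo f A, fo f B) \<cdot>\<^bsub>D\<^esub> (Ide D (fo f A) \<star>\<^bsub>D\<^esub> t B)) \<Zinj>\<^bsub>D\<^esub> Ide D ?L) \<cdot>\<^bsub>D\<^esub>
      D.T\<^sub>a (?\<phi> (A, C.T\<^sub>o B)) \<cdot>\<^bsub>D\<^esub>
      tp2 S' (fo f (A \<rightarrowtail>\<^bsub>C\<^esub> K), fo f (C.T\<^sub>o B \<rightarrowtail>\<^bsub>C\<^esub> M)) \<cdot>\<^bsub>D\<^esub> (Ide D (fo f (A \<rightarrowtail>\<^bsub>C\<^esub> K)) \<star>\<^bsub>D\<^esub> t (C.T\<^sub>o B \<rightarrowtail>\<^bsub>C\<^esub> M))"
  proof -
    have "?\<phi> (A, B) \<cdot>\<^bsub>D\<^esub> (fa f (Ide C (A \<rightarrowtail>\<^bsub>C\<^esub> K)) \<star>\<^bsub>D\<^esub> fa f (dual_suspension C S M B)) =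
      (\<alpha> (A, B) \<Zinj>\<^bsub>D\<^esub> Ide D ?L) \<cdot>\<^bsub>D\<^esub>
        (?\<psi> A B \<cdot>\<^bsub>D\<^esub> fa f (Ide C (A \<rightarrowtail>\<^bsub>C\<^esub> K) \<star>\<^bsub>C\<^esub> dual_suspension C S M B)) \<cdot>\<^bsub>D\<^esub> \<alpha> (A \<rightarrowtail>\<^bsub>C\<^esub> K, C.T\<^sub>o (C.T\<^sub>o B \<rightarrowtail>\<^bsub>C\<^esub> M))"
      using \<alpha>_nat [of "Ide C (A \<rightarrowtail>\<^bsub>C\<^esub> K)" "dual_suspension C S M B"] by (simp add: \<phi>)
    also have "\<dots> = ?d (fo f A \<odot>\<^bsub>D\<^esub> fo f B) \<cdot>\<^bsub>D\<^esub>
      D.T\<^sub>a (inverse_arrow D (tp2 S' (fo f A, fo f B) \<cdot>\<^bsub>D\<^esub> (Ide D (fo f A) \<star>\<^bsub>D\<^esub> t B)) \<Zinj>\<^bsub>D\<^esub> Ide D ?L) \<cdot>\<^bsub>D\<^esub>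
      D.T\<^sub>a ((\<alpha> (A, C.T\<^sub>o B) \<Zinj>\<^bsub>D\<^esub> Ide D ?L) \<cdot>\<^bsub>D\<^esub> ?\<psi> A (C.T\<^sub>o B) \<cdot>\<^bsub>D\<^esub> \<alpha> (A \<rightarrowtail>\<^bsub>C\<^esub> K, C.T\<^sub>o B \<rightarrowtail>\<^bsub>C\<^esub> M)) \<cdot>\<^bsub>D\<^esub>
      tp2 S' (fo f (A \<rightarrowtail>\<^bsub>C\<^esub> K), fo f (C.T\<^sub>o B \<rightarrowtail>\<^bsub>C\<^esub> M)) \<cdot>\<^bsub>D\<^esub> (Ide D (fo f (A \<rightarrowtail>\<^bsub>C\<^esub> K)) \<star>\<^bsub>D\<^esub> t (C.T\<^sub>o B \<rightarrowtail>\<^bsub>C\<^esub> M))"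
      unfolding \<psi>
      by (rule suspended_transport) (simp_all add: D.tensor_iso f_iso \<alpha>_tp)
    finally show ?thesis
      by (simp only: \<phi> AB C.susp_simps(1))
  qed
  show ?case
    using fst_eq snd_eq by simp
qed

text \<open>In each variable this is an exact functor, tensoring with a fixed object, followed by
  the exact \<open>f\<close>; the third arrows agree because the suspension maps compose.\<close>

lemma f_after_tensor_exact:
  assumes C: "triangulated_smcc C S \<Delta>" and f: "exact_functor C S \<Delta> D S' \<Delta>' (f, t)"
  shows "exact_bifunctor C S \<Delta> C S \<Delta> D S' \<Delta>' f_after_tensor"
proof -
  have tensor: "exact_bifunctor C S \<Delta> C S \<Delta> C S \<Delta> (suspended_tensor C S)"
    using C by (simp add: triangulated_smcc_def)
  have "suspended_bifunctor C S C S D S' f_after_tensor"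
    using \<alpha>_suspended_iso by (simp add: suspended_bifunctor_iso_def)
  then show ?thesis
    unfolding f_after_tensor_eq
  proof (rule exact_bifunctorI)
    fix B u v w assume "B \<in> Ob C" and uvw: "(u, v, w) \<in> \<Delta>"
    then show "(fa (f \<circ>\<^sub>F Tensor C) (u, Ide C B), fa (f \<circ>\<^sub>F Tensor C) (v, Ide C B),
        (t (Dom C u \<odot>\<^bsub>C\<^esub> B) \<cdot>\<^bsub>D\<^esub> fa f (tp1 S (Dom C u, B))) \<cdot>\<^bsub>D\<^esub>
          fa (f \<circ>\<^sub>F Tensor C) (w, Ide C B)) \<in> \<Delta>'"
      using exact_functorD [OF f exact_bifunctorD(1) [OF tensor _ uvw]]
      by (simp add: triangulated_smcc_triangle [OF C uvw])
  next
    fix A u v w assume "A \<in> Ob C" and uvw: "(u, v, w) \<in> \<Delta>"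
    then show "(fa (f \<circ>\<^sub>F Tensor C) (Ide C A, u), fa (f \<circ>\<^sub>F Tensor C) (Ide C A, v),
        (t (A \<odot>\<^bsub>C\<^esub> Dom C u) \<cdot>\<^bsub>D\<^esub> fa f (tp2 S (A, Dom C u))) \<cdot>\<^bsub>D\<^esub>
          fa (f \<circ>\<^sub>F Tensor C) (Ide C A, w)) \<in> \<Delta>'"
      using exact_functorD [OF f exact_bifunctorD(2) [OF tensor _ uvw]]
      by (simp add: triangulated_smcc_triangle [OF C uvw])
  qed (simp_all add: C.susp_functor D.susp_functor C.category_axioms)
qed

lemma tensor_after_f_exact:
  assumes C: "triangulated_smcc C S \<Delta>" and D: "triangulated_smcc D S' \<Delta>'"
    and f: "exact_functor C S \<Delta> D S' \<Delta>' (f, t)"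
  shows "exact_bifunctor C S \<Delta> C S \<Delta> D S' \<Delta>' tensor_after_f"
proof -
  have tensor: "exact_bifunctor D S' \<Delta>' D S' \<Delta>' D S' \<Delta>' (suspended_tensor D S')"
    using D by (simp add: triangulated_smcc_def)
  have "suspended_bifunctor C S C S D S' tensor_after_f"
    using \<alpha>_suspended_iso by (simp add: suspended_bifunctor_iso_def)
  then show ?thesis
    unfolding tensor_after_f_eq
  \<comment> \<open>Cases 6 and 7 are the triangles in the first and second variable:
    \<open>f\<close> is applied first, then the tensor product with the image of the fixed
    object.\<close>
  proof (rule exact_bifunctorI, goal_cases)
    case (6 B u v w)
    then show ?case
      using exact_bifunctorD(1) [OF tensor _ exact_functorD [OF f 6(2)], of "fo f B"]
      by (simp add: triangulated_smcc_triangle [OF C 6(2)])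
  next
    case (7 A u v w)
    then show ?case
      using exact_bifunctorD(2) [OF tensor _ exact_functorD [OF f 7(2)], of "fo f A"]
      by (simp add: triangulated_smcc_triangle [OF C 7(2)])
  qed (simp_all add: C.susp_functor D.susp_functor C.category_axioms)
qed

end

lemma triangulated_smcc_suspended: "triangulated_smcc C S \<Delta> \<Longrightarrow> suspended_smcc C S"
  by (simp add: triangulated_smcc_def)

text \<open>The suspended and triangulated variants are implications inside one statement, so that
  the same functors and the same \<alpha> serve all three settings.\<close>

theorem proposition5p4p1:
  fixes C1 :: "('o, 'a) smcc_data" and C2 :: "('p, 'b) smcc_data"
    and f :: "('o, 'a, 'p, 'b) functor_data" and \<alpha> :: "'o \<times> 'o \<Rightarrow> 'b"
    and K M :: 'o
    and S1 :: "('o, 'a) tensor_suspension_data" and S2 :: "('p, 'b) tensor_suspension_data"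
    and t :: "'o \<Rightarrow> 'b"
    and \<Delta>1 :: "('a \<times> 'a \<times> 'a) set" and \<Delta>2 :: "('b \<times> 'b \<times> 'b) set"
  assumes "symmetric_monoidal_closed_category C1"
    and "symmetric_monoidal_closed_category C2"
    and "symmetric_monoidal_functor C1 C2 f \<alpha>"
    and "K \<in> Ob C1" and "M \<in> Ob C1"
  shows
    "let L = fo f (K \<odot>\<^bsub>C1\<^esub> M);
         \<Phi> = dp_comp C2 (change_dualizing C2 (\<alpha> (K, M)))
               (dp_comp C2 (product_dp C2 (fo f K) (fo f M))
                 (dp_prod (pullback_dp C1 C2 f \<alpha> K) (pullback_dp C1 C2 f \<alpha> M)));
         \<Psi> = dp_comp C2 (pullback_dp C1 C2 f \<alpha> (K \<odot>\<^bsub>C1\<^esub> M)) (product_dp C1 K M);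
         F = suspended_postcomp C2 (suspended_id C2 S2)
               (suspended_precomp C2 C2 C2 (suspended_tensor C2 S2) (f, t) (f, t));
         G = suspended_postcomp C2 (f, t) (suspended_tensor C1 S1);
         compatible = suspended_duality_compatible
               C1 S1 (dual_functor C1 K) (dual_suspension C1 S1 K)
               C1 S1 (dual_functor C1 M) (dual_suspension C1 S1 M)
               C2 S2 (dual_functor C2 L) (dual_suspension C2 S2 L)
     in duality_preserving_iso
          (prod_duality (with_duality C1 K) (with_duality C1 M)) (with_duality C2 L) \<Phi> \<Psi> \<alpha> \<and>
        (suspended_smcc C1 S1 \<and> suspended_smcc C2 S2 \<and>
         suspended_symmetric_monoidal_functor C1 S1 C2 S2 f t \<alpha> \<longrightarrow>
           suspended_bifunctor_iso C1 S1 C1 S1 C2 S2 F G \<alpha> \<and>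
           compatible F (snd \<Phi>) \<and> compatible G (snd \<Psi>)) \<and>
        (triangulated_smcc C1 S1 \<Delta>1 \<and> triangulated_smcc C2 S2 \<Delta>2 \<and>
         suspended_symmetric_monoidal_functor C1 S1 C2 S2 f t \<alpha> \<and>
         exact_functor C1 S1 \<Delta>1 C2 S2 \<Delta>2 (f, t) \<longrightarrow>
           exact_bifunctor C1 S1 \<Delta>1 C1 S1 \<Delta>1 C2 S2 \<Delta>2 F \<and>
           exact_bifunctor C1 S1 \<Delta>1 C1 S1 \<Delta>1 C2 S2 \<Delta>2 G)"
proof -
  interpret C1: symmetric_monoidal_closed_category C1 by fact
  interpret C2: symmetric_monoidal_closed_category C2 by fact
  interpret closed_monoidal_functor C1 C2 f \<alpha>
    by unfold_locales fact
  \<comment> \<open>The suspension hypotheses are premises of single conjuncts, so this locale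
    cannot be interpreted once for the whole proof; its facts are used conditionally.\<close>
  have f_suspended: "suspended_monoidal_functor C1 C2 f \<alpha> S1 S2 t"
    if "suspended_smcc C1 S1" "suspended_smcc C2 S2"
      "suspended_symmetric_monoidal_functor C1 S1 C2 S2 f t \<alpha>"
    using that by unfold_locales
  show ?thesis
    unfolding Let_def
    using \<alpha>_duality_preserving_iso [OF assms(4,5)]
      suspended_monoidal_functor.\<alpha>_suspended_iso [OF f_suspended]
      suspended_monoidal_functor.tensor_after_f_suspended [OF f_suspended assms(4,5)]
      suspended_monoidal_functor.f_after_tensor_suspended [OF f_suspended assms(4,5)]
      suspended_monoidal_functor.tensor_after_f_exact [OF f_suspended]
      suspended_monoidal_functor.f_after_tensor_exact [OF f_suspended]
      triangulated_smcc_suspended [of C1 S1 \<Delta>1] triangulated_smcc_suspended [of C2 S2 \<Delta>2]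
    by blast
qed

end
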